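(* Let $p\in(2,3)$. Let $\eta\colon[0,T]\to\mathbb{R}^d$ be a (deterministic) $\frac1p$-Hölder continuous path which satisfies Property (RIE) relative to $p$ and the sequence of dyadic partitions $(\mathcal{P}^n_D)_{n\in\mathbb{N}}$, $\mathcal{P}^n_D=\{k2^{-n}T:k=0,1,\ldots,2^n\}$, and write $\boldsymbol{\eta}=(\boldsymbol{\eta}^1,\boldsymbol{\eta}^2)$ for the canonical rough path lift of $\eta$, so that $\boldsymbol{\eta}^1=\eta$ and $\boldsymbol{\eta}^2_{s,t}=\int_s^t\eta_{s,u}\otimes\mathrm{d}\eta_u$ for every $(s,t)\in\Delta_T$. Let $W$ be an $\mathbb{R}^e$-valued Brownian motion, and write $\mathbf{W}=(W,\mathbb{W})$ for the Itô rough path lift of $W$, so that $\mathbb{W}_{s,t}=\int_s^tW_{s,u}\otimes\mathrm{d}W_u$, defined as an Itô integral, for every $(s,t)\in\Delta_T$. For any $p'\in(p,3)$ and almost every $\omega\in\Omega$, the $\mathbb{R}^{d+e}$-valued path $(\eta,W(\omega))$ satisfies Property (RIE) relative to $p'$ and $(\mathcal{P}^n_D)_{n\in\mathbb{N}}$. Moreover, for almost every $\omega\in\Omega$, the canonical rough path lift $\boldsymbol{\Lambda}(\omega)=(\boldsymbol{\Lambda}^1(\omega),\boldsymbol{\Lambda}^2(\omega))$ of $(\eta,W(\omega))$, with values in $\mathbb{R}^{d+e}\oplus\mathbb{R}^{(d+e)\times(d+e)}$, constructed via Property (RIE), is given by $\boldsymbol{\Lambda}^1(\omega)=(\eta,W(\omega))$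 and $$\boldsymbol{\Lambda}^2_{s,t}=\begin{pmatrix} \boldsymbol{\eta}^2_{s,t} & \int_s^t\eta_{s,u}\otimes\mathrm{d}W_u \\ {W}_{s,t}\otimes\eta_{s,t}-(\int_s^t\eta_{s,u}\otimes\mathrm{d}W_u)^\top & \mathbb{W}_{s,t} \end{pmatrix}$$ for every $(s,t)\in\Delta_T$, where $\int_s^t\eta_{s,u}\otimes\mathrm{d}W_u$ is defined as an Itô integral, and $(\cdot)^\top$ denotes matrix transposition.
   Context: $T>0$ is a fixed time horizon; $W$ is a Brownian motion on a filtered probability space $(\Omega,\mathcal{F},(\mathcal{F}_t)_{t\in[0,T]},\mathbb{P})$ satisfying the usual conditions. Notation. $\Delta_T=\{(s,t)\in[0,T]^2:s\le t\}$; $X_{s,t}=X_t-X_s$; $x\otimes y=(x^iy^j)_{i,j}$; $|\mathcal{P}|=\max_i|u_{i+1}-u_i|$ is the mesh size of a partition. A control function is $w\colon\Delta_T\to[0,\infty)$ with $w(s,u)+w(u,t)\le w(s,t)$ for $s\le u\le t$. Convention: $\frac00:=0$. Property (RIE). Let $p\in(2,3)$ and let $\mathcal{P}^n=\{0=t^n_0<\cdots<t^n_{N_n}=T\}$ be a sequence of partitions of $[0,T]$ with $|\mathcal{P}^n|\to0$. For a càdlàg path $X\colon[0,T]\to\mathbb{R}^d$ put $X^n_t=X_T\mathbf{1}_{\{T\}}(t)+\sum_{k=0}^{N_n-1}X_{t^n_k}\mathbf{1}_{[t^n_k,t^n_{k+1})}(t)$. $X$ satisfies Property (RIE) relative to $p$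 and $(\mathcal{P}^n)$ if: (i) $X^n\to X$ uniformly; (ii) the Riemann sums $\int_0^tX^n_u\otimes\mathrm{d}X_u:=\sum_{k=0}^{N_n-1}X_{t^n_k}\otimes X_{t^n_k\wedge t,t^n_{k+1}\wedge t}$ converge uniformly in $t\in[0,T]$ to a limit, denoted $\int_0^tX_u\otimes\mathrm{d}X_u$; (iii) there is a control function $w$ such that $$\sup_{(s,t)\in\Delta_T}\frac{|X_{s,t}|^p}{w(s,t)}+\sup_{n\in\mathbb{N}}\sup_{0\le k<\ell\le N_n}\frac{|\int_{t^n_k}^{t^n_\ell}X^n_u\otimes\mathrm{d}X_u-X_{t^n_k}\otimes X_{t^n_k,t^n_\ell}|^{p/2}}{w(t^n_k,t^n_\ell)}\le1,$$ where integrals over $[s,t]$ are differences of those over $[0,t]$ and $[0,s]$. The canonical rough path lift of such an $X$ is $\mathbf{X}=(X,\mathbb{X})$ with $\mathbb{X}_{s,t}=\int_s^tX_{s,u}\otimes\mathrm{d}X_u:=\int_s^tX_u\otimes\mathrm{d}X_u-X_s\otimes X_{s,t}$. *)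

theory Defs
  imports "HOL-Probability.Probability"
begin

definition Simplex :: "real \<Rightarrow> (real \<times> real) set" where
  "Simplex T = {(s, t). 0 \<le> s \<and> s \<le> t \<and> t \<le> T}"

definition tensor :: "real ^ 'm \<Rightarrow> real ^ 'n \<Rightarrow> real ^ 'n ^ 'm" where
  "tensor x y = (\<chi> i j. x $ i * y $ j)"

definition join_vec :: "real ^ 'd \<Rightarrow> real ^ 'e \<Rightarrow> real ^ ('d + 'e)" where
  "join_vec x y = (\<chi> k. case k of Inl i \<Rightarrow> x $ i | Inr j \<Rightarrow> y $ j)"

definition block_mat ::
  "real ^ 'd ^ 'd \<Rightarrow> real ^ 'e ^ 'd \<Rightarrow> real ^ 'd ^ 'e \<Rightarrow> real ^ 'e ^ 'e \<Rightarrow>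
    real ^ ('d + 'e) ^ ('d + 'e)" where
  "block_mat A B C D = (\<chi> k l.
     case k of
       Inl i \<Rightarrow> (case l of Inl i' \<Rightarrow> A $ i $ i' | Inr j' \<Rightarrow> B $ i $ j')
     | Inr j \<Rightarrow> (case l of Inl i' \<Rightarrow> C $ j $ i' | Inr j' \<Rightarrow> D $ j $ j'))"


section \<open>Property (RIE)\<close>

definition is_partition :: "real \<Rightarrow> nat \<Rightarrow> (nat \<Rightarrow> real) \<Rightarrow> bool" where
  "is_partition T N \<tau> \<longleftrightarrow> \<tau> 0 = 0 \<and> \<tau> N = T \<and> (\<forall>k<N. \<tau> k < \<tau> (Suc k))"

definition mesh :: "nat \<Rightarrow> (nat \<Rightarrow> real) \<Rightarrow> real" where
  "mesh N \<tau> = Max ((\<lambda>k. \<bar>\<tau> (Suc k) - \<tau> k\<bar>) ` {..<N})"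

definition cadlag_on :: "real \<Rightarrow> (real \<Rightarrow> 'b::topological_space) \<Rightarrow> bool" where
  "cadlag_on T X \<longleftrightarrow>
     (\<forall>t\<in>{0..<T}. (X \<longlongrightarrow> X t) (at_right t)) \<and>
     (\<forall>t\<in>{0<..T}. \<exists>l. (X \<longlongrightarrow> l) (at_left t))"

definition control :: "real \<Rightarrow> (real \<Rightarrow> real \<Rightarrow> real) \<Rightarrow> bool" where
  "control T w \<longleftrightarrow>
     (\<forall>(s, t)\<in>Simplex T. 0 \<le> w s t) \<and>
     (\<forall>s u t. 0 \<le> s \<and> s \<le> u \<and> u \<le> t \<and> t \<le> T \<longrightarrow> w s u + w u t \<le> w s t)"

definition step_path ::
  "real \<Rightarrow> nat \<Rightarrow> (nat \<Rightarrow> real) \<Rightarrow> (real \<Rightarrow> real ^ 'm) \<Rightarrow> real \<Rightarrow> real ^ 'm" where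
  "step_path T N \<tau> X t =
     indicator {T} t *\<^sub>R X T +
     (\<Sum>k<N. indicator {\<tau> k..<\<tau> (Suc k)} t *\<^sub>R X (\<tau> k))"

definition riemann_sum ::
  "nat \<Rightarrow> (nat \<Rightarrow> real) \<Rightarrow> (real \<Rightarrow> real ^ 'm) \<Rightarrow> real \<Rightarrow> real ^ 'm ^ 'm" where
  "riemann_sum N \<tau> X t =
     (\<Sum>k<N. tensor (X (\<tau> k)) (X (min (\<tau> (Suc k)) t) - X (min (\<tau> k) t)))"

text \<open>
  The suprema are taken in \<^typ>\<open>ennreal\<close>, where \<open>0 / 0 = 0\<close> but \<open>x / 0 = \<infinity>\<close> for \<open>x > 0\<close>;
  real division would make the bound vacuous wherever the control vanishes.
\<close>

definition RIE ::
  "real \<Rightarrow> real \<Rightarrow> (nat \<Rightarrow> nat) \<Rightarrow> (nat \<Rightarrow> nat \<Rightarrow> real) \<Rightarrow> (real \<Rightarrow> real ^ 'm) \<Rightarrow> bool" where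
  "RIE T p N \<tau> X \<longleftrightarrow>
     (\<forall>n. is_partition T (N n) (\<tau> n)) \<and>
     (\<lambda>n. mesh (N n) (\<tau> n)) \<longlonglongrightarrow> 0 \<and>
     cadlag_on T X \<and>
     uniform_limit {0..T} (\<lambda>n. step_path T (N n) (\<tau> n) X) X sequentially \<and>
     uniformly_convergent_on {0..T} (\<lambda>n. riemann_sum (N n) (\<tau> n) X) \<and>
     (\<exists>w. control T w \<and>
       (SUP (s, t)\<in>Simplex T. ennreal (norm (X t - X s) powr p) / ennreal (w s t)) +
       (SUP n. SUP (k, l)\<in>{(k, l). k < l \<and> l \<le> N n}.
          ennreal (norm (riemann_sum (N n) (\<tau> n) X (\<tau> n l) - riemann_sum (N n) (\<tau> n) X (\<tau> n k)
                     - tensor (X (\<tau> n k)) (X (\<tau> n l) - X (\<tau> n k))) powr (p / 2))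
          / ennreal (w (\<tau> n k) (\<tau> n l)))
       \<le> 1)"

definition RIE_integral ::
  "(nat \<Rightarrow> nat) \<Rightarrow> (nat \<Rightarrow> nat \<Rightarrow> real) \<Rightarrow> (real \<Rightarrow> real ^ 'm) \<Rightarrow> real \<Rightarrow> real ^ 'm ^ 'm" where
  "RIE_integral N \<tau> X t = lim (\<lambda>n. riemann_sum (N n) (\<tau> n) X t)"

definition canonical_lift ::
  "(nat \<Rightarrow> nat) \<Rightarrow> (nat \<Rightarrow> nat \<Rightarrow> real) \<Rightarrow> (real \<Rightarrow> real ^ 'm) \<Rightarrow>
    (real \<Rightarrow> real ^ 'm) \<times> (real \<Rightarrow> real \<Rightarrow> real ^ 'm ^ 'm)" where
  "canonical_lift N \<tau> X =
     (X, \<lambda>s t. RIE_integral N \<tau> X t - RIE_integral N \<tau> X s - tensor (X s) (X t - X s))"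

definition dyadic_size :: "nat \<Rightarrow> nat" where
  "dyadic_size n = 2 ^ n"

definition dyadic :: "real \<Rightarrow> nat \<Rightarrow> nat \<Rightarrow> real" where
  "dyadic T n k = real k * T / 2 ^ n"

definition holder_on :: "real \<Rightarrow> real \<Rightarrow> (real \<Rightarrow> 'b::metric_space) \<Rightarrow> bool" where
  "holder_on T \<alpha> X \<longleftrightarrow>
     (\<exists>C. \<forall>s\<in>{0..T}. \<forall>t\<in>{0..T}. dist (X s) (X t) \<le> C * \<bar>t - s\<bar> powr \<alpha>)"


section \<open>Brownian motion on a filtered probability space\<close>

definition usual_conditions :: "'a measure \<Rightarrow> (real \<Rightarrow> 'a measure) \<Rightarrow> real \<Rightarrow> bool" where
  "usual_conditions M F T \<longleftrightarrow>
     prob_space M \<and> complete_measure M \<and>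
     (\<forall>t\<in>{0..T}. subalgebra M (F t)) \<and>
     (\<forall>(s, t)\<in>Simplex T. sets (F s) \<subseteq> sets (F t)) \<and>
     null_sets M \<subseteq> sets (F 0) \<and>
     (\<forall>t\<in>{0..<T}. sets (F t) = (\<Inter>u\<in>{t<..T}. sets (F u)))"

definition brownian_motion ::
  "'a measure \<Rightarrow> (real \<Rightarrow> 'a measure) \<Rightarrow> real \<Rightarrow> (real \<Rightarrow> 'a \<Rightarrow> real ^ 'e) \<Rightarrow> bool" where
  "brownian_motion M F T W \<longleftrightarrow>
     (\<forall>t\<in>{0..T}. W t \<in> borel_measurable (F t)) \<and>
     (AE \<omega> in M. W 0 \<omega> = 0) \<and>
     (AE \<omega> in M. continuous_on {0..T} (\<lambda>t. W t \<omega>)) \<and>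
     (\<forall>s t. 0 \<le> s \<and> s < t \<and> t \<le> T \<longrightarrow>
        prob_space.indep_set M (sets (F s))
          (sets (vimage_algebra (space M) (\<lambda>\<omega>. W t \<omega> - W s \<omega>) borel)) \<and>
        distributed M lborel (\<lambda>\<omega>. W t \<omega> - W s \<omega>)
          (\<lambda>x. ennreal (\<Prod>j\<in>UNIV. normal_density 0 (sqrt (t - s)) (x $ j))))"


section \<open>The It\^o integral\<close>

text \<open>
  A simple integrand on \<open>[s, t]\<close> is given by grid points \<open>s = \<tau>\<^sub>0 \<le> \<dots> \<le> \<tau>\<^sub>N = t\<close> and bounded
  coefficients, the \<open>k\<close>-th of which is measurable at the left end point \<open>\<tau>\<^sub>k\<close>.
\<close>

definition simple_integrand ::
  "'a measure \<Rightarrow> (real \<Rightarrow> 'a measure) \<Rightarrow> real \<Rightarrow> real \<Rightarrow>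
    nat \<Rightarrow> (nat \<Rightarrow> real) \<Rightarrow> (nat \<Rightarrow> 'a \<Rightarrow> real) \<Rightarrow> bool" where
  "simple_integrand M F s t N \<tau> \<xi> \<longleftrightarrow>
     \<tau> 0 = s \<and> \<tau> N = t \<and> (\<forall>k<N. \<tau> k \<le> \<tau> (Suc k)) \<and>
     (\<forall>k<N. \<xi> k \<in> borel_measurable (F (\<tau> k)) \<and> (\<exists>C. \<forall>\<omega>\<in>space M. \<bar>\<xi> k \<omega>\<bar> \<le> C))"

definition simple_process ::
  "nat \<Rightarrow> (nat \<Rightarrow> real) \<Rightarrow> (nat \<Rightarrow> 'a \<Rightarrow> real) \<Rightarrow> real \<Rightarrow> 'a \<Rightarrow> real" where
  "simple_process N \<tau> \<xi> u \<omega> = (\<Sum>k<N. \<xi> k \<omega> * indicator {\<tau> k<..\<tau> (Suc k)} u)"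

definition simple_integral ::
  "nat \<Rightarrow> (nat \<Rightarrow> real) \<Rightarrow> (nat \<Rightarrow> 'a \<Rightarrow> real) \<Rightarrow> (real \<Rightarrow> 'a \<Rightarrow> real) \<Rightarrow> 'a \<Rightarrow> real" where
  "simple_integral N \<tau> \<xi> B \<omega> = (\<Sum>k<N. \<xi> k \<omega> * (B (\<tau> (Suc k)) \<omega> - B (\<tau> k) \<omega>))"

text \<open>
  \<open>Z\<close> is a version of \<open>\<integral>\<^sub>s\<^sup>t H\<^sub>u dB\<^sub>u\<close> for an adapted, measurable, square-integrable integrand \<open>H\<close>.
  Joint measurability refers to the completed product measure because Brownian paths are only
  required to be continuous almost surely.
\<close>

definition has_ito_integral ::
  "'a measure \<Rightarrow> (real \<Rightarrow> 'a measure) \<Rightarrow> real \<Rightarrow> real \<Rightarrow>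
    (real \<Rightarrow> 'a \<Rightarrow> real) \<Rightarrow> (real \<Rightarrow> 'a \<Rightarrow> real) \<Rightarrow> ('a \<Rightarrow> real) \<Rightarrow> bool" where
  "has_ito_integral M F s t H B Z \<longleftrightarrow>
     (\<forall>u\<in>{s..t}. H u \<in> borel_measurable (F u)) \<and>
     (\<lambda>(u, \<omega>). H u \<omega>) \<in>
       borel_measurable (completion (restrict_space lborel {s..t} \<Otimes>\<^sub>M M)) \<and>
     Z \<in> borel_measurable M \<and>
     (\<exists>N \<tau> \<xi>.
        (\<forall>n. simple_integrand M F s t (N n) (\<tau> n) (\<xi> n)) \<and>
        (\<lambda>n. \<integral>\<^sup>+ (u, \<omega>). ennreal ((simple_process (N n) (\<tau> n) (\<xi> n) u \<omega> - H u \<omega>)\<^sup>2)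
               \<partial>completion (restrict_space lborel {s..t} \<Otimes>\<^sub>M M)) \<longlonglongrightarrow> 0 \<and>
        (\<lambda>n. \<integral>\<^sup>+ \<omega>. ennreal ((simple_integral (N n) (\<tau> n) (\<xi> n) B \<omega> - Z \<omega>)\<^sup>2) \<partial>M) \<longlonglongrightarrow> 0)"

text \<open>
  For fixed \<open>(s, t)\<close> the It\^o integral \<open>\<integral>\<^sub>s\<^sup>t Y\<^sub>s\<^sub>,\<^sub>u \<otimes> dB\<^sub>u\<close> is only determined almost surely; a pathwise
  statement for all \<open>(s, t)\<close> at once needs a version that is continuous in \<open>(s, t)\<close>, which is unique
  up to indistinguishability.
\<close>

definition is_ito_tensor_version ::
  "'a measure \<Rightarrow> (real \<Rightarrow> 'a measure) \<Rightarrow> real \<Rightarrow>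
    (real \<Rightarrow> 'a \<Rightarrow> real ^ 'm) \<Rightarrow> (real \<Rightarrow> 'a \<Rightarrow> real ^ 'n) \<Rightarrow>
    (real \<Rightarrow> real \<Rightarrow> 'a \<Rightarrow> real ^ 'n ^ 'm) \<Rightarrow> bool" where
  "is_ito_tensor_version M F T Y B J \<longleftrightarrow>
     (\<forall>(s, t)\<in>Simplex T. \<forall>i j.
        has_ito_integral M F s t (\<lambda>u \<omega>. (Y u \<omega> - Y s \<omega>) $ i) (\<lambda>u \<omega>. B u \<omega> $ j)
          (\<lambda>\<omega>. J s t \<omega> $ i $ j)) \<and>
     (AE \<omega> in M. continuous_on (Simplex T) (\<lambda>(s, t). J s t \<omega>))"

definition ito_tensor ::
  "'a measure \<Rightarrow> (real \<Rightarrow> 'a measure) \<Rightarrow> real \<Rightarrow>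
    (real \<Rightarrow> 'a \<Rightarrow> real ^ 'm) \<Rightarrow> (real \<Rightarrow> 'a \<Rightarrow> real ^ 'n) \<Rightarrow>
    real \<Rightarrow> real \<Rightarrow> 'a \<Rightarrow> real ^ 'n ^ 'm" where
  "ito_tensor M F T Y B = (SOME J. is_ito_tensor_version M F T Y B J)"

end

theory Submission
  imports Defs
begin

text \<open>
  Everything is reduced to pairs \<open>(x, y)\<close> of coordinates of the joint path. For such a pair,
  Property (RIE) asks that the dyadic Riemann sums of \<open>\<integral> x dy\<close> converge uniformly and that the
  discrete areas \<open>A\<^sup>n(s, t) = \<Sum> (x(t\<^sub>i) - x(s)) (y(t\<^sub>i\<^sub>+\<^sub>1) - y(t\<^sub>i))\<close> are dominated by a control,
  uniformly in the level \<open>n\<close>. Passing from level \<open>r\<close> to level \<open>r + 1\<close> inserts one midpoint into each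
  cell and changes both quantities by the same correction, \<open>S\<^sup>r = \<Sum> (x(mid) - x(t\<^sub>i)) (y(t\<^sub>i\<^sub>+\<^sub>1) - y(mid))\<close>.
  On a dyadic interval \<open>I\<close> of level \<open>m\<close> the area \<open>A\<^sup>m(I)\<close> is zero, so \<open>A\<^sup>n(I)\<close> is the sum of the
  \<open>S\<^sup>r(I)\<close> with \<open>m \<le> r < n\<close>. Hence it suffices that, for some \<open>c > 1\<close>, the series
  \<open>\<Sum>\<^sub>m c\<^sup>m \<Sum>\<^sub>I \<bar>x(I)\<bar>\<^sup>q\<close>, the same series for \<open>y\<close>, and \<open>\<Sum>\<^sub>r c\<^sup>r \<Sum>\<^sub>I \<bar>S\<^sup>r(I)\<bar>\<^sup>q\<^sup>/\<^sup>2\<close> converge, where \<open>I\<close>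
  runs over the dyadic intervals of level \<open>m\<close>, respectively of any level \<open>m \<le> r\<close>. The control is
  then written down directly: \<open>w(s, t)\<close> is the part of these series that comes from intervals
  \<open>I \<subseteq> [s, t]\<close>, which is superadditive by construction, and the geometric weights \<open>c\<^sup>m\<close> make it
  dominate arbitrary grid intervals, which are cut into at most two dyadic intervals per level and
  reassembled with Chen's relation (\<open>area_control\<close>, \<open>riemann_uniformly_convergent\<close>).

  The almost sure convergence of the series is read off from moments. Because the exponents are
  \<open>q\<close> and \<open>q/2\<close> with \<open>q < 3\<close>, fourth moments of increments and second moments of the corrections are
  enough. When one of the two coordinates is Brownian, \<open>S\<^sup>r(I)\<close> is an elementary stochastic integral, so by the
  It\^o isometry its second moment is of order \<open>2\<^sup>-\<^sup>m 2\<^sup>-\<^sup>2\<^sup>r\<^sup>/\<^sup>p\<close>, and the series converges because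
  \<open>q > p \<ge> 2\<close> (\<open>AE_summable_corrections\<close>). This covers the blocks \<open>(\<eta>, W)\<close>, \<open>(W, W)\<close> and \<open>(W, \<eta>)\<close>;
  the block \<open>(\<eta>, \<eta>)\<close> is the hypothesis on \<open>\<eta>\<close> with a larger exponent.

  For the formula for the lift, the uniform limits of the Riemann sums provide a version of the It\^o
  integrals that is jointly continuous in \<open>(s, t)\<close>: the step processes behind the Riemann sums
  converge in \<open>L\<^sup>2\<close> to the integrand, and Fatou's lemma combined with the isometry transfers this to
  the integrals (\<open>riemann_limit_has_ito_integral\<close>). By the isometry again, an It\^o integral is
  determined almost surely, and two continuous versions that agree at all pairs of dyadic points
  agree everywhere (\<open>ito_tensor_version_unique\<close>). The lower left block follows from summation by
  parts, since the cross variation \<open>\<Sum> \<Delta>\<eta> \<Delta>W\<close> has second moment of order \<open>2\<^sup>-\<^sup>2\<^sup>n\<^sup>/\<^sup>p\<close> and therefore tends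
  to zero almost surely (\<open>AE_integration_by_parts\<close>).
\<close>

section \<open>Peeling grid intervals into dyadic intervals\<close>

text \<open>
  A grid interval is exhausted by dyadic intervals, at most two of each level: an odd left end point is
  moved one step to the right, an odd right end point one step to the left, and what remains lies on
  the grid of the previous level, where the argument repeats. The function \<open>A\<close> is additive only up to
  the products in Chen's relation, so each peeled cell contributes its own area and one product, of
  which one factor is the increment over the small cell.
\<close>

lemma dyadic_chain_area:
  fixes A :: "nat \<Rightarrow> nat \<Rightarrow> real" and x y :: "nat \<Rightarrow> real"
  assumes "\<And>i j h. i \<le> j \<Longrightarrow> j \<le> h \<Longrightarrow> A i h = A i j + A j h + (x j - x i) * (y h - y j)"
    and "\<And>m j. m \<le> n \<Longrightarrow> k \<le> j * 2 ^ (n - m) \<Longrightarrow> (j + 1) * 2 ^ (n - m) \<le> l \<Longrightarrow>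
      \<bar>A (j * 2 ^ (n - m)) ((j + 1) * 2 ^ (n - m))\<bar> \<le> a m"
    and "\<And>m j. m \<le> n \<Longrightarrow> k \<le> j * 2 ^ (n - m) \<Longrightarrow> (j + 1) * 2 ^ (n - m) \<le> l \<Longrightarrow>
      \<bar>x ((j + 1) * 2 ^ (n - m)) - x (j * 2 ^ (n - m))\<bar> \<le> b m"
    and "\<And>m j. m \<le> n \<Longrightarrow> k \<le> j * 2 ^ (n - m) \<Longrightarrow> (j + 1) * 2 ^ (n - m) \<le> l \<Longrightarrow>
      \<bar>y ((j + 1) * 2 ^ (n - m)) - y (j * 2 ^ (n - m))\<bar> \<le> b m"
    and "\<And>i j. k \<le> i \<Longrightarrow> i \<le> j \<Longrightarrow> j \<le> l \<Longrightarrow> \<bar>x j - x i\<bar> \<le> B"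
    and "\<And>i j. k \<le> i \<Longrightarrow> i \<le> j \<Longrightarrow> j \<le> l \<Longrightarrow> \<bar>y j - y i\<bar> \<le> B"
    and "k \<le> l" and "l \<le> 2 ^ n" and "\<And>m. 0 \<le> a m" and "\<And>m. 0 \<le> b m" and "0 \<le> B"
  shows "\<bar>A k l\<bar> \<le> 2 * (\<Sum>m\<le>n. a m + B * b m)"
  using assms
proof (induction n arbitrary: A x y k l)
  case 0
  have A0: "A i i = 0" for i using 0(1)[of i i i] by simp
  have nn: "0 \<le> a 0 + B * b 0" using 0 by simp
  show ?case
  proof (cases "k = l")
    case True
    then show ?thesis using nn A0 by simp
  next
    case False
    then have "k = 0" "l = 1" using 0 by auto
    then have "\<bar>A k l\<bar> \<le> a 0" using 0(2)[of 0 0] by simp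
    moreover have "0 \<le> a 0" "0 \<le> B * b 0" using 0 by auto
    ultimately show ?thesis by simp
  qed
next
  case (Suc n)
  note chen = Suc.prems(1) and nnb = Suc.prems(9,10,11)
  have A0: "A i i = 0" for i using chen[of i i i] by simp
  have bn: "0 \<le> (\<Sum>m\<le>n. a m + B * b m)" using nnb by (intro sum_nonneg) auto
  have bS: "0 \<le> B * b (Suc n)" using nnb by auto
  show ?case
  proof (cases "k = l")
    case True
    then show ?thesis using bn bS nnb(1)[of "Suc n"] A0 by simp
  next
    case False
    \<comment> \<open>Rounding inwards to the grid of the previous level.\<close>
    define k' l' where "k' = (k + 1) div 2" and "l' = l div 2"
    have kl: "k < l" "k' \<le> l'" "k \<le> 2 * k'" "2 * l' \<le> l" "l' \<le> 2 ^ n"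
      using False Suc.prems(7,8) unfolding k'_def l'_def by auto
    have left: "\<bar>A k (2 * k')\<bar> \<le> a (Suc n) \<and> \<bar>x (2 * k') - x k\<bar> \<le> b (Suc n)"
    proof (cases "even k")
      case True
      then have "2 * k' = k" unfolding k'_def by auto
      then show ?thesis using nnb A0 by simp
    next
      case False
      then have "2 * k' = k + 1" unfolding k'_def by auto
      then show ?thesis using Suc.prems(2,3)[of "Suc n" k] kl by simp
    qed
    have right: "\<bar>A (2 * l') l\<bar> \<le> a (Suc n) \<and> \<bar>y l - y (2 * l')\<bar> \<le> b (Suc n)"
    proof (cases "even l")
      case True
      then have "2 * l' = l" unfolding l'_def by auto
      then show ?thesis using nnb A0 by simp
    next
      case False
      then have *: "2 * l' + 1 = l" unfolding l'_def by auto
      with kl False have "k \<le> 2 * l'" by auto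
      then show ?thesis using Suc.prems(2,4)[of "Suc n" "2 * l'"] * by simp
    qed
    have mid: "\<bar>(\<lambda>i j. A (2 * i) (2 * j)) k' l'\<bar> \<le> 2 * (\<Sum>m\<le>n. a m + B * b m)"
    proof (rule Suc.IH[where A = "\<lambda>i j. A (2 * i) (2 * j)" and x = "\<lambda>i. x (2 * i)" and y = "\<lambda>i. y (2 * i)"])
      fix m j assume *: "m \<le> n" "k' \<le> j * 2 ^ (n - m)" "(j + 1) * 2 ^ (n - m) \<le> l'"
      have e: "2 ^ (Suc n - m) = 2 * (2 ^ (n - m) :: nat)" using *(1) by (simp add: Suc_diff_le)
      have h: "m \<le> Suc n" "k \<le> j * 2 ^ (Suc n - m)" "(j + 1) * 2 ^ (Suc n - m) \<le> l"
        using mult_left_mono[OF *(2), of 2] kl(3) mult_left_mono[OF *(3), of 2] kl(4) *(1)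
        unfolding e by (simp_all add: algebra_simps)
      show "\<bar>A (2 * (j * 2 ^ (n - m))) (2 * ((j + 1) * 2 ^ (n - m)))\<bar> \<le> a m"
        using Suc.prems(2)[OF h] unfolding e by (simp add: algebra_simps)
      show "\<bar>x (2 * ((j + 1) * 2 ^ (n - m))) - x (2 * (j * 2 ^ (n - m)))\<bar> \<le> b m"
        using Suc.prems(3)[OF h] unfolding e by (simp add: algebra_simps)
      show "\<bar>y (2 * ((j + 1) * 2 ^ (n - m))) - y (2 * (j * 2 ^ (n - m)))\<bar> \<le> b m"
        using Suc.prems(4)[OF h] unfolding e by (simp add: algebra_simps)
    qed (use kl Suc.prems in \<open>auto intro!: chen\<close>)
    have eq: "A k l = A k (2 * k') + A (2 * k') (2 * l') + A (2 * l') l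
      + (x (2 * k') - x k) * (y l - y (2 * k')) + (x (2 * l') - x (2 * k')) * (y l - y (2 * l'))"
      using chen[of k "2 * k'" l] chen[of "2 * k'" "2 * l'" l] kl by simp
    have "\<bar>(x (2 * k') - x k) * (y l - y (2 * k'))\<bar> \<le> b (Suc n) * B"
      unfolding abs_mult using left kl nnb Suc.prems(6)[of "2 * k'" l] by (intro mult_mono) auto
    moreover have "\<bar>(x (2 * l') - x (2 * k')) * (y l - y (2 * l'))\<bar> \<le> B * b (Suc n)"
      unfolding abs_mult using right kl nnb Suc.prems(5)[of "2 * k'" "2 * l'"]
      by (intro mult_mono) auto
    ultimately have "\<bar>A k l\<bar> \<le> 2 * (\<Sum>m\<le>n. a m + B * b m) + 2 * a (Suc n) + 2 * (B * b (Suc n))"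
      using left right mid unfolding eq by (auto simp: mult.commute[of B])
    then show ?thesis by (simp add: algebra_simps)
  qed
qed

lemma dyadic_chain_increment:
  fixes G :: "nat \<Rightarrow> real"
  assumes "\<And>m j. m \<le> n \<Longrightarrow> k \<le> j * 2 ^ (n - m) \<Longrightarrow> (j + 1) * 2 ^ (n - m) \<le> l \<Longrightarrow>
      \<bar>G ((j + 1) * 2 ^ (n - m)) - G (j * 2 ^ (n - m))\<bar> \<le> b m"
    and "k \<le> l" and "l \<le> 2 ^ n" and "\<And>m. 0 \<le> b m"
  shows "\<bar>G l - G k\<bar> \<le> 2 * (\<Sum>m\<le>n. b m)"
proof -
  have "\<bar>(\<lambda>i j. G j - G i) k l\<bar> \<le> 2 * (\<Sum>m\<le>n. b m + 0 * 0)"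
  proof (rule dyadic_chain_area[where A = "\<lambda>i j. G j - G i" and x = "\<lambda>_. 0" and y = "\<lambda>_. 0"])
    fix m j assume "m \<le> n" "k \<le> j * 2 ^ (n - m)" "(j + 1) * 2 ^ (n - m) \<le> l"
    then show "\<bar>G ((j + 1) * 2 ^ (n - m)) - G (j * 2 ^ (n - m))\<bar> \<le> b m" by (rule assms(1))
  qed (use assms(2-4) in simp_all)
  then show ?thesis by simp
qed

section \<open>Discrete areas, corrections and Riemann sums\<close>

definition dyadic_area :: "real \<Rightarrow> (real \<Rightarrow> real) \<Rightarrow> (real \<Rightarrow> real) \<Rightarrow> nat \<Rightarrow> nat \<Rightarrow> nat \<Rightarrow> real" where
  "dyadic_area T x y n k l = (\<Sum>i=k..<l.
     (x (dyadic T n i) - x (dyadic T n k)) * (y (dyadic T n (Suc i)) - y (dyadic T n i)))"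

text \<open>
  In each cell \<open>x\<close> moves over the left half and \<open>y\<close> over the right half.
\<close>

definition dyadic_corr :: "real \<Rightarrow> (real \<Rightarrow> real) \<Rightarrow> (real \<Rightarrow> real) \<Rightarrow> nat \<Rightarrow> nat \<Rightarrow> nat \<Rightarrow> real" where
  "dyadic_corr T x y n k l = (\<Sum>i=k..<l.
     (x (dyadic T (Suc n) (2 * i + 1)) - x (dyadic T n i)) *
     (y (dyadic T n (Suc i)) - y (dyadic T (Suc n) (2 * i + 1))))"

definition dyadic_riemann :: "real \<Rightarrow> (real \<Rightarrow> real) \<Rightarrow> (real \<Rightarrow> real) \<Rightarrow> nat \<Rightarrow> real \<Rightarrow> real" where
  "dyadic_riemann T x y n t = (\<Sum>k<2 ^ n.
     x (dyadic T n k) * (y (min (dyadic T n (Suc k)) t) - y (min (dyadic T n k) t)))"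

lemma dyadic_Suc_double: "dyadic T (Suc n) (2 * k) = dyadic T n k"
  by (simp add: dyadic_def field_simps)

lemma dyadic_scale: "m \<le> n \<Longrightarrow> dyadic T n (j * 2 ^ (n - m)) = dyadic T m j"
  using power_add[of "2 :: real" m "n - m"] by (simp add: dyadic_def field_simps)

lemma dyadic_mono: "0 < T \<Longrightarrow> dyadic T n k \<le> dyadic T n l \<longleftrightarrow> k \<le> l"
  by (simp add: dyadic_def field_simps)

lemma dyadic_strict_mono: "0 < T \<Longrightarrow> dyadic T n k < dyadic T n l \<longleftrightarrow> k < l"
  by (simp add: dyadic_def field_simps)

lemma dyadic_in_range: "0 < T \<Longrightarrow> k \<le> 2 ^ n \<Longrightarrow> dyadic T n k \<in> {0..T}"
  using of_nat_mono[of k "2 ^ n", where 'a = real] by (simp add: dyadic_def field_simps)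

lemma dyadic_0 [simp]: "dyadic T n 0 = 0" and dyadic_end [simp]: "dyadic T n (2 ^ n) = T"
  by (simp_all add: dyadic_def)

lemma sum_pairs: "(\<Sum>i=2 * k..<2 * l. f i) = (\<Sum>i=k..<l. f (2 * i) + f (2 * i + 1 :: nat) :: real)"
proof (induction l)
  case (Suc l)
  show ?case
  proof (cases "k \<le> l")
    case True
    then have "(\<Sum>i=2 * k..<2 * Suc l. f i) = (\<Sum>i=2 * k..<2 * l. f i) + f (2 * l) + f (2 * l + 1)"
      by (simp add: algebra_simps)
    with Suc True show ?thesis by simp
  qed simp
qed simp

lemma dyadic_area_chen:
  assumes "i \<le> j" "j \<le> h"
  shows "dyadic_area T x y n i h = dyadic_area T x y n i j + dyadic_area T x y n j h
    + (x (dyadic T n j) - x (dyadic T n i)) * (y (dyadic T n h) - y (dyadic T n j))"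
proof -
  let ?d = "\<lambda>u. y (dyadic T n (Suc u)) - y (dyadic T n u)"
  have "(\<Sum>u=j..<h. (x (dyadic T n u) - x (dyadic T n i)) * ?d u)
    = (\<Sum>u=j..<h. (x (dyadic T n u) - x (dyadic T n j)) * ?d u
        + (x (dyadic T n j) - x (dyadic T n i)) * ?d u)"
    by (intro sum.cong) (auto simp: algebra_simps)
  also have "\<dots> = dyadic_area T x y n j h
      + (x (dyadic T n j) - x (dyadic T n i)) * (\<Sum>u=j..<h. ?d u)"
    by (simp add: dyadic_area_def sum.distrib sum_distrib_left)
  also have "(\<Sum>u=j..<h. ?d u) = y (dyadic T n h) - y (dyadic T n j)"
    using sum_Suc_diff'[OF assms(2), of "\<lambda>u. y (dyadic T n u)"] .
  finally show ?thesis
    using sum.atLeastLessThan_concat[OF assms,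
      of "\<lambda>u. (x (dyadic T n u) - x (dyadic T n i)) * ?d u"]
    by (simp add: dyadic_area_def)
qed

text \<open>
  One more midpoint per cell adds to the area the products over the two halves of each cell.
\<close>

lemma dyadic_area_refine:
  "dyadic_area T x y (Suc n) (2 * k) (2 * l) = dyadic_area T x y n k l + dyadic_corr T x y n k l"
proof -
  have d: "dyadic T (Suc n) (Suc (Suc (2 * i))) = dyadic T n (Suc i)" for i
    using dyadic_Suc_double[of T n "Suc i"] by simp
  show ?thesis
    unfolding dyadic_area_def sum_pairs
    by (simp add: dyadic_corr_def sum.distrib[symmetric] dyadic_Suc_double d)
       (intro sum.cong refl, simp add: algebra_simps)
qed

text \<open>
  The telescoping starts from zero because the level-\<open>m\<close> area of a single level-\<open>m\<close> cell vanishes.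
\<close>

lemma dyadic_area_telescope:
  assumes "m \<le> n"
  shows "dyadic_area T x y n (j * 2 ^ (n - m)) ((j + 1) * 2 ^ (n - m))
    = (\<Sum>r=m..<n. dyadic_corr T x y r (j * 2 ^ (r - m)) ((j + 1) * 2 ^ (r - m)))"
  using assms
proof (induction n rule: dec_induct)
  case base
  show ?case by (simp add: dyadic_area_def)
next
  case (step n)
  have e: "i * 2 ^ (Suc n - m) = 2 * (i * 2 ^ (n - m))" for i :: nat
    using step by (simp add: Suc_diff_le)
  show ?case unfolding e dyadic_area_refine using step by simp
qed

section \<open>Controls built from dyadic intervals\<close>

text \<open>
  The pair \<open>(m, j)\<close> names a dyadic interval, and \<open>r\<close> allows it to carry one term for each finer level.
  Superadditivity is immediate: for \<open>s \<le> u \<le> t\<close> a nondegenerate dyadic interval lies in at most one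
  of \<open>[s, u]\<close> and \<open>[u, t]\<close>, and in either case in \<open>[s, t]\<close>.
\<close>

lemma dyadic_control:
  fixes a :: "nat \<Rightarrow> nat \<Rightarrow> nat \<Rightarrow> real"
  assumes T: "0 < T" and nn: "\<And>r m j. 0 \<le> a r m j"
    and summ: "summable (\<lambda>r. \<Sum>m\<le>r. \<Sum>j<2 ^ m. a r m j)"
  obtains w where "control T w"
    and "\<And>r m j s t. m \<le> r \<Longrightarrow> j < 2 ^ m \<Longrightarrow> s \<le> dyadic T m j \<Longrightarrow> dyadic T m (Suc j) \<le> t \<Longrightarrow>
      a r m j \<le> w s t"
proof -
  define g where "g s t r = (\<Sum>m\<le>r. \<Sum>j<2 ^ m.
      if s \<le> dyadic T m j \<and> dyadic T m (Suc j) \<le> t then a r m j else 0)" for s t r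
  have g0: "0 \<le> g s t r" for s t r unfolding g_def by (intro sum_nonneg) (auto simp: nn)
  have sg: "summable (g s t)" for s t
  proof (rule summable_comparison_test[OF _ summ], intro exI allI impI)
    fix r show "norm (g s t r) \<le> (\<Sum>m\<le>r. \<Sum>j<2 ^ m. a r m j)"
      using g0[of s t r] by (simp, unfold g_def) (intro sum_mono, auto simp: nn)
  qed
  show ?thesis
  proof (rule that[of "\<lambda>s t. suminf (g s t)"])
    show "control T (\<lambda>s t. suminf (g s t))"
      unfolding control_def
    proof (intro conjI allI impI ballI)
      fix z assume "z \<in> Simplex T"
      show "case z of (s, t) \<Rightarrow> 0 \<le> suminf (g s t)"
        by (auto intro!: suminf_nonneg sg g0)
    next
      fix s u t assume *: "0 \<le> s \<and> s \<le> u \<and> u \<le> t \<and> t \<le> T"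
      have "suminf (g s u) + suminf (g u t) = (\<Sum>r. g s u r + g u t r)"
        by (intro suminf_add sg)
      also have "\<dots> \<le> suminf (g s t)"
      proof (intro suminf_le summable_add sg)
        fix r
        show "g s u r + g u t r \<le> g s t r"
          unfolding g_def sum.distrib[symmetric]
        proof (intro sum_mono)
          fix m j
          have "dyadic T m j < dyadic T m (Suc j)" using T by (simp add: dyadic_strict_mono)
          then show "(if s \<le> dyadic T m j \<and> dyadic T m (Suc j) \<le> u then a r m j else 0) +
           (if u \<le> dyadic T m j \<and> dyadic T m (Suc j) \<le> t then a r m j else 0)
           \<le> (if s \<le> dyadic T m j \<and> dyadic T m (Suc j) \<le> t then a r m j else 0)"
            using * nn[of r m j] by auto
        qed
      qed
      finally show "suminf (g s u) + suminf (g u t) \<le> suminf (g s t)" .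
    qed
  next
    fix r m j s t
    assume *: "m \<le> r" "j < 2 ^ m" "s \<le> dyadic T m j" "dyadic T m (Suc j) \<le> t"
    let ?f = "\<lambda>m j. if s \<le> dyadic T m j \<and> dyadic T m (Suc j) \<le> t then a r m j else 0"
    have "a r m j = ?f m j" using * by simp
    also have "\<dots> \<le> (\<Sum>j<2 ^ m. ?f m j)" using * by (intro member_le_sum) (auto simp: nn)
    also have "\<dots> \<le> g s t r" unfolding g_def
      using * by (intro member_le_sum[where f = "\<lambda>m. \<Sum>j<2 ^ m. ?f m j"] sum_nonneg) (auto simp: nn)
    also have "\<dots> \<le> suminf (g s t)"
      using sum_le_suminf[OF sg, of "{r}" s t] g0 by simp
    finally show "a r m j \<le> suminf (g s t)" .
  qed
qed

text \<open>
  Turns a weighted \<open>q\<close>-th power bound into a bound that decays geometrically with the level \<open>m\<close>; the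
  decay makes the sum over all levels converge.
\<close>

lemma le_powr_root:
  fixes v w c q :: real
  assumes "0 \<le> v" "0 < c" "0 < q" "c ^ m * v powr q \<le> w"
  shows "v \<le> (c powr (- 1 / q)) ^ m * w powr (1 / q)"
proof -
  have w: "0 \<le> w" using order_trans[OF _ assms(4), of 0] assms by simp
  have "v powr q \<le> w / c ^ m" using assms by (simp add: field_simps)
  then have "(v powr q) powr (1 / q) \<le> (w / c ^ m) powr (1 / q)"
    using assms by (intro powr_mono2) auto
  then have "v \<le> (w / c ^ m) powr (1 / q)" using assms by (simp add: powr_powr)
  also have "\<dots> = w powr (1 / q) / (c ^ m) powr (1 / q)"
    using assms w by (simp add: powr_divide)
  also have "(c ^ m) powr (1 / q) = (c powr (1 / q)) ^ m"
    using assms by (simp add: powr_powr powr_realpow[symmetric] mult.commute)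
  finally show ?thesis using assms by (simp add: powr_minus field_simps power_inverse)
qed

lemma root_rate_less_1: "1 < c \<Longrightarrow> 0 < q \<Longrightarrow> c powr (- 1 / q) < (1 :: real)"
  by (simp add: powr_less_one)

lemma geometric_partial_le:
  fixes \<theta> :: real assumes "0 \<le> \<theta>" "\<theta> < 1" shows "(\<Sum>m\<le>n. \<theta> ^ m) \<le> 1 / (1 - \<theta>)"
proof -
  have "(\<Sum>m\<le>n. \<theta> ^ m) = (1 - \<theta> ^ Suc n) / (1 - \<theta>)"
    using assms by (simp add: sum_gp0)
  also have "\<dots> \<le> 1 / (1 - \<theta>)" using assms by (intro divide_right_mono) auto
  finally show ?thesis .
qed

lemma geometric_segment_le:
  fixes \<theta> :: real assumes "0 \<le> \<theta>" "\<theta> < 1"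
  shows "(\<Sum>r=m..<n. \<theta> ^ r) \<le> \<theta> ^ m / (1 - \<theta>)"
proof (cases "m < n")
  case True
  have e: "(\<Sum>r=m..<n. \<theta> ^ r) = \<theta> ^ m * (\<Sum>r<n - m. \<theta> ^ r)"
    unfolding sum_distrib_left power_add[symmetric] using True
    by (intro sum.reindex_bij_witness[of _ "\<lambda>i. i + m" "\<lambda>i. i - m"]) auto
  have g: "(\<Sum>r<n - m. \<theta> ^ r) \<le> 1 / (1 - \<theta>)"
    using geometric_partial_le[OF assms, of "n - m - 1"] True
    by (metis Suc_diff_1 lessThan_Suc_atMost zero_less_diff)
  show ?thesis using mult_left_mono[OF g, of "\<theta> ^ m"] assms unfolding e by simp
qed (use assms in auto)

definition summable_increments :: "real \<Rightarrow> real \<Rightarrow> real \<Rightarrow> (real \<Rightarrow> real) \<Rightarrow> bool" where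
  "summable_increments T q c x \<longleftrightarrow> summable (\<lambda>m. c ^ m *
     (\<Sum>j<2 ^ m. \<bar>x (dyadic T m (Suc j)) - x (dyadic T m j)\<bar> powr q))"

text \<open>
  In the grid of level \<open>r\<close>, the \<open>j\<close>-th dyadic interval of level \<open>m \<le> r\<close> has the end point indices
  \<open>j 2\<^sup>r\<^sup>-\<^sup>m\<close> and \<open>(j + 1) 2\<^sup>r\<^sup>-\<^sup>m\<close>.
\<close>

definition summable_corrections ::
  "real \<Rightarrow> real \<Rightarrow> real \<Rightarrow> (real \<Rightarrow> real) \<Rightarrow> (real \<Rightarrow> real) \<Rightarrow> bool" where
  "summable_corrections T q c x y \<longleftrightarrow> summable (\<lambda>r. c ^ r * (\<Sum>m\<le>r. \<Sum>j<2 ^ m.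
     \<bar>dyadic_corr T x y r (j * 2 ^ (r - m)) ((j + 1) * 2 ^ (r - m))\<bar> powr (q / 2)))"

lemma T_over_power_tendsto_0: "(\<lambda>n. T / 2 ^ n) \<longlonglongrightarrow> (0 :: real)"
proof -
  have "(\<lambda>n. T * (1 / 2) ^ n) \<longlonglongrightarrow> T * 0"
    by (intro tendsto_mult tendsto_const LIMSEQ_power_zero) simp
  moreover have "(\<lambda>n. T * (1 / 2) ^ n) = (\<lambda>n. T / 2 ^ n)" by (intro ext) (simp add: power_divide)
  ultimately show ?thesis by simp
qed

definition dyadic_floor :: "real \<Rightarrow> nat \<Rightarrow> real \<Rightarrow> nat" where
  "dyadic_floor T n s = nat \<lfloor>s * 2 ^ n / T\<rfloor>"

lemma dyadic_floor:
  assumes T: "0 < T" and s: "s \<in> {0..T}"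
  shows "dyadic T n (dyadic_floor T n s) \<le> s" "s - T / 2 ^ n \<le> dyadic T n (dyadic_floor T n s)"
    and "s < dyadic T n (Suc (dyadic_floor T n s))" and "dyadic_floor T n s \<le> 2 ^ n"
proof -
  have "0 \<le> s * 2 ^ n / T" using s T by simp
  then have "real (dyadic_floor T n s) = of_int \<lfloor>s * 2 ^ n / T\<rfloor>" unfolding dyadic_floor_def by simp
  then have *: "real (dyadic_floor T n s) \<le> s * 2 ^ n / T" "s * 2 ^ n / T < real (dyadic_floor T n s) + 1"
    by linarith+
  then have "real (dyadic_floor T n s) * T \<le> s * 2 ^ n" and lt: "s * 2 ^ n < real (dyadic_floor T n s) * T + T"
    using T by (simp_all add: field_simps)
  then show le: "dyadic T n (dyadic_floor T n s) \<le> s" "s - T / 2 ^ n \<le> dyadic T n (dyadic_floor T n s)"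
    by (simp_all add: dyadic_def divide_simps)
  show "s < dyadic T n (Suc (dyadic_floor T n s))"
    using lt by (simp add: dyadic_def divide_simps algebra_simps)
  from le(1) s have "dyadic T n (dyadic_floor T n s) \<le> dyadic T n (2 ^ n)" by simp
  then show "dyadic_floor T n s \<le> 2 ^ n" using dyadic_mono[OF T] by blast
qed

lemma dyadic_floor_mono: "0 < T \<Longrightarrow> s \<le> t \<Longrightarrow> dyadic_floor T n s \<le> dyadic_floor T n t"
  unfolding dyadic_floor_def by (intro nat_mono floor_mono divide_right_mono mult_right_mono) auto

lemma dyadic_floor_tendsto:
  assumes T: "0 < T" and s: "s \<in> {0..T}"
  shows "(\<lambda>n. dyadic T n (dyadic_floor T n s)) \<longlonglongrightarrow> s"
proof -
  have "(\<lambda>n. dyadic T n (dyadic_floor T n s) - s) \<longlonglongrightarrow> 0"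
  proof (rule Lim_null_comparison[OF _ T_over_power_tendsto_0[of T]], rule always_eventually, rule allI)
    fix n
    show "norm (dyadic T n (dyadic_floor T n s) - s) \<le> T / 2 ^ n"
      using dyadic_floor(1,2)[OF T s, of n] by simp
  qed
  then show ?thesis by (simp add: LIM_zero_iff)
qed

lemma dyadic_cell_left:
  assumes T: "0 < T" and t: "0 \<le> t" "t < T"
  obtains k where "k < 2 ^ n" "dyadic T n k \<le> t" "t < dyadic T n (Suc k)"
proof -
  have s: "t \<in> {0..T}" using t by simp
  have "dyadic T n (dyadic_floor T n t) < dyadic T n (2 ^ n)" using dyadic_floor(1)[OF T s, of n] t by simp
  then have "dyadic_floor T n t < 2 ^ n" using T by (simp add: dyadic_strict_mono del: dyadic_end)
  then show ?thesis using dyadic_floor(1,3)[OF T s, of n] by (intro that) auto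
qed

text \<open>
  Geometric bounds on the dyadic intervals inside \<open>[s, t]\<close> bound the whole increment: the dyadic points
  next to \<open>s\<close> and \<open>t\<close> converge to them from inside, and continuity closes the gap.
\<close>

lemma increment_le_of_dyadic:
  fixes x :: "real \<Rightarrow> real"
  assumes T: "0 < T" and cont: "continuous_on {0..T} x" and th: "0 \<le> \<theta>" "\<theta> < 1" and k: "0 \<le> \<kappa>"
    and st: "0 \<le> s" "s \<le> t" "t \<le> T"
    and dy: "\<And>m j. j < 2 ^ m \<Longrightarrow> s \<le> dyadic T m j \<Longrightarrow> dyadic T m (Suc j) \<le> t \<Longrightarrow>
      \<bar>x (dyadic T m (Suc j)) - x (dyadic T m j)\<bar> \<le> \<theta> ^ m * \<kappa>"
  shows "\<bar>x t - x s\<bar> \<le> 2 * \<kappa> / (1 - \<theta>)"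
proof (cases "s = t")
  case True
  then show ?thesis using th k by simp
next
  case False
  then have lt: "s < t" using st by simp
  \<comment> \<open>Grid points inside \<open>[s, t]\<close>: the first one after \<open>s\<close> and the last one before \<open>t\<close>.\<close>
  define k where "k n = Suc (dyadic_floor T n s)" for n
  define l where "l n = dyadic_floor T n t" for n
  have sT: "s \<in> {0..T}" and tT: "t \<in> {0..T}" using st by auto
  have kb: "s \<le> dyadic T n (k n)" for n
    using dyadic_floor(3)[OF T sT, of n] by (simp add: k_def)
  have lb: "dyadic T n (l n) \<le> t" for n
    using dyadic_floor(1)[OF T tT] by (simp add: l_def)
  have "(\<lambda>n. dyadic T n (dyadic_floor T n s) + T / 2 ^ n) \<longlonglongrightarrow> s + 0"
    by (intro tendsto_add dyadic_floor_tendsto[OF T sT] T_over_power_tendsto_0)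
  then have ks: "(\<lambda>n. dyadic T n (k n)) \<longlonglongrightarrow> s"
    by (simp add: k_def dyadic_def algebra_simps add_divide_distrib)
  have lt': "(\<lambda>n. dyadic T n (l n)) \<longlonglongrightarrow> t"
    unfolding l_def by (rule dyadic_floor_tendsto[OF T tT])
  have ev: "\<forall>\<^sub>F n in sequentially. k n \<le> l n"
  proof -
    have "\<forall>\<^sub>F n in sequentially. dyadic T n (k n) < dyadic T n (l n)"
      using order_tendstoD[OF ks, of "(s + t) / 2"] order_tendstoD[OF lt', of "(s + t) / 2"] lt
      by (auto elim: eventually_elim2)
    then show ?thesis by eventually_elim (use T in \<open>simp add: dyadic_strict_mono\<close>)
  qed
  have bound: "\<forall>\<^sub>F n in sequentially. \<bar>x (dyadic T n (l n)) - x (dyadic T n (k n))\<bar> \<le> 2 * \<kappa> / (1 - \<theta>)"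
    using ev
  proof eventually_elim
    case (elim n)
    have ln: "l n \<le> 2 ^ n"
      using order_trans[OF lb[of n] st(3)] T by (simp add: dyadic_def field_simps)
    have "\<bar>x (dyadic T n (l n)) - x (dyadic T n (k n))\<bar> \<le> 2 * (\<Sum>m\<le>n. \<theta> ^ m * \<kappa>)"
    proof (rule dyadic_chain_increment)
      fix m j assume *: "m \<le> n" "k n \<le> j * 2 ^ (n - m)" "(j + 1) * 2 ^ (n - m) \<le> l n"
      have "(j + 1) * 2 ^ (n - m) \<le> 2 ^ m * 2 ^ (n - m)"
        using * ln by (simp add: power_add[symmetric] del: mult_Suc)
      then have "j + 1 \<le> 2 ^ m" by (subst (asm) mult_le_cancel2) simp
      then have "j < 2 ^ m" by simp
      moreover have "s \<le> dyadic T m j"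
        using kb[of n] *(2) dyadic_scale[OF *(1), of T j] dyadic_mono[OF T, of n] by (metis order_trans)
      moreover have "dyadic T m (Suc j) \<le> t"
        using lb[of n] *(3) dyadic_scale[OF *(1), of T "Suc j"] dyadic_mono[OF T, of n]
        by (metis order_trans Suc_eq_plus1)
      ultimately show "\<bar>x (dyadic T n ((j + 1) * 2 ^ (n - m))) - x (dyadic T n (j * 2 ^ (n - m)))\<bar> \<le> \<theta> ^ m * \<kappa>"
        unfolding dyadic_scale[OF *(1)] using dy[of j m] by simp
    qed (use elim ln th assms(5) in auto)
    also have "\<dots> = 2 * \<kappa> * (\<Sum>m\<le>n. \<theta> ^ m)" by (simp add: sum_distrib_left mult_ac)
    also have "\<dots> \<le> 2 * \<kappa> * (1 / (1 - \<theta>))"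
      using assms(5) by (intro mult_left_mono geometric_partial_le th) auto
    finally show ?case by simp
  qed
  have kin: "dyadic T n (k n) \<in> {0..T}" if "k n \<le> l n" for n
    using that kb[of n] lb[of n] st T dyadic_mono[OF T, of n "k n" "l n"] by auto
  have lin: "dyadic T n (l n) \<in> {0..T}" for n
    using lb[of n] st T by (auto simp: dyadic_def)
  have "(\<lambda>n. x (dyadic T n (k n))) \<longlonglongrightarrow> x s"
    by (rule continuous_on_tendsto_compose[OF cont ks])
      (use st ev kin in \<open>auto elim!: eventually_mono\<close>)
  moreover have "(\<lambda>n. x (dyadic T n (l n))) \<longlonglongrightarrow> x t"
    using continuous_on_tendsto_compose[OF cont lt'] st lin by auto
  ultimately have "(\<lambda>n. \<bar>x (dyadic T n (l n)) - x (dyadic T n (k n))\<bar>) \<longlonglongrightarrow> \<bar>x t - x s\<bar>"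
    by (intro tendsto_rabs tendsto_diff)
  then show ?thesis by (rule tendsto_upperbound[OF _ bound]) simp
qed

lemma summable_increments_control:
  assumes T: "0 < T" and q: "0 < q" and c: "1 < c"
    and sx: "summable_increments T q c x"
  obtains w where "control T w" and "\<And>m j s t. j < 2 ^ m \<Longrightarrow> s \<le> dyadic T m j \<Longrightarrow>
    dyadic T m (Suc j) \<le> t \<Longrightarrow>
    \<bar>x (dyadic T m (Suc j)) - x (dyadic T m j)\<bar> \<le> (c powr (- 1 / q)) ^ m * w s t powr (1 / q)"
proof -
  \<comment> \<open>The increments of level \<open>m\<close> are entered once, in the diagonal term \<open>r = m\<close>.\<close>
  let ?a = "\<lambda>r m j. if m = r then c ^ m * \<bar>x (dyadic T m (Suc j)) - x (dyadic T m j)\<bar> powr q else 0"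
  have "(\<Sum>m\<le>r. \<Sum>j<2 ^ m. ?a r m j) =
      c ^ r * (\<Sum>j<2 ^ r. \<bar>x (dyadic T r (Suc j)) - x (dyadic T r j)\<bar> powr q)" for r
  proof -
    have "(\<Sum>m\<le>r. \<Sum>j<2 ^ m. ?a r m j) = (\<Sum>m\<le>r. if m = r then \<Sum>j<2 ^ m. c ^ m * \<bar>x (dyadic T m (Suc j)) - x (dyadic T m j)\<bar> powr q else 0)"
      by (intro sum.cong) auto
    then show ?thesis by (simp add: sum.delta sum_distrib_left)
  qed
  then have sm: "summable (\<lambda>r. \<Sum>m\<le>r. \<Sum>j<2 ^ m. ?a r m j)"
    using sx by (simp add: summable_increments_def)
  have nn: "0 \<le> ?a r m j" for r m j using c by auto
  obtain w where w: "control T w" and le: "\<And>r m j s t. m \<le> r \<Longrightarrow> j < 2 ^ m \<Longrightarrow>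
      s \<le> dyadic T m j \<Longrightarrow> dyadic T m (Suc j) \<le> t \<Longrightarrow> ?a r m j \<le> w s t"
    using dyadic_control[OF T, of ?a, OF nn sm] by blast
  show ?thesis
  proof (rule that[OF w])
    fix m j s t assume "j < 2 ^ m" "s \<le> dyadic T m j" "dyadic T m (Suc j) \<le> t"
    from le[OF order_refl this]
    show "\<bar>x (dyadic T m (Suc j)) - x (dyadic T m j)\<bar> \<le> (c powr (- 1 / q)) ^ m * w s t powr (1 / q)"
      using c q by (intro le_powr_root) auto
  qed
qed

lemma summable_corrections_control:
  assumes T: "0 < T" and q: "0 < q" and c: "1 < c"
    and sxy: "summable_corrections T q c x y"
  obtains w where "control T w" and "\<And>r m j s t. m \<le> r \<Longrightarrow> j < 2 ^ m \<Longrightarrow> s \<le> dyadic T m j \<Longrightarrow>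
    dyadic T m (Suc j) \<le> t \<Longrightarrow>
    \<bar>dyadic_corr T x y r (j * 2 ^ (r - m)) ((j + 1) * 2 ^ (r - m))\<bar>
      \<le> (c powr (- 1 / (q / 2))) ^ r * w s t powr (1 / (q / 2))"
proof -
  let ?a = "\<lambda>r m j. c ^ r * \<bar>dyadic_corr T x y r (j * 2 ^ (r - m)) ((j + 1) * 2 ^ (r - m))\<bar> powr (q / 2)"
  have sm: "summable (\<lambda>r. \<Sum>m\<le>r. \<Sum>j<2 ^ m. ?a r m j)"
    using sxy by (simp add: summable_corrections_def sum_distrib_left)
  have nn: "0 \<le> ?a r m j" for r m j using c by auto
  obtain w where w: "control T w" and le: "\<And>r m j s t. m \<le> r \<Longrightarrow> j < 2 ^ m \<Longrightarrow>
      s \<le> dyadic T m j \<Longrightarrow> dyadic T m (Suc j) \<le> t \<Longrightarrow> ?a r m j \<le> w s t"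
    using dyadic_control[OF T, of ?a, OF nn sm] by blast
  show ?thesis
    by (rule that[OF w]) (intro le_powr_root le, use c q in auto)
qed

lemma control_nonneg: "control T w \<Longrightarrow> 0 \<le> s \<Longrightarrow> s \<le> t \<Longrightarrow> t \<le> T \<Longrightarrow> 0 \<le> w s t"
  by (auto simp: control_def Simplex_def)

lemma control_mono:
  assumes "control T w" "0 \<le> s" "s \<le> s'" "s' \<le> t'" "t' \<le> t" "t \<le> T"
  shows "w s' t' \<le> w s t"
proof -
  have "w s s' + w s' t \<le> w s t" "w s' t' + w t' t \<le> w s' t" "0 \<le> w s s'" "0 \<le> w t' t"
    using assms by (auto simp: control_def Simplex_def)
  then show ?thesis by simp
qed

lemma control_add:
  assumes "control T v" "control T w"
  shows "control T (\<lambda>s t. v s t + w s t)"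
  unfolding control_def
proof (intro conjI allI impI ballI)
  fix z assume "z \<in> Simplex T"
  then show "case z of (s, t) \<Rightarrow> 0 \<le> v s t + w s t"
    using assms by (fastforce simp: control_def)
next
  fix s u t assume "0 \<le> s \<and> s \<le> u \<and> u \<le> t \<and> t \<le> T"
  then have "v s u + v u t \<le> v s t" "w s u + w u t \<le> w s t"
    using assms by (auto simp: control_def)
  then show "v s u + w s u + (v u t + w u t) \<le> v s t + w s t" by simp
qed

lemma control_scale:
  assumes "control T w" "0 \<le> C"
  shows "control T (\<lambda>s t. C * w s t)"
  unfolding control_def
proof (intro conjI allI impI ballI)
  fix z assume "z \<in> Simplex T"
  then show "case z of (s, t) \<Rightarrow> 0 \<le> C * w s t"
    using assms by (auto simp: control_def)
next
  fix s u t assume "0 \<le> s \<and> s \<le> u \<and> u \<le> t \<and> t \<le> T"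
  then have "w s u + w u t \<le> w s t" using assms by (auto simp: control_def)
  from mult_left_mono[OF this assms(2)] show "C * w s u + C * w u t \<le> C * w s t"
    by (simp add: distrib_left)
qed

lemma control_sum:
  assumes "finite I" "\<And>i. i \<in> I \<Longrightarrow> control T (w i)"
  shows "control T (\<lambda>s t. \<Sum>i\<in>I. w i s t)"
  using assms by (induction I) (auto intro!: control_add, auto simp: control_def)

definition path_controlled :: "real \<Rightarrow> real \<Rightarrow> (real \<Rightarrow> real) \<Rightarrow> bool" where
  "path_controlled T q x \<longleftrightarrow>
     (\<exists>w. control T w \<and> (\<forall>(s, t)\<in>Simplex T. \<bar>x t - x s\<bar> powr q \<le> w s t))"

definition area_controlled :: "real \<Rightarrow> real \<Rightarrow> (real \<Rightarrow> real) \<Rightarrow> (real \<Rightarrow> real) \<Rightarrow> bool" where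
  "area_controlled T q x y \<longleftrightarrow> (\<exists>w. control T w \<and> (\<forall>n k l. k < l \<longrightarrow> l \<le> 2 ^ n \<longrightarrow>
     \<bar>dyadic_area T x y n k l\<bar> powr (q / 2) \<le> w (dyadic T n k) (dyadic T n l)))"

lemma path_control:
  assumes T: "0 < T" and q: "0 < q" and c: "1 < c" and cont: "continuous_on {0..T} x"
    and sx: "summable_increments T q c x"
  shows "path_controlled T q x"
proof -
  let ?\<theta> = "c powr (- 1 / q)"
  have th: "0 \<le> ?\<theta>" "?\<theta> < 1" using root_rate_less_1[OF c q] by auto
  obtain w where w: "control T w" and le: "\<And>m j s t. j < 2 ^ m \<Longrightarrow> s \<le> dyadic T m j \<Longrightarrow>
    dyadic T m (Suc j) \<le> t \<Longrightarrow>
    \<bar>x (dyadic T m (Suc j)) - x (dyadic T m j)\<bar> \<le> ?\<theta> ^ m * w s t powr (1 / q)"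
    using summable_increments_control[OF T q c sx] by blast
  define C where "C = (2 / (1 - ?\<theta>)) powr q"
  have "\<bar>x t - x s\<bar> powr q \<le> C * w s t" if "(s, t) \<in> Simplex T" for s t
  proof -
    have st: "0 \<le> s" "s \<le> t" "t \<le> T" using that by (auto simp: Simplex_def)
    have "\<bar>x t - x s\<bar> \<le> 2 * w s t powr (1 / q) / (1 - ?\<theta>)"
      by (rule increment_le_of_dyadic[OF T cont th _ st le]) auto
    then have "\<bar>x t - x s\<bar> powr q \<le> (2 / (1 - ?\<theta>) * w s t powr (1 / q)) powr q"
      using q by (intro powr_mono2) auto
    also have "\<dots> = C * w s t"
      unfolding C_def by (subst powr_mult) (use th q control_nonneg[OF w st] in \<open>auto simp: powr_powr\<close>)
    finally show ?thesis .
  qed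
  moreover have "control T (\<lambda>s t. C * w s t)" by (rule control_scale[OF w]) (simp add: C_def)
  ultimately show ?thesis
    unfolding path_controlled_def by (intro exI[of _ "\<lambda>s t. C * w s t"]) auto
qed

text \<open>
  All estimates below are monotone in the control, so one control can serve both paths and their
  corrections.
\<close>

lemma pair_control:
  assumes T: "0 < T" and q: "0 < q" and c: "1 < c"
    and sx: "summable_increments T q c x" and sy: "summable_increments T q c y"
    and sxy: "summable_corrections T q c x y"
  obtains w where "control T w"
    and "\<And>m j s t. j < 2 ^ m \<Longrightarrow> 0 \<le> s \<Longrightarrow> s \<le> dyadic T m j \<Longrightarrow> dyadic T m (Suc j) \<le> t \<Longrightarrow> t \<le> T \<Longrightarrow>
      \<bar>x (dyadic T m (Suc j)) - x (dyadic T m j)\<bar> \<le> (c powr (- 1 / q)) ^ m * w s t powr (1 / q) \<and>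
      \<bar>y (dyadic T m (Suc j)) - y (dyadic T m j)\<bar> \<le> (c powr (- 1 / q)) ^ m * w s t powr (1 / q)"
    and "\<And>r m j s t. m \<le> r \<Longrightarrow> j < 2 ^ m \<Longrightarrow> 0 \<le> s \<Longrightarrow> s \<le> dyadic T m j \<Longrightarrow>
      dyadic T m (Suc j) \<le> t \<Longrightarrow> t \<le> T \<Longrightarrow>
      \<bar>dyadic_corr T x y r (j * 2 ^ (r - m)) ((j + 1) * 2 ^ (r - m))\<bar>
        \<le> (c powr (- 1 / (q / 2))) ^ r * w s t powr (1 / (q / 2))"
proof -
  obtain w1 where w1: "control T w1" and le1: "\<And>m j s t. j < 2 ^ m \<Longrightarrow> s \<le> dyadic T m j \<Longrightarrow>
    dyadic T m (Suc j) \<le> t \<Longrightarrow>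
    \<bar>x (dyadic T m (Suc j)) - x (dyadic T m j)\<bar> \<le> (c powr (- 1 / q)) ^ m * w1 s t powr (1 / q)"
    using summable_increments_control[OF T q c sx] by blast
  obtain w2 where w2: "control T w2" and le2: "\<And>m j s t. j < 2 ^ m \<Longrightarrow> s \<le> dyadic T m j \<Longrightarrow>
    dyadic T m (Suc j) \<le> t \<Longrightarrow>
    \<bar>y (dyadic T m (Suc j)) - y (dyadic T m j)\<bar> \<le> (c powr (- 1 / q)) ^ m * w2 s t powr (1 / q)"
    using summable_increments_control[OF T q c sy] by blast
  obtain w3 where w3: "control T w3" and le3: "\<And>r m j s t. m \<le> r \<Longrightarrow> j < 2 ^ m \<Longrightarrow> s \<le> dyadic T m j \<Longrightarrow>
    dyadic T m (Suc j) \<le> t \<Longrightarrow>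
    \<bar>dyadic_corr T x y r (j * 2 ^ (r - m)) ((j + 1) * 2 ^ (r - m))\<bar>
      \<le> (c powr (- 1 / (q / 2))) ^ r * w3 s t powr (1 / (q / 2))"
    using summable_corrections_control[OF T q c sxy] by blast
  have nn: "0 \<le> w1 s t" "0 \<le> w2 s t" "0 \<le> w3 s t" if "0 \<le> s" "s \<le> dyadic T m j" "dyadic T m (Suc j) \<le> t" "t \<le> T" for s t m j
  proof -
    have "s \<le> t" using that dyadic_mono[OF T, of m j "Suc j"] by auto
    then show "0 \<le> w1 s t" "0 \<le> w2 s t" "0 \<le> w3 s t"
      using control_nonneg[OF _ that(1) _ that(4)] w1 w2 w3 by auto
  qed
  show ?thesis
  proof (rule that[of "\<lambda>s t. w1 s t + w2 s t + w3 s t"])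
    show "control T (\<lambda>s t. w1 s t + w2 s t + w3 s t)" by (intro control_add w1 w2 w3)
  next
    fix m j s t
    assume *: "j < 2 ^ m" "0 \<le> s" "s \<le> dyadic T m j" "dyadic T m (Suc j) \<le> t" "t \<le> T"
    have "w1 s t powr (1 / q) \<le> (w1 s t + w2 s t + w3 s t) powr (1 / q)"
      "w2 s t powr (1 / q) \<le> (w1 s t + w2 s t + w3 s t) powr (1 / q)"
      using nn[OF *(2-)] q by (auto intro!: powr_mono2)
    then show "\<bar>x (dyadic T m (Suc j)) - x (dyadic T m j)\<bar>
        \<le> (c powr (- 1 / q)) ^ m * (w1 s t + w2 s t + w3 s t) powr (1 / q) \<and>
      \<bar>y (dyadic T m (Suc j)) - y (dyadic T m j)\<bar>
        \<le> (c powr (- 1 / q)) ^ m * (w1 s t + w2 s t + w3 s t) powr (1 / q)"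
      by (intro conjI order_trans[OF le1[OF *(1,3,4)] mult_left_mono]
          order_trans[OF le2[OF *(1,3,4)] mult_left_mono]) auto
  next
    fix r m j s t
    assume *: "m \<le> r" "j < 2 ^ m" "0 \<le> s" "s \<le> dyadic T m j" "dyadic T m (Suc j) \<le> t" "t \<le> T"
    have "w3 s t powr (1 / (q / 2)) \<le> (w1 s t + w2 s t + w3 s t) powr (1 / (q / 2))"
      using nn[OF *(3-)] q by (intro powr_mono2) auto
    then show "\<bar>dyadic_corr T x y r (j * 2 ^ (r - m)) ((j + 1) * 2 ^ (r - m))\<bar>
        \<le> (c powr (- 1 / (q / 2))) ^ r * (w1 s t + w2 s t + w3 s t) powr (1 / (q / 2))"
      by (intro order_trans[OF le3[OF *(1,2,4,5)] mult_left_mono]) auto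
  qed
qed

text \<open>
  Let \<open>\<kappa> = w(s, t)\<^sup>1\<^sup>/\<^sup>q\<close>. Inside \<open>[s, t]\<close> a dyadic interval of level \<open>m\<close> has increments at most
  \<open>\<theta>\<^sup>m \<kappa>\<close> and, by telescoping the corrections, area at most a multiple of \<open>\<rho>\<^sup>m \<kappa>\<^sup>2\<close> with \<open>\<theta>, \<rho> < 1\<close>,
  uniformly in the level on which the area is computed. The chain lemma adds these up to a multiple
  of \<open>\<kappa>\<^sup>2\<close>.
\<close>

lemma area_control:
  assumes T: "0 < T" and q: "0 < q" and c: "1 < c"
    and cont: "continuous_on {0..T} x" "continuous_on {0..T} y"
    and sx: "summable_increments T q c x" and sy: "summable_increments T q c y"
    and sxy: "summable_corrections T q c x y"
  shows "area_controlled T q x y"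
proof -
  let ?\<theta> = "c powr (- 1 / q)" and ?\<rho> = "c powr (- 1 / (q / 2))"
  have th: "0 \<le> ?\<theta>" "?\<theta> < 1" using root_rate_less_1[OF c q] by auto
  have rh: "0 \<le> ?\<rho>" "?\<rho> < 1" using root_rate_less_1[OF c, of "q / 2"] q by auto
  obtain w where w: "control T w"
    and lexy: "\<And>m j s t. j < 2 ^ m \<Longrightarrow> 0 \<le> s \<Longrightarrow> s \<le> dyadic T m j \<Longrightarrow> dyadic T m (Suc j) \<le> t \<Longrightarrow> t \<le> T \<Longrightarrow>
      \<bar>x (dyadic T m (Suc j)) - x (dyadic T m j)\<bar> \<le> ?\<theta> ^ m * w s t powr (1 / q) \<and>
      \<bar>y (dyadic T m (Suc j)) - y (dyadic T m j)\<bar> \<le> ?\<theta> ^ m * w s t powr (1 / q)"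
    and lec: "\<And>r m j s t. m \<le> r \<Longrightarrow> j < 2 ^ m \<Longrightarrow> 0 \<le> s \<Longrightarrow> s \<le> dyadic T m j \<Longrightarrow>
      dyadic T m (Suc j) \<le> t \<Longrightarrow> t \<le> T \<Longrightarrow>
      \<bar>dyadic_corr T x y r (j * 2 ^ (r - m)) ((j + 1) * 2 ^ (r - m))\<bar>
        \<le> ?\<rho> ^ r * w s t powr (1 / (q / 2))"
    using pair_control[OF T q c sx sy sxy] by blast
  define C where "C = 2 * (1 / (1 - ?\<rho>) * (1 / (1 - ?\<rho>)) + 2 / (1 - ?\<theta>) * (1 / (1 - ?\<theta>)))"
  have C0: "0 \<le> C" unfolding C_def using th rh by (intro mult_nonneg_nonneg add_nonneg_nonneg) auto
  have "\<bar>dyadic_area T x y n k l\<bar> powr (q / 2) \<le> C powr (q / 2) * w (dyadic T n k) (dyadic T n l)"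
    if kl: "k < l" "l \<le> 2 ^ n" for n k l
  proof -
    define s t where "s = dyadic T n k" and "t = dyadic T n l"
    have st: "0 \<le> s" "s \<le> t" "t \<le> T"
      using dyadic_in_range[OF T, of k n] dyadic_in_range[OF T, of l n] kl dyadic_mono[OF T, of n k l]
      unfolding s_def t_def by auto
    define \<kappa> where "\<kappa> = w s t powr (1 / q)"
    define \<kappa>2 where "\<kappa>2 = w s t powr (1 / (q / 2))"
    have kk: "\<kappa> * \<kappa> = \<kappa>2" unfolding \<kappa>_def \<kappa>2_def by (simp add: powr_add[symmetric])
    have k0: "0 \<le> \<kappa>" "0 \<le> \<kappa>2" unfolding \<kappa>_def \<kappa>2_def by auto
    have xy1: "\<bar>x (dyadic T m (Suc j)) - x (dyadic T m j)\<bar> \<le> ?\<theta> ^ m * \<kappa>"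
      "\<bar>y (dyadic T m (Suc j)) - y (dyadic T m j)\<bar> \<le> ?\<theta> ^ m * \<kappa>"
      if "j < 2 ^ m" "s \<le> dyadic T m j" "dyadic T m (Suc j) \<le> t" for m j
      using lexy[OF that(1) st(1) that(2,3) st(3)] unfolding \<kappa>_def by auto
    have c1: "\<bar>dyadic_corr T x y r (j * 2 ^ (r - m)) ((j + 1) * 2 ^ (r - m))\<bar> \<le> ?\<rho> ^ r * \<kappa>2"
      if "m \<le> r" "j < 2 ^ m" "s \<le> dyadic T m j" "dyadic T m (Suc j) \<le> t" for r m j
      using lec[OF that(1,2) st(1) that(3,4) st(3)] unfolding \<kappa>2_def .
    have sub: "j < 2 ^ m" "s \<le> dyadic T m j" "dyadic T m (Suc j) \<le> t"
      if *: "m \<le> n" "k \<le> j * 2 ^ (n - m)" "(j + 1) * 2 ^ (n - m) \<le> l" for m j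
    proof -
      have "(j + 1) * 2 ^ (n - m) \<le> 2 ^ m * 2 ^ (n - m)"
        using * kl by (simp add: power_add[symmetric] del: mult_Suc)
      then have "j + 1 \<le> 2 ^ m" by (subst (asm) mult_le_cancel2) simp
      then show "j < 2 ^ m" by simp
      show "s \<le> dyadic T m j"
        using *(2) dyadic_scale[OF *(1), of T j] dyadic_mono[OF T, of n] unfolding s_def by metis
      show "dyadic T m (Suc j) \<le> t"
        using *(3) dyadic_scale[OF *(1), of T "Suc j"] dyadic_mono[OF T, of n] unfolding t_def
        by (metis Suc_eq_plus1)
    qed
    let ?B = "2 * \<kappa> / (1 - ?\<theta>)"
    have sub': "0 \<le> dyadic T n i" "dyadic T n i \<le> dyadic T n j" "dyadic T n j \<le> T"
      "s \<le> dyadic T n i" "dyadic T n j \<le> t" if "k \<le> i" "i \<le> j" "j \<le> l" for i j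
    proof -
      show "s \<le> dyadic T n i" "dyadic T n i \<le> dyadic T n j" "dyadic T n j \<le> t"
        using that dyadic_mono[OF T, of n] unfolding s_def t_def by auto
      then show "0 \<le> dyadic T n i" "dyadic T n j \<le> T" using st by auto
    qed
    have "\<bar>dyadic_area T x y n k l\<bar> \<le> 2 * (\<Sum>m\<le>n. ?\<rho> ^ m * (\<kappa>2 / (1 - ?\<rho>)) + ?B * (?\<theta> ^ m * \<kappa>))"
    proof (rule dyadic_chain_area[where x = "\<lambda>i. x (dyadic T n i)" and y = "\<lambda>i. y (dyadic T n i)",
          OF dyadic_area_chen])
      fix m j assume *: "m \<le> n" "k \<le> j * 2 ^ (n - m)" "(j + 1) * 2 ^ (n - m) \<le> l"
      show "\<bar>x (dyadic T n ((j + 1) * 2 ^ (n - m))) - x (dyadic T n (j * 2 ^ (n - m)))\<bar> \<le> ?\<theta> ^ m * \<kappa>"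
        unfolding dyadic_scale[OF *(1)] using xy1(1)[OF sub[OF *]] by simp
      show "\<bar>y (dyadic T n ((j + 1) * 2 ^ (n - m))) - y (dyadic T n (j * 2 ^ (n - m)))\<bar> \<le> ?\<theta> ^ m * \<kappa>"
        unfolding dyadic_scale[OF *(1)] using xy1(2)[OF sub[OF *]] by simp
      have "\<bar>dyadic_area T x y n (j * 2 ^ (n - m)) ((j + 1) * 2 ^ (n - m))\<bar>
          \<le> (\<Sum>r=m..<n. ?\<rho> ^ r * \<kappa>2)"
        unfolding dyadic_area_telescope[OF *(1)]
        by (rule order_trans[OF sum_abs sum_mono]) (use c1 sub[OF *] in auto)
      also have "\<dots> = (\<Sum>r=m..<n. ?\<rho> ^ r) * \<kappa>2" by (simp add: sum_distrib_right)
      also have "\<dots> \<le> ?\<rho> ^ m / (1 - ?\<rho>) * \<kappa>2"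
        by (intro mult_right_mono geometric_segment_le rh k0)
      finally show "\<bar>dyadic_area T x y n (j * 2 ^ (n - m)) ((j + 1) * 2 ^ (n - m))\<bar>
          \<le> ?\<rho> ^ m * (\<kappa>2 / (1 - ?\<rho>))" by simp
    next
      fix i j assume *: "k \<le> i" "i \<le> j" "j \<le> l"
      note ** = sub'[OF *]
      show "\<bar>x (dyadic T n j) - x (dyadic T n i)\<bar> \<le> ?B"
        by (rule increment_le_of_dyadic[OF T cont(1) th k0(1) **(1-3) xy1(1)]) (use ** in auto)
      show "\<bar>y (dyadic T n j) - y (dyadic T n i)\<bar> \<le> ?B"
        by (rule increment_le_of_dyadic[OF T cont(2) th k0(1) **(1-3) xy1(2)]) (use ** in auto)
    qed (use kl th rh k0 in auto)
    also have "\<dots> = 2 * (\<kappa>2 / (1 - ?\<rho>) * (\<Sum>m\<le>n. ?\<rho> ^ m) + 2 * \<kappa>2 / (1 - ?\<theta>) * (\<Sum>m\<le>n. ?\<theta> ^ m))"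
      unfolding kk[symmetric] by (simp add: sum.distrib sum_distrib_left sum_divide_distrib mult_ac)
    also have "\<dots> \<le> 2 * (\<kappa>2 / (1 - ?\<rho>) * (1 / (1 - ?\<rho>)) + 2 * \<kappa>2 / (1 - ?\<theta>) * (1 / (1 - ?\<theta>)))"
      using th rh k0 by (intro mult_left_mono add_mono geometric_partial_le) auto
    also have "\<dots> = C * \<kappa>2" unfolding C_def by (simp add: algebra_simps)
    finally have "\<bar>dyadic_area T x y n k l\<bar> powr (q / 2) \<le> (C * \<kappa>2) powr (q / 2)"
      using q by (intro powr_mono2) auto
    also have "\<dots> = C powr (q / 2) * w s t"
      using C0 k0 q control_nonneg[OF w st] unfolding \<kappa>2_def by (simp add: powr_mult powr_powr)
    finally show ?thesis unfolding s_def t_def .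
  qed
  moreover have "control T (\<lambda>s t. C powr (q / 2) * w s t)" by (rule control_scale[OF w]) simp
  ultimately show ?thesis
    unfolding area_controlled_def by (intro exI[of _ "\<lambda>s t. C powr (q / 2) * w s t"]) auto
qed

section \<open>Uniform convergence of the Riemann sums\<close>

lemma dyadic_cell:
  assumes T: "0 < T" and t: "t \<in> {0..T}"
  obtains k where "k < 2 ^ n" "dyadic T n k \<le> t" "t \<le> dyadic T n (Suc k)"
proof (cases "t = T")
  case True
  have "Suc (2 ^ n - 1) = (2 ^ n :: nat)" by simp
  then have e: "dyadic T n (Suc (2 ^ n - 1)) = T" by (metis dyadic_end)
  then have "dyadic T n (2 ^ n - 1) \<le> T" using dyadic_mono[OF T, of n "2 ^ n - 1" "Suc (2 ^ n - 1)"] by auto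
  with e True show ?thesis by (intro that[of "2 ^ n - 1"]) auto
next
  case False
  then obtain k where "k < 2 ^ n" "dyadic T n k \<le> t" "t < dyadic T n (Suc k)"
    using dyadic_cell_left[OF T, of t n] t by auto
  then show ?thesis by (intro that[of k]) auto
qed

text \<open>
  Cells to the left of \<open>t\<close> contribute the full correction, cells to the right nothing, and the cell
  that contains \<open>t\<close> an incomplete product.
\<close>

lemma dyadic_riemann_refine:
  assumes T: "0 < T" and k: "k < 2 ^ n" "dyadic T n k \<le> t" "t \<le> dyadic T n (Suc k)"
  shows "dyadic_riemann T x y (Suc n) t - dyadic_riemann T x y n t = dyadic_corr T x y n 0 k
    + (x (dyadic T (Suc n) (2 * k + 1)) - x (dyadic T n k)) * (y t - y (min (dyadic T (Suc n) (2 * k + 1)) t))"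
proof -
  let ?m = "\<lambda>i. dyadic T (Suc n) (2 * i + 1)"
  let ?f = "\<lambda>i. (x (?m i) - x (dyadic T n i)) * (y (min (dyadic T n (Suc i)) t) - y (min (?m i) t))"
  have d: "dyadic T (Suc n) (Suc (Suc (2 * i))) = dyadic T n (Suc i)" for i
    using dyadic_Suc_double[of T n "Suc i"] by simp
  have fine: "dyadic_riemann T x y (Suc n) t = (\<Sum>i=2 * 0..<2 * 2 ^ n.
     x (dyadic T (Suc n) i) * (y (min (dyadic T (Suc n) (Suc i)) t) - y (min (dyadic T (Suc n) i) t)))"
    unfolding dyadic_riemann_def by (simp add: atLeast0LessThan)
  have "dyadic_riemann T x y (Suc n) t - dyadic_riemann T x y n t = (\<Sum>i<2 ^ n. ?f i)"
    unfolding fine sum_pairs unfolding dyadic_riemann_def atLeast0LessThan sum_subtractf[symmetric]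
    by (intro sum.cong refl) (simp add: dyadic_Suc_double d, simp add: algebra_simps)
  also have "(\<Sum>i<2 ^ n. ?f i) = (\<Sum>i<k. ?f i) + ?f k + (\<Sum>i=Suc k..<2 ^ n. ?f i)"
  proof -
    have "(\<Sum>i<2 ^ n. ?f i) = (\<Sum>i=0..<k. ?f i) + (\<Sum>i=k..<2 ^ n. ?f i)"
      using sum.atLeastLessThan_concat[of 0 k "2 ^ n" ?f] k(1) by (simp only: lessThan_atLeast0)
    moreover have "(\<Sum>i=k..<2 ^ n. ?f i) = ?f k + (\<Sum>i=Suc k..<2 ^ n. ?f i)"
      by (rule sum.atLeast_Suc_lessThan[OF k(1)])
    ultimately show ?thesis by (simp only: lessThan_atLeast0)
  qed
  also have "(\<Sum>i=Suc k..<2 ^ n. ?f i) = 0"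
  proof (intro sum.neutral ballI)
    fix i assume i: "i \<in> {Suc k..<2 ^ n}"
    have "t \<le> dyadic T n i" using k(3) dyadic_mono[OF T, of n "Suc k" i] i by auto
    moreover have "dyadic T n i \<le> ?m i" "dyadic T n i \<le> dyadic T n (Suc i)"
      using dyadic_mono[OF T, of "Suc n" "2 * i" "2 * i + 1"] dyadic_mono[OF T, of n i "Suc i"]
      by (auto simp: dyadic_Suc_double)
    ultimately have "min (dyadic T n (Suc i)) t = t" "min (?m i) t = t" by auto
    then show "?f i = 0" by simp
  qed
  also have "(\<Sum>i<k. ?f i) = dyadic_corr T x y n 0 k"
    unfolding dyadic_corr_def atLeast0LessThan
  proof (intro sum.cong refl)
    fix i assume i: "i \<in> {..<k}"
    have "dyadic T n (Suc i) \<le> t" using k(2) dyadic_mono[OF T, of n "Suc i" k] i by auto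
    moreover have "?m i \<le> dyadic T n (Suc i)"
      using dyadic_mono[OF T, of "Suc n" "2 * i + 1" "2 * Suc i"] by (simp add: dyadic_Suc_double d)
    ultimately have "min (dyadic T n (Suc i)) t = dyadic T n (Suc i)" "min (?m i) t = ?m i" by auto
    then show "?f i = (x (?m i) - x (dyadic T n i)) * (y (dyadic T n (Suc i)) - y (?m i))" by simp
  qed
  finally show ?thesis using k by (simp add: min_def)
qed

lemma summable_linear_geometric:
  fixes \<rho> :: real assumes "0 \<le> \<rho>" "\<rho> < 1" shows "summable (\<lambda>n. real (Suc n) * \<rho> ^ n)"
proof -
  have "summable (\<lambda>n. diffs (\<lambda>_. 1 :: real) n * \<rho> ^ n)"
    by (rule termdiff_converges[of _ 1]) (use assms summable_geometric in auto)
  then show ?thesis by (simp add: diffs_def)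
qed

text \<open>
  Successive Riemann sums differ by a correction over an initial segment of the grid plus one product.
  The initial segment consists of at most two dyadic intervals per level, each with a correction of
  order \<open>\<rho>\<^sup>n\<close>, so the difference is of order \<open>(n + 1) \<rho>\<^sup>n + \<theta>\<^sup>n\<close> uniformly in \<open>t\<close>, as
  in the Rademacher-Menshov argument.
\<close>

lemma riemann_uniformly_convergent:
  assumes T: "0 < T" and q: "0 < q" and c: "1 < c"
    and cont: "continuous_on {0..T} x" "continuous_on {0..T} y"
    and sx: "summable_increments T q c x" and sy: "summable_increments T q c y"
    and sxy: "summable_corrections T q c x y"
  shows "uniformly_convergent_on {0..T} (dyadic_riemann T x y)"
proof -
  let ?\<theta> = "c powr (- 1 / q)" and ?\<rho> = "c powr (- 1 / (q / 2))"
  have th: "0 \<le> ?\<theta>" "?\<theta> < 1" using root_rate_less_1[OF c q] by auto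
  have rh: "0 \<le> ?\<rho>" "?\<rho> < 1" using root_rate_less_1[OF c, of "q / 2"] q by auto
  obtain w where w: "control T w"
    and lexy: "\<And>m j s t. j < 2 ^ m \<Longrightarrow> 0 \<le> s \<Longrightarrow> s \<le> dyadic T m j \<Longrightarrow> dyadic T m (Suc j) \<le> t \<Longrightarrow> t \<le> T \<Longrightarrow>
      \<bar>x (dyadic T m (Suc j)) - x (dyadic T m j)\<bar> \<le> ?\<theta> ^ m * w s t powr (1 / q) \<and>
      \<bar>y (dyadic T m (Suc j)) - y (dyadic T m j)\<bar> \<le> ?\<theta> ^ m * w s t powr (1 / q)"
    and lec: "\<And>r m j s t. m \<le> r \<Longrightarrow> j < 2 ^ m \<Longrightarrow> 0 \<le> s \<Longrightarrow> s \<le> dyadic T m j \<Longrightarrow>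
      dyadic T m (Suc j) \<le> t \<Longrightarrow> t \<le> T \<Longrightarrow>
      \<bar>dyadic_corr T x y r (j * 2 ^ (r - m)) ((j + 1) * 2 ^ (r - m))\<bar>
        \<le> ?\<rho> ^ r * w s t powr (1 / (q / 2))"
    using pair_control[OF T q c sx sy sxy] by blast
  define K1 where "K1 = w 0 T powr (1 / q)"
  define K2 where "K2 = 2 * (w 0 T powr (1 / q)) / (1 - ?\<theta>)"
  define K3 where "K3 = w 0 T powr (1 / (q / 2))"
  have K: "0 \<le> K1" "0 \<le> K2" "0 \<le> K3" using th by (auto simp: K1_def K2_def K3_def)
  define b where "b n = 2 * K3 * (real (Suc n) * ?\<rho> ^ n) + K1 * K2 * ?\<theta> ^ Suc n" for n
  have sb: "summable b" unfolding b_def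
    by (intro summable_add summable_mult summable_linear_geometric rh)
      (use th summable_geometric[of ?\<theta>] in \<open>simp add: summable_Suc_iff\<close>)
  have step: "norm (dyadic_riemann T x y (Suc n) t - dyadic_riemann T x y n t) \<le> b n"
    if t: "t \<in> {0..T}" for n t
  proof -
    obtain k where k: "k < 2 ^ n" "dyadic T n k \<le> t" "t \<le> dyadic T n (Suc k)"
      using dyadic_cell[OF T t] .
    let ?m = "dyadic T (Suc n) (2 * k + 1)"
    have mid: "dyadic T n k \<le> ?m" "?m \<le> dyadic T n (Suc k)"
      using dyadic_mono[OF T, of "Suc n" "2 * k" "2 * k + 1"]
        dyadic_mono[OF T, of "Suc n" "2 * k + 1" "2 * Suc k"]
      unfolding dyadic_Suc_double by auto
    have mT: "0 \<le> ?m" "?m \<le> T"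
      using mid dyadic_in_range[OF T, of k n] dyadic_in_range[OF T, of "Suc k" n] k(1) by auto
    have "\<bar>dyadic_corr T x y n 0 k - dyadic_corr T x y n 0 0\<bar> \<le> 2 * (\<Sum>m\<le>n. ?\<rho> ^ n * K3)"
    proof (rule dyadic_chain_increment)
      fix m j assume *: "m \<le> n" "0 \<le> j * 2 ^ (n - m)" "(j + 1) * 2 ^ (n - m) \<le> k"
      have "(j + 1) * 2 ^ (n - m) \<le> 2 ^ m * 2 ^ (n - m)"
        using * k(1) by (simp add: power_add[symmetric] del: mult_Suc)
      then have "j + 1 \<le> 2 ^ m" by (subst (asm) mult_le_cancel2) simp
      then have j: "j < 2 ^ m" by simp
      have "dyadic_corr T x y n 0 ((j + 1) * 2 ^ (n - m)) - dyadic_corr T x y n 0 (j * 2 ^ (n - m))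
          = dyadic_corr T x y n (j * 2 ^ (n - m)) ((j + 1) * 2 ^ (n - m))"
        unfolding dyadic_corr_def by (subst sum_diff_nat_ivl) auto
      also have "\<bar>\<dots>\<bar> \<le> ?\<rho> ^ n * K3" unfolding K3_def
        using dyadic_in_range[OF T, of j m] dyadic_in_range[OF T, of "Suc j" m] j
        by (intro lec *) auto
      finally show "\<bar>dyadic_corr T x y n 0 ((j + 1) * 2 ^ (n - m)) - dyadic_corr T x y n 0 (j * 2 ^ (n - m))\<bar>
          \<le> ?\<rho> ^ n * K3" .
    qed (use k(1) K in auto)
    then have 1: "\<bar>dyadic_corr T x y n 0 k\<bar> \<le> 2 * K3 * (real (Suc n) * ?\<rho> ^ n)"
      by (simp add: dyadic_corr_def algebra_simps)
    have "\<bar>x ?m - x (dyadic T (Suc n) (2 * k))\<bar> \<le> ?\<theta> ^ Suc n * K1" unfolding K1_def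
      using lexy[of "2 * k" "Suc n" 0 T] dyadic_in_range[OF T, of k n] mT k(1)
      by (auto simp: dyadic_Suc_double)
    moreover have "\<bar>y t - y (min ?m t)\<bar> \<le> K2" unfolding K2_def
    proof (rule increment_le_of_dyadic[OF T cont(2) th])
      fix m j assume *: "j < 2 ^ m" "min ?m t \<le> dyadic T m j" "dyadic T m (Suc j) \<le> t"
      show "\<bar>y (dyadic T m (Suc j)) - y (dyadic T m j)\<bar> \<le> ?\<theta> ^ m * w 0 T powr (1 / q)"
        using lexy[of j m 0 T] dyadic_in_range[OF T, of j m] dyadic_in_range[OF T, of "Suc j" m] *(1)
        by auto
    qed (use t mT in auto)
    ultimately have 2: "\<bar>(x ?m - x (dyadic T n k)) * (y t - y (min ?m t))\<bar> \<le> (?\<theta> ^ Suc n * K1) * K2"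
      unfolding abs_mult dyadic_Suc_double using K th by (intro mult_mono) auto
    show ?thesis unfolding dyadic_riemann_refine[OF T k] b_def real_norm_def
      by (rule order_trans[OF abs_triangle_ineq]) (use 1 2 in \<open>simp add: algebra_simps\<close>)
  qed
  have "uniformly_convergent_on {0..T}
      (\<lambda>n t. \<Sum>i<n. dyadic_riemann T x y (Suc i) t - dyadic_riemann T x y i t)"
    by (rule Weierstrass_m_test'[OF step sb])
  then have "uniformly_convergent_on {0..T}
      (\<lambda>n t. (\<Sum>i<n. dyadic_riemann T x y (Suc i) t - dyadic_riemann T x y i t) + dyadic_riemann T x y 0 t)"
    by (rule uniformly_convergent_add) (auto intro!: uniformly_convergentI uniform_limit_intros)
  moreover have "(\<lambda>n t. (\<Sum>i<n. dyadic_riemann T x y (Suc i) t - dyadic_riemann T x y i t)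
      + dyadic_riemann T x y 0 t) = dyadic_riemann T x y"
  proof (intro ext)
    fix n t
    show "(\<Sum>i<n. dyadic_riemann T x y (Suc i) t - dyadic_riemann T x y i t)
      + dyadic_riemann T x y 0 t = dyadic_riemann T x y n t"
      using sum_lessThan_telescope[of "\<lambda>i. dyadic_riemann T x y i t" n] by simp
  qed
  ultimately show ?thesis by simp
qed

section \<open>Property (RIE) in coordinates\<close>

lemma riemann_sum_component:
  "riemann_sum (dyadic_size n) (dyadic T n) X t $ i $ j
    = dyadic_riemann T (\<lambda>u. X u $ i) (\<lambda>u. X u $ j) n t"
  by (simp add: riemann_sum_def dyadic_riemann_def dyadic_size_def tensor_def)

lemma dyadic_riemann_at_grid:
  assumes T: "0 < T" and l: "l \<le> 2 ^ n"
  shows "dyadic_riemann T x y n (dyadic T n l)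
    = (\<Sum>i=0..<l. x (dyadic T n i) * (y (dyadic T n (Suc i)) - y (dyadic T n i)))"
proof -
  let ?f = "\<lambda>i. x (dyadic T n i) * (y (min (dyadic T n (Suc i)) (dyadic T n l)) - y (min (dyadic T n i) (dyadic T n l)))"
  have "dyadic_riemann T x y n (dyadic T n l) = (\<Sum>i=0..<l. ?f i) + (\<Sum>i=l..<2 ^ n. ?f i)"
    unfolding dyadic_riemann_def lessThan_atLeast0
    by (rule sum.atLeastLessThan_concat[symmetric]) (use l in auto)
  also have "(\<Sum>i=l..<2 ^ n. ?f i) = 0"
  proof (rule sum.neutral, rule ballI)
    fix i assume "i \<in> {l..<2 ^ n}"
    then have "dyadic T n l \<le> dyadic T n i" "dyadic T n l \<le> dyadic T n (Suc i)"
      by (simp_all add: dyadic_mono[OF T])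
    then show "?f i = 0" by (simp add: min_absorb2)
  qed
  also have "(\<Sum>i=0..<l. ?f i) = (\<Sum>i=0..<l. x (dyadic T n i) * (y (dyadic T n (Suc i)) - y (dyadic T n i)))"
  proof (rule sum.cong[OF refl])
    fix i assume "i \<in> {0..<l}"
    then have "dyadic T n i \<le> dyadic T n l" "dyadic T n (Suc i) \<le> dyadic T n l"
      by (simp_all add: dyadic_mono[OF T])
    then show "?f i = x (dyadic T n i) * (y (dyadic T n (Suc i)) - y (dyadic T n i))"
      by (simp add: min_absorb1)
  qed
  finally show ?thesis by simp
qed

text \<open>
  The quantity that Property (RIE) bounds is the discrete area.
\<close>

lemma dyadic_area_eq_riemann:
  assumes T: "0 < T" and kl: "k \<le> l" "l \<le> 2 ^ n"
  shows "dyadic_riemann T x y n (dyadic T n l) - dyadic_riemann T x y n (dyadic T n k)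
      - x (dyadic T n k) * (y (dyadic T n l) - y (dyadic T n k)) = dyadic_area T x y n k l"
proof -
  let ?g = "\<lambda>i. x (dyadic T n i) * (y (dyadic T n (Suc i)) - y (dyadic T n i))"
  have "(\<Sum>i=0..<l. ?g i) = (\<Sum>i=0..<k. ?g i) + (\<Sum>i=k..<l. ?g i)"
    by (rule sum.atLeastLessThan_concat[symmetric]) (use kl in auto)
  moreover have "y (dyadic T n l) - y (dyadic T n k) = (\<Sum>i=k..<l. y (dyadic T n (Suc i)) - y (dyadic T n i))"
    using sum_Suc_diff'[OF kl(1), of "\<lambda>u. y (dyadic T n u)"] by simp
  moreover have "dyadic_area T x y n k l = (\<Sum>i=k..<l. ?g i)
      - x (dyadic T n k) * (\<Sum>i=k..<l. y (dyadic T n (Suc i)) - y (dyadic T n i))"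
    unfolding dyadic_area_def sum_distrib_left sum_subtractf[symmetric]
    by (rule sum.cong[OF refl]) (simp add: algebra_simps)
  ultimately show ?thesis
    using dyadic_riemann_at_grid[OF T, of l n x y] dyadic_riemann_at_grid[OF T, of k n x y] kl by simp
qed

lemma sum_powr_le:
  fixes a :: "'i \<Rightarrow> real"
  assumes "finite I" "\<And>i. i \<in> I \<Longrightarrow> 0 \<le> a i" "0 < q"
  shows "(\<Sum>i\<in>I. a i) powr q \<le> real (card I) powr q * (\<Sum>i\<in>I. a i powr q)"
proof (cases "I = {}")
  case False
  define m where "m = Max (a ` I)"
  have m: "m \<in> a ` I" "\<And>i. i \<in> I \<Longrightarrow> a i \<le> m" unfolding m_def using assms False by auto
  then have m0: "0 \<le> m" using assms by auto
  have "(\<Sum>i\<in>I. a i) \<le> real (card I) * m" using m by (intro sum_bounded_above) auto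
  then have "(\<Sum>i\<in>I. a i) powr q \<le> (real (card I) * m) powr q"
    using assms by (intro powr_mono2 sum_nonneg) auto
  also have "\<dots> = real (card I) powr q * m powr q" by (rule powr_mult)
  also have "m powr q \<le> (\<Sum>i\<in>I. a i powr q)"
  proof -
    from m(1) obtain i where i: "i \<in> I" "m = a i" by auto
    then show ?thesis using assms(1) by (auto intro!: member_le_sum)
  qed
  finally show ?thesis by (simp add: mult_left_mono)
qed simp

lemma norm_matrix_le_l1:
  fixes A :: "real ^ 'n ^ 'm"
  shows "norm A \<le> (\<Sum>z\<in>UNIV. \<bar>A $ fst z $ snd z\<bar>)"
proof -
  have "norm A \<le> (\<Sum>i\<in>UNIV. norm (A $ i))"
    unfolding norm_vec_def[of A] by (rule L2_set_le_sum, simp)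
  also have "\<dots> \<le> (\<Sum>i\<in>UNIV. \<Sum>j\<in>UNIV. \<bar>A $ i $ j\<bar>)"
    by (intro sum_mono norm_le_l1_cart)
  also have "\<dots> = (\<Sum>z\<in>UNIV. \<bar>A $ fst z $ snd z\<bar>)"
    by (simp add: sum.cartesian_product UNIV_Times_UNIV[symmetric] case_prod_beta del: UNIV_Times_UNIV)
  finally show ?thesis .
qed

text \<open>
  Half of the budget \<open>1\<close> in Property (RIE) goes to each of the two suprema.
\<close>

lemma ennreal_ratio_le_half:
  assumes "0 \<le> a" "2 * a \<le> w"
  shows "ennreal a / ennreal w \<le> ennreal (1 / 2)"
proof (cases "w = 0")
  case True
  then show ?thesis using assms by simp
next
  case False
  then have "0 < w" using assms by linarith
  then show ?thesis using assms by (simp add: divide_ennreal field_simps del: ennreal_half)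
qed

lemma ennreal_ratio_le_1D:
  assumes "ennreal a / ennreal w \<le> 1" "0 \<le> a" "0 \<le> w"
  shows "a \<le> w"
proof (cases "w = 0")
  case True
  have "a = 0"
  proof (rule ccontr)
    assume "a \<noteq> 0"
    then have "ennreal a / ennreal w = \<infinity>"
      using True assms(2) by (simp add: ennreal_divide_eq_top_iff)
    with assms(1) show False by (simp add: top_unique)
  qed
  with True show ?thesis by simp
next
  case False
  then have "ennreal (a / w) \<le> 1" using assms by (simp add: divide_ennreal)
  then show ?thesis using assms False by (simp add: ennreal_le_1 field_simps)
qed

lemma step_path_dyadic:
  assumes T: "0 < T" and t: "t \<in> {0..T}"
  shows "\<exists>u\<in>{0..T}. \<bar>t - u\<bar> \<le> T / 2 ^ n \<and> step_path T (dyadic_size n) (dyadic T n) X t = X u"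
proof (cases "t = T")
  case True
  have "indicator {dyadic T n k..<dyadic T n (Suc k)} T *\<^sub>R X (dyadic T n k) = 0"
    if "k \<in> {..<dyadic_size n}" for k
    using dyadic_in_range[OF T, of "Suc k" n] that by (simp add: dyadic_size_def indicator_def)
  then have "step_path T (dyadic_size n) (dyadic T n) X t = X T"
    unfolding step_path_def True by (simp only: sum.neutral_const sum.cong[OF refl]) simp
  then show ?thesis using True T by (intro bexI[of _ T]) auto
next
  case False
  then obtain k where k: "k < 2 ^ n" "dyadic T n k \<le> t" "t < dyadic T n (Suc k)"
    using dyadic_cell_left[OF T, of t n] t by auto
  have "indicator {dyadic T n i..<dyadic T n (Suc i)} t *\<^sub>R X (dyadic T n i) = (if i = k then X (dyadic T n k) else 0)"
    for i
  proof (cases "i = k")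
    case False
    then consider "Suc i \<le> k" | "Suc k \<le> i" by linarith
    then have "\<not> (dyadic T n i \<le> t \<and> t < dyadic T n (Suc i))"
    proof cases
      case 1 then show ?thesis using k(2) dyadic_mono[OF T, of n "Suc i" k] by auto
    next
      case 2 then show ?thesis using k(3) dyadic_mono[OF T, of n "Suc k" i] by auto
    qed
    then show ?thesis using False by (auto simp: indicator_def)
  qed (use k in \<open>auto simp: indicator_def\<close>)
  then have "step_path T (dyadic_size n) (dyadic T n) X t = X (dyadic T n k)"
    unfolding step_path_def using False k(1) by (simp add: dyadic_size_def)
  moreover have "dyadic T n (Suc k) = dyadic T n k + T / 2 ^ n"
    by (simp add: dyadic_def field_simps)
  then have "\<bar>t - dyadic T n k\<bar> \<le> T / 2 ^ n" using k by simp
  ultimately show ?thesis using dyadic_in_range[OF T, of k n] k(1) by (intro bexI[of _ "dyadic T n k"]) auto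
qed

lemma step_path_uniform_limit:
  assumes T: "0 < T" and cont: "continuous_on {0..T} X"
  shows "uniform_limit {0..T} (\<lambda>n. step_path T (dyadic_size n) (dyadic T n) X) X sequentially"
proof (rule uniform_limitI)
  fix e :: real assume e: "0 < e"
  have "uniformly_continuous_on {0..T} X"
    using cont by (intro compact_uniformly_continuous) auto
  then obtain d where d: "0 < d" "\<And>s t. s \<in> {0..T} \<Longrightarrow> t \<in> {0..T} \<Longrightarrow> dist t s < d \<Longrightarrow> dist (X t) (X s) < e"
    using e unfolding uniformly_continuous_on_def by blast
  have "\<forall>\<^sub>F n in sequentially. T / 2 ^ n < d"
    using order_tendstoD(2)[OF T_over_power_tendsto_0 d(1)] .
  then show "\<forall>\<^sub>F n in sequentially. \<forall>t\<in>{0..T}. dist (step_path T (dyadic_size n) (dyadic T n) X t) (X t) < e"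
  proof eventually_elim
    case (elim n)
    show ?case
    proof
      fix t assume t: "t \<in> {0..T}"
      obtain u where u: "u \<in> {0..T}" "\<bar>t - u\<bar> \<le> T / 2 ^ n"
        "step_path T (dyadic_size n) (dyadic T n) X t = X u"
        using step_path_dyadic[OF T t, of n X] by auto
      show "dist (step_path T (dyadic_size n) (dyadic T n) X t) (X t) < e"
        unfolding u(3) by (rule d(2)) (use t u elim in \<open>auto simp: dist_real_def\<close>)
    qed
  qed
qed

lemma continuous_imp_cadlag_on:
  assumes cont: "continuous_on {0..T} X"
  shows "cadlag_on T X"
  unfolding cadlag_on_def
proof (intro conjI ballI exI)
  fix t assume t: "t \<in> {0..<T}"
  have "(X \<longlongrightarrow> X t) (at t within {0..T})" using cont t by (auto simp: continuous_on_def)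
  then have "(X \<longlongrightarrow> X t) (at t within {t..T})" by (rule tendsto_within_subset) (use t in auto)
  then show "(X \<longlongrightarrow> X t) (at_right t)" using t by (simp add: at_within_Icc_at_right)
next
  fix t assume t: "t \<in> {0<..T}"
  have "(X \<longlongrightarrow> X t) (at t within {0..T})" using cont t by (auto simp: continuous_on_def)
  then have "(X \<longlongrightarrow> X t) (at t within {0..t})" by (rule tendsto_within_subset) (use t in auto)
  then show "(X \<longlongrightarrow> X t) (at_left t)" using t by (simp add: at_within_Icc_at_left)
qed

lemma uniformly_convergent_on_vec:
  fixes f :: "nat \<Rightarrow> 'x \<Rightarrow> ('b :: real_normed_vector) ^ 'm"
  assumes "\<And>i. uniformly_convergent_on S (\<lambda>n t. f n t $ i)"
  shows "uniformly_convergent_on S f"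
proof -
  from assms have "\<exists>l. uniform_limit S (\<lambda>n t. f n t $ i) l sequentially" for i
    by (auto simp: uniformly_convergent_on_def)
  then obtain l where l: "\<And>i. uniform_limit S (\<lambda>n t. f n t $ i) (l i) sequentially" by metis
  have "uniform_limit S f (\<lambda>t. \<chi> i. l i t) sequentially"
  proof (rule uniform_limitI)
    fix e :: real assume e: "0 < e"
    let ?e = "e / real (CARD('m))"
    have "\<forall>\<^sub>F n in sequentially. \<forall>i\<in>UNIV. \<forall>t\<in>S. dist (f n t $ i) (l i t) < ?e"
      using e by (intro eventually_ball_finite ballI uniform_limitD[OF l]) auto
    then show "\<forall>\<^sub>F n in sequentially. \<forall>t\<in>S. dist (f n t) (\<chi> i. l i t) < e"
    proof eventually_elim
      case (elim n)
      show ?case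
      proof
        fix t assume t: "t \<in> S"
        have "dist (f n t) (\<chi> i. l i t) \<le> (\<Sum>i\<in>UNIV. dist (f n t $ i) (l i t))"
          unfolding dist_vec_def using L2_set_le_sum[of UNIV "\<lambda>i. dist (f n t $ i) (l i t)"] by simp
        also have "\<dots> < (\<Sum>i\<in>(UNIV :: 'm set). ?e)" using elim t by (intro sum_strict_mono) auto
        finally show "dist (f n t) (\<chi> i. l i t) < e" by simp
      qed
    qed
  qed
  then show ?thesis by (auto simp: uniformly_convergent_on_def)
qed

text \<open>
  Property (RIE) can be checked coordinate by coordinate: a norm to a power is at most a multiple of
  the sum of the powers of the coordinates, so a multiple of the sum of all coordinate controls
  controls the vector-valued quantities.
\<close>

lemma RIE_dyadicI:
  fixes X :: "real \<Rightarrow> real ^ 'm"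
  assumes T: "0 < T" and q: "0 < q"
    and part: "\<And>n. is_partition T (dyadic_size n) (dyadic T n)"
    and mesh: "(\<lambda>n. mesh (dyadic_size n) (dyadic T n)) \<longlonglongrightarrow> 0"
    and cont: "continuous_on {0..T} X"
    and conv: "\<And>i j. uniformly_convergent_on {0..T} (dyadic_riemann T (\<lambda>u. X u $ i) (\<lambda>u. X u $ j))"
    and path: "\<And>i. path_controlled T q (\<lambda>u. X u $ i)"
    and area: "\<And>i j. area_controlled T q (\<lambda>u. X u $ i) (\<lambda>u. X u $ j)"
  shows "RIE T q dyadic_size (dyadic T) X"
proof -
  from path obtain wp where wp: "\<And>i. control T (wp i)"
    "\<And>i s t. (s, t) \<in> Simplex T \<Longrightarrow> \<bar>X t $ i - X s $ i\<bar> powr q \<le> wp i s t"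
    by (simp add: path_controlled_def case_prod_beta) (metis fst_conv snd_conv)
  from area obtain wa where wa: "\<And>i j. control T (wa i j)"
    "\<And>i j n k l. k < l \<Longrightarrow> l \<le> 2 ^ n \<Longrightarrow>
      \<bar>dyadic_area T (\<lambda>u. X u $ i) (\<lambda>u. X u $ j) n k l\<bar> powr (q / 2) \<le> wa i j (dyadic T n k) (dyadic T n l)"
    unfolding area_controlled_def by metis
  define Cp where "Cp = real CARD('m) powr q"
  define Ca where "Ca = real CARD('m \<times> 'm) powr (q / 2)"
  define w1 where "w1 s t = 2 * Cp * (\<Sum>i\<in>UNIV. wp i s t)" for s t
  define w2 where "w2 s t = 2 * Ca * (\<Sum>z\<in>UNIV. wa (fst z) (snd z) s t)" for s t
  have w1: "control T w1" unfolding w1_def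
    by (intro control_scale control_sum wp) (auto simp: Cp_def)
  have w2: "control T w2" unfolding w2_def
    by (intro control_scale control_sum wa) (auto simp: Ca_def)
  define w where "w s t = w1 s t + w2 s t" for s t
  have w: "control T w" unfolding w_def by (intro control_add w1 w2)
  have p1: "2 * norm (X t - X s) powr q \<le> w s t" if st: "(s, t) \<in> Simplex T" for s t
  proof -
    have "norm (X t - X s) powr q \<le> (\<Sum>i\<in>UNIV. \<bar>X t $ i - X s $ i\<bar>) powr q"
      using q norm_le_l1_cart[of "X t - X s"] by (intro powr_mono2) auto
    also have "\<dots> \<le> Cp * (\<Sum>i\<in>UNIV. \<bar>X t $ i - X s $ i\<bar> powr q)"
      unfolding Cp_def by (rule sum_powr_le) (use q in auto)
    also have "\<dots> \<le> Cp * (\<Sum>i\<in>UNIV. wp i s t)"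
      by (intro mult_left_mono sum_mono wp st) (auto simp: Cp_def)
    finally show ?thesis
      using control_nonneg[OF w2, of s t] st unfolding w_def w1_def Simplex_def by auto
  qed
  have p2: "2 * norm (riemann_sum (dyadic_size n) (dyadic T n) X (dyadic T n l)
      - riemann_sum (dyadic_size n) (dyadic T n) X (dyadic T n k)
      - tensor (X (dyadic T n k)) (X (dyadic T n l) - X (dyadic T n k))) powr (q / 2)
      \<le> w (dyadic T n k) (dyadic T n l)" (is "2 * norm ?A powr _ \<le> _")
    if kl: "k < l" "l \<le> 2 ^ n" for n k l
  proof -
    have A: "?A $ i $ j = dyadic_area T (\<lambda>u. X u $ i) (\<lambda>u. X u $ j) n k l" for i j
      using dyadic_area_eq_riemann[OF T, of k l n "\<lambda>u. X u $ i" "\<lambda>u. X u $ j"] kl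
      by (simp add: riemann_sum_component tensor_def)
    have "norm ?A powr (q / 2) \<le> (\<Sum>z\<in>UNIV. \<bar>?A $ fst z $ snd z\<bar>) powr (q / 2)"
      using q by (intro powr_mono2 norm_matrix_le_l1) auto
    also have "\<dots> \<le> Ca * (\<Sum>z\<in>UNIV. \<bar>?A $ fst z $ snd z\<bar> powr (q / 2))"
      unfolding Ca_def by (rule sum_powr_le) (use q in auto)
    also have "\<dots> \<le> Ca * (\<Sum>z\<in>UNIV. wa (fst z) (snd z) (dyadic T n k) (dyadic T n l))"
      unfolding A by (intro mult_left_mono sum_mono wa kl) (auto simp: Ca_def)
    finally show ?thesis
      using control_nonneg[OF w1, of "dyadic T n k" "dyadic T n l"] kl
        dyadic_in_range[OF T, of k n] dyadic_in_range[OF T, of l n] dyadic_mono[OF T, of n k l]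
      unfolding w_def w2_def by auto
  qed
  have sup1: "(SUP (s, t)\<in>Simplex T. ennreal (norm (X t - X s) powr q) / ennreal (w s t)) \<le> ennreal (1 / 2)"
    by (rule SUP_least) (auto intro!: ennreal_ratio_le_half p1 simp del: ennreal_half)
  have sup2: "(SUP n. SUP (k, l)\<in>{(k, l). k < l \<and> l \<le> dyadic_size n}.
      ennreal (norm (riemann_sum (dyadic_size n) (dyadic T n) X (dyadic T n l)
        - riemann_sum (dyadic_size n) (dyadic T n) X (dyadic T n k)
        - tensor (X (dyadic T n k)) (X (dyadic T n l) - X (dyadic T n k))) powr (q / 2))
      / ennreal (w (dyadic T n k) (dyadic T n l))) \<le> ennreal (1 / 2)"
    by (intro SUP_least) (auto intro!: ennreal_ratio_le_half p2[unfolded dyadic_size_def] simp: dyadic_size_def simp del: ennreal_half)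
  have half: "ennreal (1 / 2) + ennreal (1 / 2) = 1"
    by (subst ennreal_plus[symmetric]) auto
  show ?thesis
    unfolding RIE_def
    apply (intro conjI allI part mesh continuous_imp_cadlag_on step_path_uniform_limit T cont exI[of _ w] w)
    subgoal
      by (intro uniformly_convergent_on_vec) (unfold riemann_sum_component, rule conv)
    subgoal using add_mono[OF sup1 sup2] unfolding half .
    done
qed

lemma SUP_pair_leD:
  fixes r :: "nat \<Rightarrow> nat \<Rightarrow> nat \<Rightarrow> ennreal"
  assumes "S + (SUP n. SUP (k, l)\<in>I n. r n k l) \<le> 1" and "(k, l) \<in> I n"
  shows "r n k l \<le> 1"
proof -
  have "r n k l = (case (k, l) of (k, l) \<Rightarrow> r n k l)" by simp
  also have "\<dots> \<le> (SUP (k, l)\<in>I n. r n k l)" by (rule SUP_upper[OF assms(2)])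
  also have "\<dots> \<le> (SUP n. SUP (k, l)\<in>I n. r n k l)" by (rule SUP_upper) simp
  also have "\<dots> \<le> S + (SUP n. SUP (k, l)\<in>I n. r n k l)" by (rule add_increasing) auto
  also note assms(1)
  finally show ?thesis .
qed

lemma RIE_dyadicD:
  fixes X :: "real \<Rightarrow> real ^ 'm"
  assumes T: "0 < T" and p: "0 < p" and rie: "RIE T p dyadic_size (dyadic T) X"
  shows "is_partition T (dyadic_size n) (dyadic T n)"
    and "(\<lambda>n. mesh (dyadic_size n) (dyadic T n)) \<longlonglongrightarrow> 0"
    and "uniformly_convergent_on {0..T} (dyadic_riemann T (\<lambda>u. X u $ i) (\<lambda>u. X u $ j))"
    and "area_controlled T p (\<lambda>u. X u $ i) (\<lambda>u. X u $ j)"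
proof -
  show "is_partition T (dyadic_size n) (dyadic T n)"
    "(\<lambda>n. mesh (dyadic_size n) (dyadic T n)) \<longlonglongrightarrow> 0"
    using rie by (simp_all add: RIE_def)
  have "uniformly_convergent_on {0..T} (\<lambda>n. riemann_sum (dyadic_size n) (dyadic T n) X)"
    using rie by (simp add: RIE_def)
  then obtain L where L: "uniform_limit {0..T} (\<lambda>n. riemann_sum (dyadic_size n) (dyadic T n) X) L sequentially"
    by (auto simp: uniformly_convergent_on_def)
  have "uniform_limit {0..T} (\<lambda>n t. riemann_sum (dyadic_size n) (dyadic T n) X t $ i $ j) (\<lambda>t. L t $ i $ j) sequentially"
    by (intro bounded_linear.uniform_limit[OF bounded_linear_vec_nth]
        bounded_linear.uniform_limit[OF bounded_linear_vec_nth] L)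
  then show "uniformly_convergent_on {0..T} (dyadic_riemann T (\<lambda>u. X u $ i) (\<lambda>u. X u $ j))"
    unfolding riemann_sum_component uniformly_convergent_on_def by (intro exI)
  obtain w where w: "control T w" and le: "(SUP (s, t)\<in>Simplex T. ennreal (norm (X t - X s) powr p) / ennreal (w s t)) +
       (SUP n. SUP (k, l)\<in>{(k, l). k < l \<and> l \<le> dyadic_size n}.
          ennreal (norm (riemann_sum (dyadic_size n) (dyadic T n) X (dyadic T n l) - riemann_sum (dyadic_size n) (dyadic T n) X (dyadic T n k)
                     - tensor (X (dyadic T n k)) (X (dyadic T n l) - X (dyadic T n k))) powr (p / 2))
          / ennreal (w (dyadic T n k) (dyadic T n l))) \<le> 1"
    using rie by (auto simp: RIE_def)
  have "\<bar>dyadic_area T (\<lambda>u. X u $ i) (\<lambda>u. X u $ j) n k l\<bar> powr (p / 2) \<le> w (dyadic T n k) (dyadic T n l)"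
    if kl: "k < l" "l \<le> 2 ^ n" for n k l
  proof -
    let ?A = "riemann_sum (dyadic_size n) (dyadic T n) X (dyadic T n l) - riemann_sum (dyadic_size n) (dyadic T n) X (dyadic T n k)
                     - tensor (X (dyadic T n k)) (X (dyadic T n l) - X (dyadic T n k))"
    have "ennreal (norm ?A powr (p / 2)) / ennreal (w (dyadic T n k) (dyadic T n l)) \<le> 1"
      by (rule SUP_pair_leD[OF le]) (use kl in \<open>simp add: dyadic_size_def\<close>)
    then have "norm ?A powr (p / 2) \<le> w (dyadic T n k) (dyadic T n l)"
    proof (rule ennreal_ratio_le_1D)
      show "0 \<le> w (dyadic T n k) (dyadic T n l)"
        using kl dyadic_in_range[OF T, of k n] dyadic_in_range[OF T, of l n] dyadic_mono[OF T, of n k l]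
        by (intro control_nonneg[OF w]) auto
    qed simp
    moreover have "?A $ i $ j = dyadic_area T (\<lambda>u. X u $ i) (\<lambda>u. X u $ j) n k l"
      using dyadic_area_eq_riemann[OF T, of k l n "\<lambda>u. X u $ i" "\<lambda>u. X u $ j"] kl
      by (simp add: riemann_sum_component tensor_def)
    moreover have "\<bar>?A $ i $ j\<bar> powr (p / 2) \<le> norm ?A powr (p / 2)"
      using p component_le_norm_cart[of "?A $ i" j] Finite_Cartesian_Product.norm_nth_le[of ?A i]
      by (intro powr_mono2) (auto intro: order_trans)
    ultimately show ?thesis by simp
  qed
  with w show "area_controlled T p (\<lambda>u. X u $ i) (\<lambda>u. X u $ j)"
    unfolding area_controlled_def by blast
qed

text \<open>
  Since \<open>v \<le> w(0, T)\<close> for every value \<open>v\<close> of the control, \<open>v\<^sup>q\<^sup>/\<^sup>p \<le> w(0, T)\<^sup>q\<^sup>/\<^sup>p\<^sup>-\<^sup>1 v\<close>.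
\<close>

lemma area_controlled_mono_exponent:
  assumes T: "0 < T" and p: "0 < p" "p \<le> q"
    and area: "area_controlled T p x y"
  shows "area_controlled T q x y"
proof -
  let ?A = "dyadic_area T x y"
  obtain w where w: "control T w" and le: "\<And>n k l. k < l \<Longrightarrow> l \<le> 2 ^ n \<Longrightarrow>
      \<bar>?A n k l\<bar> powr (p / 2) \<le> w (dyadic T n k) (dyadic T n l)"
    using area unfolding area_controlled_def by blast
  define C where "C = w 0 T powr (q / p - 1)"
  have "\<bar>?A n k l\<bar> powr (q / 2) \<le> C * w (dyadic T n k) (dyadic T n l)" if kl: "k < l" "l \<le> 2 ^ n" for n k l
  proof -
    define v where "v = w (dyadic T n k) (dyadic T n l)"
    have r: "0 \<le> dyadic T n k" "dyadic T n k \<le> dyadic T n l" "dyadic T n l \<le> T"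
      using kl dyadic_in_range[OF T, of k n] dyadic_in_range[OF T, of l n] dyadic_mono[OF T, of n k l]
      by auto
    have v: "0 \<le> v" "v \<le> w 0 T" unfolding v_def
      using control_nonneg[OF w r] control_mono[OF w _ r] T by auto
    have "\<bar>?A n k l\<bar> powr (q / 2) = (\<bar>?A n k l\<bar> powr (p / 2)) powr (q / p)"
      using p by (simp add: powr_powr)
    also have "\<dots> \<le> v powr (q / p)" unfolding v_def using p by (intro powr_mono2 le kl) auto
    also have "\<dots> = v powr (q / p - 1) * v"
      using v by (cases "v = 0") (auto simp: powr_diff)
    also have "\<dots> \<le> C * v" unfolding C_def using v p by (intro mult_right_mono powr_mono2) auto
    finally show ?thesis unfolding v_def .
  qed
  moreover have "control T (\<lambda>s t. C * w s t)" by (rule control_scale[OF w]) (simp add: C_def)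
  ultimately show ?thesis unfolding area_controlled_def by (intro exI[of _ "\<lambda>s t. C * w s t"]) auto
qed

section \<open>Moments of Brownian increments\<close>

lemma prod_Basis_cart:
  fixes g :: "real ^ 'e \<Rightarrow> 'b :: comm_monoid_mult"
  shows "(\<Prod>b\<in>Basis. g b) = (\<Prod>k\<in>UNIV. g (axis k 1))"
proof -
  have B: "Basis = range (\<lambda>k. axis k (1 :: real) :: real ^ 'e)"
    by (auto simp: Basis_vec_def)
  have i: "inj (\<lambda>k. axis k (1 :: real) :: real ^ 'e)"
    by (auto simp: inj_on_def axis_eq_axis)
  show ?thesis unfolding B prod.reindex[OF i] comp_def ..
qed

lemma nn_integral_lborel_prod_cart:
  fixes f :: "'e :: finite \<Rightarrow> real \<Rightarrow> ennreal"
  assumes [measurable]: "\<And>k. f k \<in> borel_measurable borel"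
  shows "(\<integral>\<^sup>+x. (\<Prod>k\<in>UNIV. f k (x $ k)) \<partial>(lborel :: (real ^ 'e) measure)) = (\<Prod>k\<in>UNIV. \<integral>\<^sup>+x. f k x \<partial>lborel)"
proof -
  define h where "h b = f (THE k. b = axis k (1 :: real))" for b :: "real ^ 'e"
  have h: "h (axis k 1) = f k" for k
    unfolding h_def by (rule arg_cong[of _ _ f], rule the_equality) (auto simp: axis_eq_axis)
  have [measurable]: "h b \<in> borel_measurable borel" for b unfolding h_def by measurable
  have "(\<integral>\<^sup>+x. (\<Prod>b\<in>Basis. h b (x \<bullet> b)) \<partial>(lborel :: (real ^ 'e) measure)) = (\<Prod>b\<in>Basis. \<integral>\<^sup>+x. h b x \<partial>lborel)"
    by (rule nn_integral_lborel_prod) auto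
  then show ?thesis by (simp add: prod_Basis_cart h inner_axis)
qed

text \<open>
  The other factors of the product density integrate to one.
\<close>

lemma distributed_component:
  fixes X :: "'a \<Rightarrow> real ^ 'e"
  assumes X: "distributed M lborel X (\<lambda>x. ennreal (\<Prod>k\<in>UNIV. f k (x $ k)))"
    and f: "\<And>k. f k \<in> borel_measurable borel" "\<And>k x. 0 \<le> f k x" "\<And>k. (\<integral>\<^sup>+x. ennreal (f k x) \<partial>lborel) = 1"
  shows "distributed M lborel (\<lambda>\<omega>. X \<omega> $ j) (\<lambda>x. ennreal (f j x))"
proof -
  note [measurable] = f(1)
  have D: "distr M lborel X = density lborel (\<lambda>x. ennreal (\<Prod>k\<in>UNIV. f k (x $ k)))"
    and Xm: "X \<in> M \<rightarrow>\<^sub>M lborel"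
    using X by (auto simp: distributed_def)
  have Xm'[measurable]: "X \<in> borel_measurable M" using Xm by simp
  have jm[measurable]: "(\<lambda>x :: real ^ 'e. x $ j) \<in> borel_measurable borel" by measurable
  have "distr M lborel (\<lambda>\<omega>. X \<omega> $ j) = density lborel (\<lambda>x. ennreal (f j x))"
  proof (rule measure_eqI)
    fix A assume "A \<in> sets (distr M lborel (\<lambda>\<omega>. X \<omega> $ j))"
    then have A[measurable]: "A \<in> sets borel" by simp
    let ?A = "(\<lambda>x :: real ^ 'e. x $ j) -` A"
    have A'[measurable]: "?A \<in> sets borel" using measurable_sets[OF jm A] by simp
    define g where "g k x = (if k = j then ennreal (f k x) * indicator A x else ennreal (f k x))" for k x
    have [measurable]: "g k \<in> borel_measurable borel" for k unfolding g_def by measurable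
    have "emeasure (distr M lborel (\<lambda>\<omega>. X \<omega> $ j)) A = emeasure (distr M lborel X) ?A"
      by (subst (1 2) emeasure_distr) (auto intro!: arg_cong[of _ _ "emeasure M"])
    also have "\<dots> = (\<integral>\<^sup>+x. ennreal (\<Prod>k\<in>UNIV. f k (x $ k)) * indicator ?A x \<partial>lborel)"
      unfolding D by (rule emeasure_density) auto
    also have "\<dots> = (\<integral>\<^sup>+x. (\<Prod>k\<in>UNIV. g k (x $ k)) \<partial>lborel)"
    proof (rule nn_integral_cong)
      fix x :: "real ^ 'e"
      have "(\<Prod>k\<in>UNIV. g k (x $ k)) = g j (x $ j) * (\<Prod>k\<in>UNIV - {j}. g k (x $ k))"
        by (rule prod.remove) auto
      also have "(\<Prod>k\<in>UNIV - {j}. g k (x $ k)) = (\<Prod>k\<in>UNIV - {j}. ennreal (f k (x $ k)))"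
        by (rule prod.cong) (auto simp: g_def)
      also have "g j (x $ j) = ennreal (f j (x $ j)) * indicator ?A x" by (simp add: g_def indicator_def)
      also have "ennreal (f j (x $ j)) * indicator ?A x * (\<Prod>k\<in>UNIV - {j}. ennreal (f k (x $ k)))
          = (ennreal (f j (x $ j)) * (\<Prod>k\<in>UNIV - {j}. ennreal (f k (x $ k)))) * indicator ?A x"
        by (simp add: mult_ac)
      also have "ennreal (f j (x $ j)) * (\<Prod>k\<in>UNIV - {j}. ennreal (f k (x $ k)))
          = (\<Prod>k\<in>UNIV. ennreal (f k (x $ k)))"
        by (rule prod.remove[symmetric]) auto
      also have "\<dots> = ennreal (\<Prod>k\<in>UNIV. f k (x $ k))" using f(2) by (intro prod_ennreal) auto
      finally show "ennreal (\<Prod>k\<in>UNIV. f k (x $ k)) * indicator ?A x = (\<Prod>k\<in>UNIV. g k (x $ k))" by simp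
    qed
    also have "\<dots> = (\<Prod>k\<in>UNIV. \<integral>\<^sup>+x. g k x \<partial>lborel)" by (rule nn_integral_lborel_prod_cart) auto
    also have "\<dots> = (\<integral>\<^sup>+x. g j x \<partial>lborel) * (\<Prod>k\<in>UNIV - {j}. \<integral>\<^sup>+x. g k x \<partial>lborel)"
      by (rule prod.remove) auto
    also have "(\<Prod>k\<in>UNIV - {j}. \<integral>\<^sup>+x. g k x \<partial>lborel) = 1"
      by (rule prod.neutral) (auto simp: g_def f(3))
    also have "(\<integral>\<^sup>+x. g j x \<partial>lborel) = emeasure (density lborel (\<lambda>x. ennreal (f j x))) A"
      by (subst emeasure_density) (auto simp: g_def intro!: nn_integral_cong)
    finally show "emeasure (distr M lborel (\<lambda>\<omega>. X \<omega> $ j)) A = emeasure (density lborel (\<lambda>x. ennreal (f j x))) A"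
      by simp
  qed simp
  then show ?thesis by (auto simp: distributed_def)
qed

lemma borel_measurable_component:
  fixes X :: "'a \<Rightarrow> real ^ 'e"
  assumes "X \<in> borel_measurable M"
  shows "(\<lambda>\<omega>. X \<omega> $ j) \<in> borel_measurable M"
proof -
  have "(\<lambda>x :: real ^ 'e. x $ j) \<in> borel_measurable borel" by measurable
  from measurable_compose[OF assms this] show ?thesis .
qed

lemma integrable_mult_of_squares:
  fixes X Y :: "'a \<Rightarrow> real"
  assumes [measurable]: "X \<in> borel_measurable M" "Y \<in> borel_measurable M"
    and "integrable M (\<lambda>\<omega>. (X \<omega>)\<^sup>2)" "integrable M (\<lambda>\<omega>. (Y \<omega>)\<^sup>2)"
  shows "integrable M (\<lambda>\<omega>. X \<omega> * Y \<omega>)"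
proof (rule Bochner_Integration.integrable_bound)
  show "integrable M (\<lambda>\<omega>. (X \<omega>)\<^sup>2 + (Y \<omega>)\<^sup>2)" using assms by auto
  have "\<bar>x * y\<bar> \<le> x\<^sup>2 + y\<^sup>2" for x y :: real
  proof -
    have "0 \<le> \<bar>x\<bar> * \<bar>y\<bar>" by (rule mult_nonneg_nonneg) auto
    moreover have "2 * \<bar>x\<bar> * \<bar>y\<bar> \<le> x\<^sup>2 + y\<^sup>2" using sum_squares_bound[of "\<bar>x\<bar>" "\<bar>y\<bar>"] by simp
    ultimately show ?thesis unfolding abs_mult by linarith
  qed
  then show "AE \<omega> in M. norm (X \<omega> * Y \<omega>) \<le> norm ((X \<omega>)\<^sup>2 + (Y \<omega>)\<^sup>2)" by simp
qed simp

locale filtered_prob = prob_space M for M :: "'a measure" +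
  fixes F :: "real \<Rightarrow> 'a measure" and T :: real
  assumes T_pos: "0 < T"
    and subalg: "\<And>t. 0 \<le> t \<Longrightarrow> t \<le> T \<Longrightarrow> subalgebra M (F t)"
    and F_mono: "\<And>s t. 0 \<le> s \<Longrightarrow> s \<le> t \<Longrightarrow> t \<le> T \<Longrightarrow> sets (F s) \<subseteq> sets (F t)"
begin

lemma space_F: "0 \<le> t \<Longrightarrow> t \<le> T \<Longrightarrow> space (F t) = space M"
  using subalg by (auto simp: subalgebra_def)

lemma measurable_F: "0 \<le> t \<Longrightarrow> t \<le> T \<Longrightarrow> X \<in> borel_measurable (F t) \<Longrightarrow> X \<in> borel_measurable M"
  using measurable_from_subalg[OF subalg] .

lemma measurable_F_mono:
  assumes "0 \<le> s" "s \<le> t" "t \<le> T" "X \<in> borel_measurable (F s)"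
  shows "X \<in> borel_measurable (F t)"
proof (rule measurable_from_subalg[OF _ assms(4)])
  show "subalgebra (F t) (F s)"
    using assms F_mono space_F[of s] space_F[of t] by (auto simp: subalgebra_def)
qed

text \<open>
  The three facts about a coordinate of Brownian motion that the moment estimates use. Continuity is
  kept apart because it holds only almost surely.
\<close>

definition scalar_bm :: "(real \<Rightarrow> 'a \<Rightarrow> real) \<Rightarrow> bool" where
  "scalar_bm B \<longleftrightarrow> (\<forall>t\<in>{0..T}. B t \<in> borel_measurable (F t)) \<and>
     (\<forall>s t. 0 \<le> s \<and> s < t \<and> t \<le> T \<longrightarrow>
        (\<forall>X\<in>borel_measurable (F s). indep_var borel X borel (\<lambda>\<omega>. B t \<omega> - B s \<omega>)) \<and>
        distributed M lborel (\<lambda>\<omega>. B t \<omega> - B s \<omega>) (normal_density 0 (sqrt (t - s))))"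

lemma scalar_bm_component:
  assumes bm: "brownian_motion M F T W"
  shows "scalar_bm (\<lambda>t \<omega>. W t \<omega> $ j)"
  unfolding scalar_bm_def
proof (intro conjI ballI allI impI)
  fix t assume "t \<in> {0..T}"
  then have [measurable]: "W t \<in> borel_measurable (F t)" using bm by (auto simp: brownian_motion_def)
  show "(\<lambda>\<omega>. W t \<omega> $ j) \<in> borel_measurable (F t)"
    by (rule borel_measurable_component) measurable
next
  fix s t assume st: "0 \<le> s \<and> s < t \<and> t \<le> T"
  let ?D = "\<lambda>\<omega>. W t \<omega> - W s \<omega>"
  have dist: "distributed M lborel ?D (\<lambda>x. ennreal (\<Prod>j\<in>UNIV. normal_density 0 (sqrt (t - s)) (x $ j)))"
    and ind: "indep_set (sets (F s)) (sets (vimage_algebra (space M) ?D borel))"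
    using bm st by (auto simp: brownian_motion_def)
  have nd: "(\<integral>\<^sup>+x. ennreal (normal_density 0 (sqrt (t - s)) x) \<partial>lborel) = 1"
    using st by (subst nn_integral_eq_integral) auto
  have "distributed M lborel (\<lambda>\<omega>. ?D \<omega> $ j) (normal_density 0 (sqrt (t - s)))"
    by (rule distributed_component[OF dist]) (use nd in auto)
  then show "distributed M lborel (\<lambda>\<omega>. W t \<omega> $ j - W s \<omega> $ j) (normal_density 0 (sqrt (t - s)))" by simp
  have Dm: "?D \<in> borel_measurable M" using dist by (auto simp: distributed_def)
  then have Djm: "(\<lambda>\<omega>. W t \<omega> $ j - W s \<omega> $ j) \<in> borel_measurable M"
    using borel_measurable_component[of ?D M j] by simp
  fix X :: "'a \<Rightarrow> real" assume X: "X \<in> borel_measurable (F s)"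
  have Xm: "X \<in> borel_measurable M" using measurable_F[of s X] X st by auto
  show "indep_var borel X borel (\<lambda>\<omega>. W t \<omega> $ j - W s \<omega> $ j)"
    unfolding indep_var_eq
  proof (intro conjI)
    show "indep_set (sigma_sets (space M) {X -` A \<inter> space M |A. A \<in> sets borel})
        (sigma_sets (space M) {(\<lambda>\<omega>. W t \<omega> $ j - W s \<omega> $ j) -` A \<inter> space M |A. A \<in> sets borel})"
      unfolding indep_set_def
    proof (rule indep_sets_mono_sets[OF ind[unfolded indep_set_def]])
      fix b :: bool
      have 1: "sigma_sets (space M) {X -` A \<inter> space M |A. A \<in> sets borel} \<subseteq> sets (F s)"
        using sets.sigma_sets_subset[of "{X -` A \<inter> space M |A. A \<in> sets borel}" "F s"]
          measurable_sets[OF X] st space_F[of s] by auto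
      have 2: "sigma_sets (space M) {(\<lambda>\<omega>. W t \<omega> $ j - W s \<omega> $ j) -` A \<inter> space M |A. A \<in> sets borel}
          \<subseteq> sets (vimage_algebra (space M) ?D borel)"
      proof -
        have "(\<lambda>\<omega>. W t \<omega> $ j - W s \<omega> $ j) -` A \<inter> space M \<in> sets (vimage_algebra (space M) ?D borel)"
          if A: "A \<in> sets borel" for A
        proof -
          have "(\<lambda>x :: real ^ 'b. x $ j) -` A \<inter> space borel \<in> sets borel"
            by (rule measurable_sets[OF _ A]) measurable
          then have "?D -` ((\<lambda>x. x $ j) -` A) \<inter> space M \<in> sets (vimage_algebra (space M) ?D borel)"
            by (intro in_vimage_algebra) simp
          also have "?D -` ((\<lambda>x. x $ j) -` A) \<inter> space M = (\<lambda>\<omega>. W t \<omega> $ j - W s \<omega> $ j) -` A \<inter> space M"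
            by auto
          finally show ?thesis .
        qed
        then show ?thesis
          using sets.sigma_sets_subset[of "{(\<lambda>\<omega>. W t \<omega> $ j - W s \<omega> $ j) -` A \<inter> space M |A. A \<in> sets borel}"
              "vimage_algebra (space M) ?D borel"] by auto
      qed
      show "(case b of True \<Rightarrow> sigma_sets (space M) {X -` A \<inter> space M |A. A \<in> sets borel}
          | False \<Rightarrow> sigma_sets (space M) {(\<lambda>\<omega>. W t \<omega> $ j - W s \<omega> $ j) -` A \<inter> space M |A. A \<in> sets borel})
        \<subseteq> (case b of True \<Rightarrow> sets (F s) | False \<Rightarrow> sets (vimage_algebra (space M) ?D borel))"
        using 1 2 by (cases b) auto
    qed
  qed (use Xm Djm in auto)
qed

section \<open>The isometry for elementary integrals\<close>

text \<open>
  One summand \<open>\<zeta> (B\<^sub>b - B\<^sub>a)\<close> of an elementary integral. Square integrability instead of boundedness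
  admits \<open>\<zeta> = W\<^sub>a - W\<^sub>s\<close>.
\<close>

definition elementary :: "real \<Rightarrow> real \<Rightarrow> ('a \<Rightarrow> real) \<Rightarrow> bool" where
  "elementary a b \<zeta> \<longleftrightarrow> 0 \<le> a \<and> a \<le> b \<and> b \<le> T \<and> \<zeta> \<in> borel_measurable (F a) \<and> integrable M (\<lambda>\<omega>. (\<zeta> \<omega>)\<^sup>2)"

context
  fixes B assumes B: "scalar_bm B"
begin

lemma bm_adapted: "0 \<le> t \<Longrightarrow> t \<le> T \<Longrightarrow> B t \<in> borel_measurable (F t)"
  using B by (auto simp: scalar_bm_def)

lemma bm_measurable: "0 \<le> t \<Longrightarrow> t \<le> T \<Longrightarrow> B t \<in> borel_measurable M"
  using bm_adapted measurable_F by blast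

lemma bm_increment_adapted:
  assumes "0 \<le> s" "s \<le> u" "t \<le> u" "0 \<le> t" "u \<le> T"
  shows "(\<lambda>\<omega>. B t \<omega> - B s \<omega>) \<in> borel_measurable (F u)"
  using measurable_F_mono[of s u "B s"] measurable_F_mono[of t u "B t"] bm_adapted[of s] bm_adapted[of t] assms
  by (intro borel_measurable_diff) auto

lemma bm_moments:
  assumes st: "0 \<le> s" "s \<le> t" "t \<le> T"
  shows "integrable M (\<lambda>\<omega>. (B t \<omega> - B s \<omega>) ^ k)"
    and "expectation (\<lambda>\<omega>. B t \<omega> - B s \<omega>) = 0"
    and "expectation (\<lambda>\<omega>. (B t \<omega> - B s \<omega>)\<^sup>2) = t - s"
    and "expectation (\<lambda>\<omega>. (B t \<omega> - B s \<omega>) ^ 4) = 3 * (t - s)\<^sup>2"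
proof -
  have "integrable M (\<lambda>\<omega>. (B t \<omega> - B s \<omega>) ^ k) \<and> expectation (\<lambda>\<omega>. B t \<omega> - B s \<omega>) = 0
    \<and> expectation (\<lambda>\<omega>. (B t \<omega> - B s \<omega>)\<^sup>2) = t - s \<and> expectation (\<lambda>\<omega>. (B t \<omega> - B s \<omega>) ^ 4) = 3 * (t - s)\<^sup>2"
  proof (cases "s = t")
    case False
    with st have lt: "s < t" by simp
    let ?\<sigma> = "sqrt (t - s)"
    have s0: "0 < ?\<sigma>" using lt by simp
    have D: "distributed M lborel (\<lambda>\<omega>. B t \<omega> - B s \<omega>) (normal_density 0 ?\<sigma>)"
      using B lt st by (auto simp: scalar_bm_def)
    have 1: "integrable M (\<lambda>\<omega>. (B t \<omega> - B s \<omega>) ^ k)"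
      using distributed_integrable[OF D, of "\<lambda>x. x ^ k"] integrable_normal_moment[OF s0, of 0 k] by simp
    have 2: "expectation (\<lambda>\<omega>. B t \<omega> - B s \<omega>) = 0"
      using normal_distributed_expectation[OF s0 D] .
    have 3: "expectation (\<lambda>\<omega>. (B t \<omega> - B s \<omega>)\<^sup>2) = t - s"
      using normal_distributed_variance[OF s0 D] 2 lt by simp
    have "expectation (\<lambda>\<omega>. (B t \<omega> - B s \<omega>) ^ 4) = (\<integral>x. normal_density 0 ?\<sigma> x * x ^ 4 \<partial>lborel)"
      using distributed_integral[OF D, of "\<lambda>x. x ^ 4"] by simp
    also have "\<dots> = 3 * (t - s)\<^sup>2"
      using integral_normal_moment_even[OF s0, of 0 2] lt by (simp add: fact_numeral field_simps power2_eq_square)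
    finally show ?thesis using 1 2 3 by simp
  qed (cases k; simp)
  then show "integrable M (\<lambda>\<omega>. (B t \<omega> - B s \<omega>) ^ k)" "expectation (\<lambda>\<omega>. B t \<omega> - B s \<omega>) = 0"
    "expectation (\<lambda>\<omega>. (B t \<omega> - B s \<omega>)\<^sup>2) = t - s" "expectation (\<lambda>\<omega>. (B t \<omega> - B s \<omega>) ^ 4) = 3 * (t - s)\<^sup>2"
    by auto
qed

lemma bm_indep_power:
  assumes st: "0 \<le> s" "s \<le> t" "t \<le> T" and X: "X \<in> borel_measurable (F s)" "integrable M X"
  shows "integrable M (\<lambda>\<omega>. X \<omega> * (B t \<omega> - B s \<omega>) ^ k)"
    and "expectation (\<lambda>\<omega>. X \<omega> * (B t \<omega> - B s \<omega>) ^ k) = expectation X * expectation (\<lambda>\<omega>. (B t \<omega> - B s \<omega>) ^ k)"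
proof -
  have "integrable M (\<lambda>\<omega>. X \<omega> * (B t \<omega> - B s \<omega>) ^ k) \<and>
    expectation (\<lambda>\<omega>. X \<omega> * (B t \<omega> - B s \<omega>) ^ k) = expectation X * expectation (\<lambda>\<omega>. (B t \<omega> - B s \<omega>) ^ k)"
  proof (cases "s = t")
    case True
    then show ?thesis using X(2) by (cases k) (simp_all add: prob_space)
  next
    case False
    then have "indep_var borel X borel (\<lambda>\<omega>. B t \<omega> - B s \<omega>)" using B st X by (auto simp: scalar_bm_def)
    then have "indep_var borel ((\<lambda>x. x) \<circ> X) borel ((\<lambda>x. x ^ k) \<circ> (\<lambda>\<omega>. B t \<omega> - B s \<omega>))"
      by (rule indep_var_compose) auto
    then have iv: "indep_var borel X borel (\<lambda>\<omega>. (B t \<omega> - B s \<omega>) ^ k)" by (simp add: comp_def)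
    show ?thesis
      using indep_var_integrable[OF iv X(2) bm_moments(1)[OF st]]
        indep_var_lebesgue_integral[OF iv X(2) bm_moments(1)[OF st]] by simp
  qed
  then show "integrable M (\<lambda>\<omega>. X \<omega> * (B t \<omega> - B s \<omega>) ^ k)"
    "expectation (\<lambda>\<omega>. X \<omega> * (B t \<omega> - B s \<omega>) ^ k) = expectation X * expectation (\<lambda>\<omega>. (B t \<omega> - B s \<omega>) ^ k)"
    by auto
qed

lemma bm_mult_increment:
  assumes st: "0 \<le> s" "s \<le> t" "t \<le> T" and X: "X \<in> borel_measurable (F s)" "integrable M X"
  shows "integrable M (\<lambda>\<omega>. X \<omega> * (B t \<omega> - B s \<omega>))"
    and "expectation (\<lambda>\<omega>. X \<omega> * (B t \<omega> - B s \<omega>)) = 0"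
    and "integrable M (\<lambda>\<omega>. X \<omega> * (B t \<omega> - B s \<omega>)\<^sup>2)"
    and "expectation (\<lambda>\<omega>. X \<omega> * (B t \<omega> - B s \<omega>)\<^sup>2) = expectation X * (t - s)"
  using bm_indep_power[OF st X, of 1] bm_indep_power[OF st X, of 2] bm_moments[OF st] by simp_all

lemma elementary_square:
  assumes "elementary a b \<zeta>"
  shows "integrable M (\<lambda>\<omega>. (\<zeta> \<omega> * (B b \<omega> - B a \<omega>))\<^sup>2)"
    and "(\<lambda>\<omega>. \<zeta> \<omega> * (B b \<omega> - B a \<omega>)) \<in> borel_measurable (F b)"
    and "(\<lambda>\<omega>. \<zeta> \<omega> * (B b \<omega> - B a \<omega>)) \<in> borel_measurable M"
proof -
  have *: "0 \<le> a" "a \<le> b" "b \<le> T" "\<zeta> \<in> borel_measurable (F a)" "integrable M (\<lambda>\<omega>. (\<zeta> \<omega>)\<^sup>2)"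
    using assms by (auto simp: elementary_def)
  have [measurable]: "\<zeta> \<in> borel_measurable (F a)" by fact
  have "(\<lambda>\<omega>. (\<zeta> \<omega>)\<^sup>2) \<in> borel_measurable (F a)" by measurable
  from bm_mult_increment(3)[OF *(1-3) this *(5)]
  show "integrable M (\<lambda>\<omega>. (\<zeta> \<omega> * (B b \<omega> - B a \<omega>))\<^sup>2)" by (simp add: power_mult_distrib)
  show "(\<lambda>\<omega>. \<zeta> \<omega> * (B b \<omega> - B a \<omega>)) \<in> borel_measurable (F b)"
    using * by (intro borel_measurable_times measurable_F_mono[OF _ _ _ *(4)] bm_increment_adapted) auto
  then show "(\<lambda>\<omega>. \<zeta> \<omega> * (B b \<omega> - B a \<omega>)) \<in> borel_measurable M"
    using measurable_F[of b] * by auto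
qed

text \<open>
  If the later interval starts at \<open>c\<close>, split the earlier increment at \<open>c\<close>. The part before \<open>c\<close> is known
  at time \<open>c\<close> and is orthogonal to \<open>B\<^sub>d - B\<^sub>c\<close>; of the part after \<open>c\<close> only the square over the common
  interval \<open>[c, m]\<close> survives.
\<close>

lemma elementary_cross_le:
  assumes z: "elementary a b \<zeta>" and x: "elementary c d \<xi>" and ac: "a \<le> c"
  shows "expectation (\<lambda>\<omega>. (\<zeta> \<omega> * (B b \<omega> - B a \<omega>)) * (\<xi> \<omega> * (B d \<omega> - B c \<omega>)))
    = expectation (\<lambda>\<omega>. \<zeta> \<omega> * \<xi> \<omega>) * measure lborel ({a<..b} \<inter> {c<..d})"
proof -
  have z': "0 \<le> a" "a \<le> b" "b \<le> T" "\<zeta> \<in> borel_measurable (F a)" "integrable M (\<lambda>\<omega>. (\<zeta> \<omega>)\<^sup>2)"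
    and x': "0 \<le> c" "c \<le> d" "d \<le> T" "\<xi> \<in> borel_measurable (F c)" "integrable M (\<lambda>\<omega>. (\<xi> \<omega>)\<^sup>2)"
    using z x by (auto simp: elementary_def)
  have zc: "\<zeta> \<in> borel_measurable (F c)" using measurable_F_mono[OF _ ac _ z'(4)] z' x' by auto
  have Mm: "\<zeta> \<in> borel_measurable M" "\<xi> \<in> borel_measurable M"
    using measurable_F[of a] measurable_F[of c] z' x' by auto
  show ?thesis
  proof (cases "b \<le> c")
    case True
    let ?Y = "\<lambda>\<omega>. (\<zeta> \<omega> * (B b \<omega> - B a \<omega>)) * \<xi> \<omega>"
    have "?Y \<in> borel_measurable (F c)"
      by (rule borel_measurable_times[OF measurable_F_mono[OF _ True _ elementary_square(2)[OF z]] x'(4)])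
        (use z' x' in auto)
    moreover have "integrable M ?Y"
      by (rule integrable_mult_of_squares[OF elementary_square(3)[OF z] Mm(2) elementary_square(1)[OF z] x'(5)])
    ultimately have "expectation (\<lambda>\<omega>. ?Y \<omega> * (B d \<omega> - B c \<omega>)) = 0"
      using bm_mult_increment(2)[OF x'(1-3)] by blast
    moreover have eq: "{a<..b} \<inter> {c<..d} = {}" using True by auto
    ultimately show ?thesis unfolding eq by (simp add: mult.assoc)
  next
    case False
    let ?P = "\<lambda>\<omega>. \<zeta> \<omega> * \<xi> \<omega>"
    have Pm: "?P \<in> borel_measurable (F c)" using zc x' by (intro borel_measurable_times)
    have Pi: "integrable M ?P" by (rule integrable_mult_of_squares[OF Mm z'(5) x'(5)])
    have zac: "elementary a c \<zeta>" using z' x' ac by (auto simp: elementary_def)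
    let ?Y = "\<lambda>\<omega>. (\<zeta> \<omega> * (B c \<omega> - B a \<omega>)) * \<xi> \<omega>"
    have Ym: "?Y \<in> borel_measurable (F c)"
      by (rule borel_measurable_times[OF elementary_square(2)[OF zac] x'(4)])
    have Yi: "integrable M ?Y"
      by (rule integrable_mult_of_squares[OF elementary_square(3)[OF zac] Mm(2) elementary_square(1)[OF zac] x'(5)])
    note Y = bm_mult_increment(1,2)[OF x'(1-3) Ym Yi]
    \<comment> \<open>The intervals \<open>[c, b]\<close> and \<open>[c, d]\<close> are nested; \<open>[c, m]\<close> is the shorter and \<open>[c, e]\<close> the longer one.\<close>
    define m where "m = min b d"
    define e where "e = max b d"
    have me: "c \<le> m" "m \<le> e" "e \<le> T" using False x' z' by (auto simp: m_def e_def)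
    have c0: "0 \<le> c" "m \<le> T" "0 \<le> m" using x' me by auto
    note P2 = bm_mult_increment(3,4)[OF c0(1) me(1) c0(2) Pm Pi]
    let ?Q = "\<lambda>\<omega>. ?P \<omega> * (B m \<omega> - B c \<omega>)"
    have Qm: "?Q \<in> borel_measurable (F m)"
      by (rule borel_measurable_times[OF measurable_F_mono[OF c0(1) me(1) c0(2) Pm] bm_increment_adapted])
        (use me c0 in auto)
    note Q = bm_mult_increment(1,2)[OF c0(3) me(2,3) Qm bm_mult_increment(1)[OF c0(1) me(1) c0(2) Pm Pi]]
    have "(\<lambda>\<omega>. (\<zeta> \<omega> * (B b \<omega> - B a \<omega>)) * (\<xi> \<omega> * (B d \<omega> - B c \<omega>)))
      = (\<lambda>\<omega>. ?Y \<omega> * (B d \<omega> - B c \<omega>) + (?P \<omega> * (B m \<omega> - B c \<omega>)\<^sup>2 + ?Q \<omega> * (B e \<omega> - B m \<omega>)))"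
    proof (cases "b \<le> d")
      case True
      then have "m = b" "e = d" by (auto simp: m_def e_def)
      then show ?thesis by (intro ext) (simp add: power2_eq_square algebra_simps)
    next
      case False
      then have "m = d" "e = b" by (auto simp: m_def e_def)
      then show ?thesis by (intro ext) (simp add: power2_eq_square algebra_simps)
    qed
    moreover have "expectation (\<lambda>\<omega>. ?Y \<omega> * (B d \<omega> - B c \<omega>) + (?P \<omega> * (B m \<omega> - B c \<omega>)\<^sup>2 + ?Q \<omega> * (B e \<omega> - B m \<omega>)))
      = expectation ?P * (m - c)"
      using Y P2 Q by simp
    moreover have "{a<..b} \<inter> {c<..d} = {c<..m}" using ac by (auto simp: m_def)
    ultimately show ?thesis using me by simp
  qed
qed

lemma elementary_cross:
  assumes z: "elementary a b \<zeta>" and x: "elementary c d \<xi>"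
  shows "expectation (\<lambda>\<omega>. (\<zeta> \<omega> * (B b \<omega> - B a \<omega>)) * (\<xi> \<omega> * (B d \<omega> - B c \<omega>)))
    = expectation (\<lambda>\<omega>. \<zeta> \<omega> * \<xi> \<omega>) * measure lborel ({a<..b} \<inter> {c<..d})"
proof (cases "a \<le> c")
  case True
  then show ?thesis using elementary_cross_le[OF z x] by simp
next
  case False
  then show ?thesis using elementary_cross_le[OF x z] by (simp add: mult_ac Int_commute)
qed

text \<open>
  The intervals may overlap, so that the difference of two simple integrals on different grids is
  again an elementary integral.
\<close>

lemma ito_isometry_elementary:
  assumes I: "finite I" and e: "\<And>i. i \<in> I \<Longrightarrow> elementary (a i) (b i) (\<zeta> i)"
  shows "integrable M (\<lambda>\<omega>. (\<Sum>i\<in>I. \<zeta> i \<omega> * (B (b i) \<omega> - B (a i) \<omega>))\<^sup>2)"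
    and "expectation (\<lambda>\<omega>. (\<Sum>i\<in>I. \<zeta> i \<omega> * (B (b i) \<omega> - B (a i) \<omega>))\<^sup>2)
      = (\<Sum>i\<in>I. \<Sum>j\<in>I. expectation (\<lambda>\<omega>. \<zeta> i \<omega> * \<zeta> j \<omega>) * measure lborel ({a i<..b i} \<inter> {a j<..b j}))"
proof -
  let ?X = "\<lambda>i \<omega>. \<zeta> i \<omega> * (B (b i) \<omega> - B (a i) \<omega>)"
  have eq: "(\<lambda>\<omega>. (\<Sum>i\<in>I. ?X i \<omega>)\<^sup>2) = (\<lambda>\<omega>. \<Sum>i\<in>I. \<Sum>j\<in>I. ?X i \<omega> * ?X j \<omega>)"
    by (intro ext) (simp only: power2_eq_square sum_product)
  have int: "integrable M (\<lambda>\<omega>. ?X i \<omega> * ?X j \<omega>)" if "i \<in> I" "j \<in> I" for i j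
    using elementary_square[OF e[OF that(1)]] elementary_square[OF e[OF that(2)]]
    by (intro integrable_mult_of_squares) auto
  show "integrable M (\<lambda>\<omega>. (\<Sum>i\<in>I. ?X i \<omega>)\<^sup>2)"
    unfolding eq by (intro Bochner_Integration.integrable_sum int)
  show "expectation (\<lambda>\<omega>. (\<Sum>i\<in>I. ?X i \<omega>)\<^sup>2)
      = (\<Sum>i\<in>I. \<Sum>j\<in>I. expectation (\<lambda>\<omega>. \<zeta> i \<omega> * \<zeta> j \<omega>) * measure lborel ({a i<..b i} \<inter> {a j<..b j}))"
  proof -
    have "expectation (\<lambda>\<omega>. \<Sum>i\<in>I. \<Sum>j\<in>I. ?X i \<omega> * ?X j \<omega>)
        = (\<Sum>i\<in>I. \<Sum>j\<in>I. expectation (\<lambda>\<omega>. ?X i \<omega> * ?X j \<omega>))"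
      by (simp add: Bochner_Integration.integral_sum int Bochner_Integration.integrable_sum)
    also have "\<dots> = (\<Sum>i\<in>I. \<Sum>j\<in>I. expectation (\<lambda>\<omega>. \<zeta> i \<omega> * \<zeta> j \<omega>)
        * measure lborel ({a i<..b i} \<inter> {a j<..b j}))"
      by (intro sum.cong refl elementary_cross e)
    finally show ?thesis unfolding eq .
  qed
qed

lemma ito_isometry_disjoint:
  assumes I: "finite I" and e: "\<And>i. i \<in> I \<Longrightarrow> elementary (a i) (b i) (\<zeta> i)"
    and disj: "\<And>i j. i \<in> I \<Longrightarrow> j \<in> I \<Longrightarrow> i \<noteq> j \<Longrightarrow> {a i<..b i} \<inter> {a j<..b j} = {}"
  shows "expectation (\<lambda>\<omega>. (\<Sum>i\<in>I. \<zeta> i \<omega> * (B (b i) \<omega> - B (a i) \<omega>))\<^sup>2)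
      = (\<Sum>i\<in>I. expectation (\<lambda>\<omega>. (\<zeta> i \<omega>)\<^sup>2) * (b i - a i))"
proof -
  have "(\<Sum>j\<in>I. expectation (\<lambda>\<omega>. \<zeta> i \<omega> * \<zeta> j \<omega>) * measure lborel ({a i<..b i} \<inter> {a j<..b j}))
      = expectation (\<lambda>\<omega>. (\<zeta> i \<omega>)\<^sup>2) * (b i - a i)" if i: "i \<in> I" for i
  proof -
    have "(\<Sum>j\<in>I. expectation (\<lambda>\<omega>. \<zeta> i \<omega> * \<zeta> j \<omega>) * measure lborel ({a i<..b i} \<inter> {a j<..b j}))
      = (\<Sum>j\<in>I. if j = i then expectation (\<lambda>\<omega>. \<zeta> i \<omega> * \<zeta> i \<omega>) * measure lborel {a i<..b i} else 0)"
    proof (rule sum.cong[OF refl])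
      fix j assume j: "j \<in> I"
      show "expectation (\<lambda>\<omega>. \<zeta> i \<omega> * \<zeta> j \<omega>) * measure lborel ({a i<..b i} \<inter> {a j<..b j})
          = (if j = i then expectation (\<lambda>\<omega>. \<zeta> i \<omega> * \<zeta> i \<omega>) * measure lborel {a i<..b i} else 0)"
      proof (cases "j = i")
        case False
        then have "{a i<..b i} \<inter> {a j<..b j} = {}" using disj[OF i j] by auto
        then show ?thesis using False by (simp only: if_False measure_empty mult_zero_right)
      qed simp
    qed
    also have "\<dots> = expectation (\<lambda>\<omega>. (\<zeta> i \<omega>)\<^sup>2) * (b i - a i)"
      using I i e[OF i] by (simp add: power2_eq_square elementary_def)
    finally show ?thesis .
  qed
  then show ?thesis by (intro trans[OF ito_isometry_elementary(2)[OF I e] sum.cong[OF refl]])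
qed

end

end

section \<open>Almost sure summability\<close>

text \<open>
  Bounds a moment of order \<open>q\<close> by an even moment at the scale \<open>\<sigma>\<close>, without losing the power of \<open>\<sigma>\<close>.
\<close>

lemma powr_le_scaled_power:
  fixes z \<sigma> q :: real
  assumes s: "0 < \<sigma>" and q: "0 < q" "q \<le> real (2 * k)"
  shows "\<bar>z\<bar> powr q \<le> \<sigma> powr q * (1 + z ^ (2 * k) / \<sigma> ^ (2 * k))"
proof -
  define u where "u = \<bar>z\<bar> / \<sigma>"
  have u0: "0 \<le> u" using s by (simp add: u_def)
  have "u powr q \<le> 1 + u ^ (2 * k)"
  proof (cases "u \<le> 1")
    case True
    then have "u powr q \<le> 1" using u0 q by (intro powr_le1) auto
    then show ?thesis using u0 zero_le_power[of u "2 * k"] by linarith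
  next
    case False
    then have "u powr q \<le> u powr real (2 * k)" using q by (intro powr_mono) auto
    also have "u powr real (2 * k) = u ^ (2 * k)" using False by (intro powr_realpow) auto
    finally show ?thesis by simp
  qed
  moreover have "u ^ (2 * k) = z ^ (2 * k) / \<sigma> ^ (2 * k)"
    unfolding u_def by (simp add: power_divide power_even_abs)
  moreover have "\<bar>z\<bar> powr q = \<sigma> powr q * u powr q"
    using s u0 by (simp add: u_def powr_mult[symmetric])
  ultimately show ?thesis by (simp add: mult_left_mono)
qed

lemma dyadic_midpoint:
  assumes "0 < T"
  shows "dyadic T (Suc r) (2 * i + 1) - dyadic T r i = T / 2 ^ Suc r"
    and "dyadic T r (Suc i) - dyadic T (Suc r) (2 * i + 1) = T / 2 ^ Suc r"
  using assms by (simp_all add: dyadic_def field_simps)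

lemma dyadic_midpoint_range:
  assumes T: "0 < T" and i: "i < 2 ^ r"
  shows "0 \<le> dyadic T r i" "dyadic T r i \<le> dyadic T (Suc r) (2 * i + 1)"
    "dyadic T (Suc r) (2 * i + 1) \<le> dyadic T r (Suc i)" "dyadic T r (Suc i) \<le> T"
    "0 \<le> dyadic T (Suc r) (2 * i + 1)" "dyadic T (Suc r) (2 * i + 1) \<le> T"
proof -
  show 1: "0 \<le> dyadic T r i" "dyadic T r (Suc i) \<le> T"
    using dyadic_in_range[OF T, of i r] dyadic_in_range[OF T, of "Suc i" r] i by auto
  have h: "0 \<le> T / 2 ^ Suc r" using T by simp
  show 2: "dyadic T r i \<le> dyadic T (Suc r) (2 * i + 1)"
    using dyadic_midpoint(1)[OF T, of r i] h by linarith
  show 3: "dyadic T (Suc r) (2 * i + 1) \<le> dyadic T r (Suc i)"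
    using dyadic_midpoint(2)[OF T, of r i] h by linarith
  show "0 \<le> dyadic T (Suc r) (2 * i + 1)" "dyadic T (Suc r) (2 * i + 1) \<le> T"
    using 1 2 3 by linarith+
qed

context filtered_prob
begin

lemma AE_summableI:
  assumes f[measurable]: "\<And>n. f n \<in> borel_measurable M" and f0: "\<And>n \<omega>. 0 \<le> f n \<omega>"
    and le: "\<And>n. (\<integral>\<^sup>+\<omega>. ennreal (f n \<omega>) \<partial>M) \<le> ennreal (g n)"
    and g: "summable g" "\<And>n. 0 \<le> g n"
  shows "AE \<omega> in M. summable (\<lambda>n. f n \<omega> :: real)"
proof -
  have "(\<integral>\<^sup>+\<omega>. (\<Sum>n. ennreal (f n \<omega>)) \<partial>M) = (\<Sum>n. \<integral>\<^sup>+\<omega>. ennreal (f n \<omega>) \<partial>M)"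
    by (rule nn_integral_suminf) simp
  also have "\<dots> \<le> (\<Sum>n. ennreal (g n))" by (intro suminf_le le) auto
  also have "\<dots> = ennreal (suminf g)" using g by (intro suminf_ennreal2) auto
  finally have "(\<integral>\<^sup>+\<omega>. (\<Sum>n. ennreal (f n \<omega>)) \<partial>M) \<noteq> \<infinity>" by (auto simp: top_unique)
  then have "AE \<omega> in M. (\<Sum>n. ennreal (f n \<omega>)) \<noteq> \<infinity>" by (intro nn_integral_noteq_infinite) auto
  then show ?thesis
    by eventually_elim (rule summable_suminf_not_top, use f0 in auto)
qed

lemma nn_integral_le_dominated:
  assumes "\<And>\<omega>. f \<omega> \<le> g \<omega>" and "integrable M g" and "\<And>\<omega>. 0 \<le> g \<omega>" and "expectation g \<le> K"
  shows "(\<integral>\<^sup>+\<omega>. ennreal (f \<omega>) \<partial>M) \<le> ennreal K"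
proof -
  have "(\<integral>\<^sup>+\<omega>. ennreal (f \<omega>) \<partial>M) \<le> (\<integral>\<^sup>+\<omega>. ennreal (g \<omega>) \<partial>M)"
    by (intro nn_integral_mono ennreal_leI assms)
  also have "\<dots> = ennreal (expectation g)"
    using assms by (intro nn_integral_eq_integral) auto
  finally show ?thesis using assms(4) by (meson ennreal_leI order_trans)
qed

text \<open>
  Covers both integrands of the theorem: a \<open>1/p\<close>-Hoelder path, taken as a constant random variable at
  each time, and a Brownian coordinate.
\<close>

definition regular_process :: "real \<Rightarrow> real \<Rightarrow> (real \<Rightarrow> 'a \<Rightarrow> real) \<Rightarrow> bool" where
  "regular_process p C Y \<longleftrightarrow> 0 \<le> C \<and> (\<forall>t\<in>{0..T}. Y t \<in> borel_measurable (F t)) \<and>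
     (\<forall>s t. 0 \<le> s \<and> s \<le> t \<and> t \<le> T \<longrightarrow> integrable M (\<lambda>\<omega>. (Y t \<omega> - Y s \<omega>) ^ 4) \<and>
        expectation (\<lambda>\<omega>. (Y t \<omega> - Y s \<omega>) ^ 4) \<le> C * (t - s) powr (4 / p))"

lemma regular_process_adapted: "regular_process p C Y \<Longrightarrow> 0 \<le> t \<Longrightarrow> t \<le> T \<Longrightarrow> Y t \<in> borel_measurable (F t)"
  by (auto simp: regular_process_def)

lemma regular_process_measurable: "regular_process p C Y \<Longrightarrow> 0 \<le> t \<Longrightarrow> t \<le> T \<Longrightarrow> Y t \<in> borel_measurable M"
  using regular_process_adapted measurable_F by blast

lemma regular_increment_adapted:
  assumes Y: "regular_process p C Y" and "0 \<le> s" "s \<le> u" "t \<le> u" "0 \<le> t" "u \<le> T"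
  shows "(\<lambda>\<omega>. Y t \<omega> - Y s \<omega>) \<in> borel_measurable (F u)"
  using measurable_F_mono[of s u "Y s"] measurable_F_mono[of t u "Y t"]
    regular_process_adapted[OF Y, of s] regular_process_adapted[OF Y, of t] assms
  by (intro borel_measurable_diff) auto

lemma regular_square:
  assumes Y: "regular_process p C Y" and st: "0 \<le> s" "s \<le> t" "t \<le> T"
  shows "integrable M (\<lambda>\<omega>. (Y t \<omega> - Y s \<omega>)\<^sup>2)"
    and "expectation (\<lambda>\<omega>. (Y t \<omega> - Y s \<omega>)\<^sup>2) \<le> (1 + C) * (t - s) powr (2 / p)"
proof -
  have 4: "integrable M (\<lambda>\<omega>. (Y t \<omega> - Y s \<omega>) ^ 4)"
    "expectation (\<lambda>\<omega>. (Y t \<omega> - Y s \<omega>) ^ 4) \<le> C * (t - s) powr (4 / p)" and C: "0 \<le> C"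
    using Y st by (auto simp: regular_process_def)
  have [measurable]: "Y t \<in> borel_measurable M" "Y s \<in> borel_measurable M"
    using regular_process_measurable[OF Y] st by auto
  have sq: "z\<^sup>2 \<le> a + z ^ 4 / a" if "0 < a" for z a :: real
  proof -
    have "2 * (a * z\<^sup>2) \<le> a\<^sup>2 + (z\<^sup>2)\<^sup>2" using sum_squares_bound[of a "z\<^sup>2"] by simp
    moreover have "0 \<le> a * z\<^sup>2" using that by simp
    ultimately have "a * z\<^sup>2 \<le> a\<^sup>2 + (z\<^sup>2)\<^sup>2" by linarith
    then show ?thesis using that by (simp add: field_simps power2_eq_square power4_eq_xxxx)
  qed
  show i2: "integrable M (\<lambda>\<omega>. (Y t \<omega> - Y s \<omega>)\<^sup>2)"
  proof (rule Bochner_Integration.integrable_bound)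
    show "integrable M (\<lambda>\<omega>. 1 + (Y t \<omega> - Y s \<omega>) ^ 4 / 1)" using 4 by auto
    show "AE \<omega> in M. norm ((Y t \<omega> - Y s \<omega>)\<^sup>2) \<le> norm (1 + (Y t \<omega> - Y s \<omega>) ^ 4 / 1)"
      using sq[of 1] by (auto intro!: AE_I2 intro: order_trans[OF _ abs_ge_self])
  qed measurable
  show "expectation (\<lambda>\<omega>. (Y t \<omega> - Y s \<omega>)\<^sup>2) \<le> (1 + C) * (t - s) powr (2 / p)"
  proof (cases "s = t")
    case False
    let ?a = "(t - s) powr (2 / p)"
    have a: "0 < ?a" using False st by simp
    have "expectation (\<lambda>\<omega>. (Y t \<omega> - Y s \<omega>)\<^sup>2) \<le> expectation (\<lambda>\<omega>. ?a + (Y t \<omega> - Y s \<omega>) ^ 4 / ?a)"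
      using 4 by (intro integral_mono i2 sq a) auto
    also have "\<dots> = ?a + expectation (\<lambda>\<omega>. (Y t \<omega> - Y s \<omega>) ^ 4) / ?a"
      using 4 by (simp add: prob_space)
    also have "\<dots> \<le> ?a + C * (t - s) powr (4 / p) / ?a"
      using 4 a by (intro add_left_mono divide_right_mono) auto
    also have "(t - s) powr (4 / p) = ?a * ?a" by (simp add: powr_add[symmetric])
    finally show ?thesis using a by (simp add: algebra_simps)
  qed simp
qed

lemma scalar_bm_regular:
  assumes B: "scalar_bm B" and p: "2 < p"
  shows "regular_process p (3 * T powr (2 - 4 / p)) B"
  unfolding regular_process_def
proof (intro conjI allI impI ballI)
  fix s t assume st: "0 \<le> s \<and> s \<le> t \<and> t \<le> T"
  show "integrable M (\<lambda>\<omega>. (B t \<omega> - B s \<omega>) ^ 4)" using bm_moments(1)[OF B] st by auto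
  have "(t - s)\<^sup>2 \<le> T powr (2 - 4 / p) * (t - s) powr (4 / p)"
  proof (cases "s = t")
    case False
    then have pos: "0 < t - s" using st by simp
    have "(t - s)\<^sup>2 = (t - s) powr ((2 - 4 / p) + 4 / p)"
      using pos by (simp add: powr_numeral)
    also have "\<dots> = (t - s) powr (2 - 4 / p) * (t - s) powr (4 / p)" by (rule powr_add)
    also have "\<dots> \<le> T powr (2 - 4 / p) * (t - s) powr (4 / p)"
      using pos st p by (intro mult_right_mono powr_mono2) (auto simp: field_simps)
    finally show ?thesis .
  qed simp
  then show "expectation (\<lambda>\<omega>. (B t \<omega> - B s \<omega>) ^ 4) \<le> 3 * T powr (2 - 4 / p) * (t - s) powr (4 / p)"
    using bm_moments(4)[OF B, of s t] st by simp
qed (use bm_adapted[OF B] in auto)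

lemma holder_regular:
  assumes h: "\<And>s t. 0 \<le> s \<Longrightarrow> s \<le> t \<Longrightarrow> t \<le> T \<Longrightarrow> \<bar>x t - x s\<bar> \<le> C * (t - s) powr (1 / p)" and C: "0 \<le> C"
  shows "regular_process p (C ^ 4) (\<lambda>t _. x t)"
  unfolding regular_process_def
proof (intro conjI allI impI ballI)
  fix s t assume st: "0 \<le> s \<and> s \<le> t \<and> t \<le> T"
  have "(x t - x s) ^ 4 = \<bar>x t - x s\<bar> ^ 4" by (simp add: power_even_abs)
  also have "\<dots> \<le> (C * (t - s) powr (1 / p)) ^ 4" using h st by (intro power_mono) auto
  also have "\<dots> = C ^ 4 * (t - s) powr (4 / p)"
    by (cases "s = t") (use st in \<open>auto simp: power_mult_distrib powr_realpow[symmetric] powr_powr\<close>)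
  finally show "expectation (\<lambda>_. (x t - x s) ^ 4) \<le> C ^ 4 * (t - s) powr (4 / p)" by (simp add: prob_space)
qed (use C in auto)

lemma rate_less_1:
  fixes c p q :: real
  assumes "0 < c" "c < 2 powr (q / p - 1)"
  shows "0 \<le> c * 2 powr (1 - q / p)" "c * 2 powr (1 - q / p) < 1"
proof -
  have "c * 2 powr (1 - q / p) < 2 powr (q / p - 1) * 2 powr (1 - q / p)"
    using assms by (intro mult_strict_right_mono) auto
  also have "\<dots> = 1" by (simp add: powr_add[symmetric])
  finally show "c * 2 powr (1 - q / p) < 1" .
qed (use assms in simp)

text \<open>
  Even moments bounded by powers of the scales \<open>\<sigma>\<close> reduce almost sure convergence of the random series to
  convergence of the series of the scales.
\<close>

lemma AE_summable_moments:
  fixes S :: "nat \<Rightarrow> 'i \<Rightarrow> 'a \<Rightarrow> real" and \<sigma> :: "nat \<Rightarrow> 'i \<Rightarrow> real"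
  assumes S: "\<And>r i. i \<in> I r \<Longrightarrow> S r i \<in> borel_measurable M"
    "\<And>r i. i \<in> I r \<Longrightarrow> integrable M (\<lambda>\<omega>. S r i \<omega> ^ (2 * k))"
    "\<And>r i. i \<in> I r \<Longrightarrow> expectation (\<lambda>\<omega>. S r i \<omega> ^ (2 * k)) \<le> K * \<sigma> r i ^ (2 * k)"
    and s: "\<And>r i. i \<in> I r \<Longrightarrow> 0 < \<sigma> r i" and K: "0 \<le> K"
    and a: "0 < a" "a \<le> real (2 * k)" and c: "0 < c"
    and g: "\<And>r. c ^ r * (\<Sum>i\<in>I r. \<sigma> r i powr a) \<le> g r" "summable g"
  shows "AE \<omega> in M. summable (\<lambda>r. c ^ r * (\<Sum>i\<in>I r. \<bar>S r i \<omega>\<bar> powr a))"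
proof (rule AE_summableI[where g = "\<lambda>r. (1 + K) * g r"])
  fix r
  show "(\<lambda>\<omega>. c ^ r * (\<Sum>i\<in>I r. \<bar>S r i \<omega>\<bar> powr a)) \<in> borel_measurable M"
    using S(1) by (intro borel_measurable_times borel_measurable_sum powr_real_measurable
          borel_measurable_abs borel_measurable_const) auto
  show "0 \<le> c ^ r * (\<Sum>i\<in>I r. \<bar>S r i \<omega>\<bar> powr a)" for \<omega>
    using c by (intro mult_nonneg_nonneg sum_nonneg) auto
  have "0 \<le> c ^ r * (\<Sum>i\<in>I r. \<sigma> r i powr a)" using c by (intro mult_nonneg_nonneg sum_nonneg) auto
  then show "0 \<le> (1 + K) * g r" using K g(1)[of r] by (intro mult_nonneg_nonneg) auto
  let ?h = "\<lambda>i \<omega>. \<sigma> r i powr a * (1 + S r i \<omega> ^ (2 * k) / \<sigma> r i ^ (2 * k))"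
  have h0: "0 \<le> ?h i \<omega>" if "i \<in> I r" for i \<omega>
    using s[OF that] by (intro mult_nonneg_nonneg add_nonneg_nonneg divide_nonneg_nonneg) auto
  have hi: "integrable M (?h i)" if "i \<in> I r" for i
    using S(2)[OF that] by simp
  show "(\<integral>\<^sup>+\<omega>. ennreal (c ^ r * (\<Sum>i\<in>I r. \<bar>S r i \<omega>\<bar> powr a)) \<partial>M) \<le> ennreal ((1 + K) * g r)"
  proof (rule nn_integral_le_dominated[where g = "\<lambda>\<omega>. c ^ r * (\<Sum>i\<in>I r. ?h i \<omega>)"])
    fix \<omega>
    show "c ^ r * (\<Sum>i\<in>I r. \<bar>S r i \<omega>\<bar> powr a) \<le> c ^ r * (\<Sum>i\<in>I r. ?h i \<omega>)"
      using c a by (intro mult_left_mono sum_mono powr_le_scaled_power s) auto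
    show "0 \<le> c ^ r * (\<Sum>i\<in>I r. ?h i \<omega>)"
      using c by (intro mult_nonneg_nonneg sum_nonneg h0) auto
  next
    show "integrable M (\<lambda>\<omega>. c ^ r * (\<Sum>i\<in>I r. ?h i \<omega>))"
      by (intro integrable_mult_right Bochner_Integration.integrable_sum hi)
    have "expectation (\<lambda>\<omega>. c ^ r * (\<Sum>i\<in>I r. ?h i \<omega>)) = c ^ r * (\<Sum>i\<in>I r. expectation (?h i))"
      using Bochner_Integration.integral_sum[of "I r" M ?h] hi by simp
    also have "\<dots> \<le> c ^ r * (\<Sum>i\<in>I r. \<sigma> r i powr a * (1 + K))"
    proof (intro mult_left_mono sum_mono)
      fix i assume i: "i \<in> I r"
      have "expectation (?h i) = \<sigma> r i powr a * (1 + expectation (\<lambda>\<omega>. S r i \<omega> ^ (2 * k)) / \<sigma> r i ^ (2 * k))"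
        using S(2)[OF i] by (simp add: prob_space)
      also have "\<dots> \<le> \<sigma> r i powr a * (1 + K)"
        using S(3)[OF i] s[OF i] by (intro mult_left_mono add_left_mono) (auto simp: pos_divide_le_eq)
      finally show "expectation (?h i) \<le> \<sigma> r i powr a * (1 + K)" .
    qed (use c in simp)
    also have "\<dots> = (1 + K) * (c ^ r * (\<Sum>i\<in>I r. \<sigma> r i powr a))"
      by (simp only: sum_distrib_right[symmetric]) (simp add: mult_ac)
    also have "\<dots> \<le> (1 + K) * g r" using K by (intro mult_left_mono g) auto
    finally show "expectation (\<lambda>\<omega>. c ^ r * (\<Sum>i\<in>I r. ?h i \<omega>)) \<le> (1 + K) * g r" .
  qed
next
  show "summable (\<lambda>r. (1 + K) * g r)" by (intro summable_mult g)
qed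

text \<open>
  Level \<open>m\<close> has \<open>2\<^sup>m\<close> increments whose \<open>q\<close>-th moment is of order \<open>2\<^sup>-\<^sup>m\<^sup>q\<^sup>/\<^sup>p\<close>, so the weighted series is
  geometric with ratio \<open>c 2\<^sup>1\<^sup>-\<^sup>q\<^sup>/\<^sup>p < 1\<close>.
\<close>

lemma regular_summable_increments:
  assumes Y: "regular_process p C Y" and p: "0 < p" "p < q" "q \<le> 4" and c: "0 < c" "c < 2 powr (q / p - 1)"
  shows "AE \<omega> in M. summable_increments T q c (\<lambda>t. Y t \<omega>)"
proof -
  let ?z = "\<lambda>m j \<omega>. Y (dyadic T m (Suc j)) \<omega> - Y (dyadic T m j) \<omega>"
  let ?\<sigma> = "\<lambda>m (j :: nat). (T / 2 ^ m) powr (1 / p)"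
  let ?\<rho> = "c * 2 powr (1 - q / p)"
  have C: "0 \<le> C" using Y by (simp add: regular_process_def)
  have "AE \<omega> in M. summable (\<lambda>m. c ^ m * (\<Sum>j<2 ^ m. \<bar>?z m j \<omega>\<bar> powr q))"
  proof (rule AE_summable_moments[where k = 2 and \<sigma> = ?\<sigma> and K = C and g = "\<lambda>m. T powr (q / p) * ?\<rho> ^ m"])
    fix m j :: nat assume "j \<in> {..<2 ^ m}"
    then have r: "dyadic T m j \<in> {0..T}" "dyadic T m (Suc j) \<in> {0..T}"
      using dyadic_in_range[OF T_pos] by auto
    then show "?z m j \<in> borel_measurable M"
      by (intro borel_measurable_diff regular_process_measurable[OF Y]) auto
    have h: "dyadic T m (Suc j) - dyadic T m j = T / 2 ^ m" by (simp add: dyadic_def field_simps)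
    have s4: "?\<sigma> m j ^ 4 = (T / 2 ^ m) powr (4 / p)"
      using T_pos by (simp add: powr_realpow[symmetric] powr_powr)
    have "0 \<le> dyadic T m j \<and> dyadic T m j \<le> dyadic T m (Suc j) \<and> dyadic T m (Suc j) \<le> T"
      using r dyadic_mono[OF T_pos, of m j "Suc j"] by auto
    then have "integrable M (\<lambda>\<omega>. ?z m j \<omega> ^ 4) \<and> expectation (\<lambda>\<omega>. ?z m j \<omega> ^ 4) \<le> C * (T / 2 ^ m) powr (4 / p)"
      using Y unfolding regular_process_def h[symmetric] by blast
    then show "integrable M (\<lambda>\<omega>. ?z m j \<omega> ^ (2 * 2))"
      "expectation (\<lambda>\<omega>. ?z m j \<omega> ^ (2 * 2)) \<le> C * ?\<sigma> m j ^ (2 * 2)"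
      by (simp_all add: s4)
    show "0 < ?\<sigma> m j" using T_pos by simp
  next
    fix m
    have "?\<sigma> m 0 powr q = T powr (q / p) / (2 ^ m) powr (q / p)"
      using T_pos by (simp add: powr_powr powr_divide)
    also have "(2 ^ m) powr (q / p) = (2 powr (q / p)) ^ m"
      by (simp add: powr_realpow[symmetric] powr_powr mult.commute)
    finally have "?\<sigma> m 0 powr q = T powr (q / p) * (2 powr (- q / p)) ^ m"
      by (simp add: powr_minus power_inverse divide_inverse)
    then have "c ^ m * (\<Sum>j<2 ^ m. ?\<sigma> m j powr q) = T powr (q / p) * (c * (2 * 2 powr (- q / p))) ^ m"
      by (simp add: power_mult_distrib mult_ac)
    also have "2 * 2 powr (- q / p) = 2 powr (1 - q / p)" using powr_add[of 2 1 "- q / p"] by simp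
    finally show "c ^ m * (\<Sum>j<2 ^ m. ?\<sigma> m j powr q) \<le> T powr (q / p) * ?\<rho> ^ m" by simp
  next
    show "summable (\<lambda>m. T powr (q / p) * ?\<rho> ^ m)"
      using rate_less_1[OF c] by (intro summable_mult summable_geometric) auto
  qed (use C p c in auto)
  then show ?thesis by (simp add: summable_increments_def)
qed

text \<open>
  The scale of \<open>S r m j\<close> is \<open>\<sigma> = 2\<^sup>-\<^sup>m\<^sup>/\<^sup>2 2\<^sup>-\<^sup>r\<^sup>/\<^sup>p\<close>. Each of the \<open>r + 1\<close> levels \<open>m \<le> r\<close> contributes at most
  \<open>2\<^sup>m \<sigma>\<^sup>q\<^sup>/\<^sup>2 \<le> 2\<^sup>r\<^sup>(\<^sup>1\<^sup>-\<^sup>q\<^sup>/\<^sup>p\<^sup>)\<close>, where \<open>q \<le> 4\<close> makes \<open>m = r\<close> the worst level and \<open>p \<ge> 2\<close> compares the two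
  exponents.
\<close>

lemma AE_summable_corrections:
  fixes S :: "nat \<Rightarrow> nat \<Rightarrow> nat \<Rightarrow> 'a \<Rightarrow> real"
  assumes S: "\<And>r m j. m \<le> r \<Longrightarrow> j < 2 ^ m \<Longrightarrow> S r m j \<in> borel_measurable M"
    "\<And>r m j. m \<le> r \<Longrightarrow> j < 2 ^ m \<Longrightarrow> integrable M (\<lambda>\<omega>. (S r m j \<omega>)\<^sup>2)"
    "\<And>r m j. m \<le> r \<Longrightarrow> j < 2 ^ m \<Longrightarrow>
       expectation (\<lambda>\<omega>. (S r m j \<omega>)\<^sup>2) \<le> K * (2 powr (- real m) * 2 powr (- 2 * real r / p))"
    and K: "0 \<le> K" and p: "2 \<le> p" "p < q" "q \<le> 4" and c: "0 < c" "c < 2 powr (q / p - 1)"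
  shows "AE \<omega> in M. summable (\<lambda>r. c ^ r * (\<Sum>m\<le>r. \<Sum>j<2 ^ m. \<bar>S r m j \<omega>\<bar> powr (q / 2)))"
proof -
  define I where "I r = Sigma {..r} (\<lambda>m. {..<2 ^ m :: nat})" for r :: nat
  \<comment> \<open>Up to \<open>K\<close>, the square of the scale is the bound on the second moment.\<close>
  define \<sigma> where "\<sigma> r z = 2 powr (- (real (fst z) / 2 + real r / p))" for r :: nat and z :: "nat \<times> nat"
  have s2: "2 powr (- real m) * 2 powr (- 2 * real r / p) = (\<sigma> r (m, j))\<^sup>2" for r m j
    unfolding \<sigma>_def power2_eq_square powr_add[symmetric] fst_conv
    by (rule arg_cong[where f = "\<lambda>x. 2 powr x"]) (simp add: algebra_simps)
  have sq: "2 ^ m * \<sigma> r (m, j) powr (q / 2) \<le> (2 powr (1 - q / p)) ^ r" if m: "m \<le> r" for r m j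
  proof -
    have "2 ^ m * \<sigma> r (m, j) powr (q / 2) = 2 powr (real m + - (real m / 2 + real r / p) * (q / 2))"
      unfolding \<sigma>_def powr_add by (simp add: powr_powr powr_realpow[symmetric])
    also have "\<dots> \<le> 2 powr ((1 - q / p) * real r)"
    proof (rule powr_mono)
      define x where "x = real r * q / p"
      have "real m * (1 - q / 4) \<le> real r * (1 - q / 4)" using m p by (intro mult_right_mono) auto
      moreover have "x \<le> real r * q / 2" unfolding x_def using p by (intro divide_left_mono) auto
      moreover have "real m + - (real m / 2 + real r / p) * (q / 2) = real m * (1 - q / 4) - x / 2"
        by (simp add: x_def algebra_simps)
      moreover have "(1 - q / p) * real r = real r - x" by (simp add: x_def algebra_simps)
      moreover have "real r * (1 - q / 4) = real r - real r * q / 4" by (simp add: algebra_simps)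
      ultimately show "real m + - (real m / 2 + real r / p) * (q / 2) \<le> (1 - q / p) * real r"
        by linarith
    qed simp
    also have "\<dots> = (2 powr (1 - q / p)) ^ r" by (simp add: powr_realpow[symmetric] powr_powr)
    finally show ?thesis .
  qed
  have flat: "(\<Sum>z\<in>I r. f (fst z) (snd z)) = (\<Sum>m\<le>r. \<Sum>j<2 ^ m. f m j :: real)" for r f
    unfolding I_def by (simp add: sum.Sigma case_prod_unfold)
  have "AE \<omega> in M. summable (\<lambda>r. c ^ r * (\<Sum>z\<in>I r. \<bar>S r (fst z) (snd z) \<omega>\<bar> powr (q / 2)))"
  proof (rule AE_summable_moments[where k = 1 and \<sigma> = \<sigma> and K = K
        and g = "\<lambda>r. real (Suc r) * (c * 2 powr (1 - q / p)) ^ r"])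
    fix r z assume z: "z \<in> I r"
    then have mj: "fst z \<le> r" "snd z < 2 ^ fst z" by (auto simp: I_def)
    show "S r (fst z) (snd z) \<in> borel_measurable M" by (rule S(1)[OF mj])
    show "integrable M (\<lambda>\<omega>. S r (fst z) (snd z) \<omega> ^ (2 * 1))" using S(2)[OF mj] by simp
    show "expectation (\<lambda>\<omega>. S r (fst z) (snd z) \<omega> ^ (2 * 1)) \<le> K * \<sigma> r z ^ (2 * 1)"
      using S(3)[OF mj] unfolding s2[of "fst z" r "snd z"] by simp
    show "0 < \<sigma> r z" by (simp add: \<sigma>_def)
  next
    fix r
    have "(\<Sum>z\<in>I r. \<sigma> r z powr (q / 2)) = (\<Sum>m\<le>r. \<Sum>j<2 ^ m. \<sigma> r (m, j) powr (q / 2))"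
      using flat[of "\<lambda>m j. \<sigma> r (m, j) powr (q / 2)" r] by simp
    also have "\<dots> = (\<Sum>m\<le>r. 2 ^ m * \<sigma> r (m, 0) powr (q / 2))" by (simp add: \<sigma>_def)
    also have "\<dots> \<le> (\<Sum>m\<le>r. (2 powr (1 - q / p)) ^ r)" by (intro sum_mono sq) auto
    finally have "c ^ r * (\<Sum>z\<in>I r. \<sigma> r z powr (q / 2)) \<le> c ^ r * (real (Suc r) * (2 powr (1 - q / p)) ^ r)"
      using c by (intro mult_left_mono) auto
    then show "c ^ r * (\<Sum>z\<in>I r. \<sigma> r z powr (q / 2)) \<le> real (Suc r) * (c * 2 powr (1 - q / p)) ^ r"
      by (simp add: power_mult_distrib mult_ac)
  next
    show "summable (\<lambda>r. real (Suc r) * (c * 2 powr (1 - q / p)) ^ r)"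
      using rate_less_1[OF c] by (intro summable_linear_geometric)
  qed (use K p c in auto)
  moreover have "(\<Sum>z\<in>I r. \<bar>S r (fst z) (snd z) \<omega>\<bar> powr (q / 2)) = (\<Sum>m\<le>r. \<Sum>j<2 ^ m. \<bar>S r m j \<omega>\<bar> powr (q / 2))" for r \<omega>
    by (rule flat)
  ultimately show ?thesis by (simp only:)
qed

text \<open>
  Second moment of an elementary integral with one interval in each of the \<open>2\<^sup>r\<^sup>-\<^sup>m\<close> level-\<open>r\<close> cells of a
  level-\<open>m\<close> interval; both halves of the cells occur, according to which factor is Brownian.
\<close>

lemma cell_sum_second_moment:
  assumes B: "scalar_bm B" and D: "0 \<le> D" and p: "0 < p"
    and mr: "m \<le> r" "j < 2 ^ m"
    and cell: "\<And>i. i < 2 ^ r \<Longrightarrow> dyadic T r i \<le> a i \<and> b i \<le> dyadic T r (Suc i) \<and> b i - a i = T / 2 ^ Suc r"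
    and e: "\<And>i. i < 2 ^ r \<Longrightarrow> elementary (a i) (b i) (\<zeta> i)"
    and z: "\<And>i. i < 2 ^ r \<Longrightarrow> expectation (\<lambda>\<omega>. (\<zeta> i \<omega>)\<^sup>2) \<le> D * (T / 2 ^ Suc r) powr (2 / p)"
  defines "S \<equiv> \<lambda>\<omega>. \<Sum>i=j * 2 ^ (r - m)..<(j + 1) * 2 ^ (r - m). \<zeta> i \<omega> * (B (b i) \<omega> - B (a i) \<omega>)"
  shows "S \<in> borel_measurable M" "integrable M (\<lambda>\<omega>. (S \<omega>)\<^sup>2)"
    and "expectation (\<lambda>\<omega>. (S \<omega>)\<^sup>2) \<le> D * T powr (2 / p) * T * (2 powr (- real m) * 2 powr (- 2 * real r / p))"
proof -
  let ?I = "{j * 2 ^ (r - m)..<(j + 1) * 2 ^ (r - m)}"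
  have "(j + 1) * 2 ^ (r - m) \<le> 2 ^ m * 2 ^ (r - m)" using mr by (intro mult_right_mono) auto
  then have "(j + 1) * 2 ^ (r - m) \<le> 2 ^ r" using mr by (simp add: power_add[symmetric] del: mult_Suc)
  then have I: "i < 2 ^ r" if "i \<in> ?I" for i using that by auto
  have eI: "elementary (a i) (b i) (\<zeta> i)" if "i \<in> ?I" for i using e I that by blast
  show "S \<in> borel_measurable M" unfolding S_def
    by (intro borel_measurable_sum elementary_square(3)[OF B] eI)
  show "integrable M (\<lambda>\<omega>. (S \<omega>)\<^sup>2)" unfolding S_def
    by (rule ito_isometry_elementary(1)[OF B]) (use eI in auto)
  have "expectation (\<lambda>\<omega>. (S \<omega>)\<^sup>2) = (\<Sum>i\<in>?I. expectation (\<lambda>\<omega>. (\<zeta> i \<omega>)\<^sup>2) * (b i - a i))"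
    unfolding S_def
  proof (rule ito_isometry_disjoint[OF B])
    fix i k assume ik: "i \<in> ?I" "k \<in> ?I" "i \<noteq> k"
    then consider "Suc i \<le> k" | "Suc k \<le> i" by linarith
    then show "{a i<..b i} \<inter> {a k<..b k} = {}"
    proof cases
      case 1
      then have "b i \<le> a k" using cell[OF I[OF ik(1)]] cell[OF I[OF ik(2)]] dyadic_mono[OF T_pos, of r "Suc i" k] by auto
      then show ?thesis by auto
    next
      case 2
      then have "b k \<le> a i" using cell[OF I[OF ik(1)]] cell[OF I[OF ik(2)]] dyadic_mono[OF T_pos, of r "Suc k" i] by auto
      then show ?thesis by auto
    qed
  qed (use eI in auto)
  also have "\<dots> \<le> (\<Sum>i\<in>?I. (D * (T / 2 ^ r) powr (2 / p)) * (T / 2 ^ r))"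
  proof (intro sum_mono mult_mono)
    fix i assume i: "i \<in> ?I"
    have le: "T / 2 ^ Suc r \<le> T / 2 ^ r" using T_pos by (simp add: field_simps)
    show "b i - a i \<le> T / 2 ^ r" using cell[OF I[OF i]] le by linarith
    have "D * (T / 2 ^ Suc r) powr (2 / p) \<le> D * (T / 2 ^ r) powr (2 / p)"
      using D p le T_pos by (intro mult_left_mono powr_mono2) auto
    then show "expectation (\<lambda>\<omega>. (\<zeta> i \<omega>)\<^sup>2) \<le> D * (T / 2 ^ r) powr (2 / p)" using z[OF I[OF i]] by linarith
    show "0 \<le> b i - a i" using cell[OF I[OF i]] T_pos by simp
  qed (use D in auto)
  also have "\<dots> = D * (T / 2 ^ r) powr (2 / p) * (T * (2 ^ (r - m) / 2 ^ r))" by simp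
  also have "(2 :: real) ^ (r - m) / 2 ^ r = 2 powr (- real m)"
    using mr by (simp add: powr_minus powr_realpow power_diff divide_inverse)
  also have "(T / 2 ^ r) powr (2 / p) = T powr (2 / p) * 2 powr (- 2 * real r / p)"
  proof -
    have "(2 ^ r :: real) powr (2 / p) = 2 powr (2 * real r / p)"
      by (simp add: powr_realpow[symmetric] powr_powr mult.commute)
    then show ?thesis unfolding powr_divide by (simp add: powr_minus_divide)
  qed
  finally show "expectation (\<lambda>\<omega>. (S \<omega>)\<^sup>2) \<le> D * T powr (2 / p) * T * (2 powr (- real m) * 2 powr (- 2 * real r / p))"
    by (simp add: mult_ac)
qed

text \<open>
  Here the coefficient is the increment of \<open>Y\<close> over the left half of a cell, which is known at the
  midpoint, and the Brownian increment is taken over the right half.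
\<close>

lemma regular_bm_summable_corrections:
  assumes B: "scalar_bm B" and Y: "regular_process p C Y"
    and p: "2 \<le> p" "p < q" "q \<le> 4" and c: "0 < c" "c < 2 powr (q / p - 1)"
  shows "AE \<omega> in M. summable_corrections T q c (\<lambda>t. Y t \<omega>) (\<lambda>t. B t \<omega>)"
proof -
  let ?m = "\<lambda>r i. dyadic T (Suc r) (2 * i + 1)"
  let ?\<zeta> = "\<lambda>r i \<omega>. Y (?m r i) \<omega> - Y (dyadic T r i) \<omega>"
  have C: "0 \<le> 1 + C" using Y by (simp add: regular_process_def)
  note rng = dyadic_midpoint_range[OF T_pos]
  have e: "elementary (?m r i) (dyadic T r (Suc i)) (?\<zeta> r i)" if i: "i < 2 ^ r" for r i
    unfolding elementary_def
    using rng[OF i] regular_square(1)[OF Y rng(1)[OF i] rng(2)[OF i] rng(6)[OF i]]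
    by (auto intro!: regular_increment_adapted[OF Y])
  have z: "expectation (\<lambda>\<omega>. (?\<zeta> r i \<omega>)\<^sup>2) \<le> (1 + C) * (T / 2 ^ Suc r) powr (2 / p)" if i: "i < 2 ^ r" for r i
    using regular_square(2)[OF Y rng(1)[OF i] rng(2)[OF i] rng(6)[OF i]] unfolding dyadic_midpoint[OF T_pos] .
  have cell: "dyadic T r i \<le> ?m r i \<and> dyadic T r (Suc i) \<le> dyadic T r (Suc i)
      \<and> dyadic T r (Suc i) - ?m r i = T / 2 ^ Suc r" if i: "i < 2 ^ r" for r i
    using rng[OF i] dyadic_midpoint[OF T_pos] by auto
  have p0: "0 < p" using p by simp
  note SM = cell_sum_second_moment[OF B C p0 _ _ cell e z]
  have "AE \<omega> in M. summable (\<lambda>r. c ^ r * (\<Sum>m\<le>r. \<Sum>j<2 ^ m.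
     \<bar>dyadic_corr T (\<lambda>t. Y t \<omega>) (\<lambda>t. B t \<omega>) r (j * 2 ^ (r - m)) ((j + 1) * 2 ^ (r - m))\<bar> powr (q / 2)))"
    unfolding dyadic_corr_def
    by (rule AE_summable_corrections[where K = "(1 + C) * T powr (2 / p) * T" and
       S = "\<lambda>r m j \<omega>. \<Sum>i=j * 2 ^ (r - m)..<(j + 1) * 2 ^ (r - m). ?\<zeta> r i \<omega> * (B (dyadic T r (Suc i)) \<omega> - B (?m r i) \<omega>)"])
      (use SM C T_pos p c in auto)
  then show ?thesis by (simp add: summable_corrections_def)
qed

text \<open>
  With the Brownian coordinate first, the coefficient is an increment of \<open>x\<close> over the right half of a
  cell; it may lie in the future of the left half because it is deterministic.
\<close>

lemma bm_holder_summable_corrections: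
  assumes B: "scalar_bm B" and Y: "regular_process p C (\<lambda>t _. x t)"
    and p: "2 \<le> p" "p < q" "q \<le> 4" and c: "0 < c" "c < 2 powr (q / p - 1)"
  shows "AE \<omega> in M. summable_corrections T q c (\<lambda>t. B t \<omega>) x"
proof -
  let ?m = "\<lambda>r i. dyadic T (Suc r) (2 * i + 1)"
  let ?\<zeta> = "\<lambda>r i (\<omega> :: 'a). x (dyadic T r (Suc i)) - x (?m r i)"
  have C: "0 \<le> 1 + C" using Y by (simp add: regular_process_def)
  note rng = dyadic_midpoint_range[OF T_pos]
  have e: "elementary (dyadic T r i) (?m r i) (?\<zeta> r i)" if i: "i < 2 ^ r" for r i
    unfolding elementary_def using rng[OF i] by auto
  have z: "expectation (\<lambda>\<omega>. (?\<zeta> r i \<omega>)\<^sup>2) \<le> (1 + C) * (T / 2 ^ Suc r) powr (2 / p)" if i: "i < 2 ^ r" for r i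
    using regular_square(2)[OF Y rng(5)[OF i] rng(3)[OF i] rng(4)[OF i]] unfolding dyadic_midpoint[OF T_pos] .
  have cell: "dyadic T r i \<le> dyadic T r i \<and> ?m r i \<le> dyadic T r (Suc i)
      \<and> ?m r i - dyadic T r i = T / 2 ^ Suc r" if i: "i < 2 ^ r" for r i
    using rng[OF i] dyadic_midpoint[OF T_pos] by auto
  have p0: "0 < p" using p by simp
  note SM = cell_sum_second_moment[OF B C p0 _ _ cell e z]
  have "AE \<omega> in M. summable (\<lambda>r. c ^ r * (\<Sum>m\<le>r. \<Sum>j<2 ^ m.
     \<bar>\<Sum>i=j * 2 ^ (r - m)..<(j + 1) * 2 ^ (r - m). ?\<zeta> r i \<omega> * (B (?m r i) \<omega> - B (dyadic T r i) \<omega>)\<bar> powr (q / 2)))"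
    by (rule AE_summable_corrections[where K = "(1 + C) * T powr (2 / p) * T"])
      (use SM C T_pos p c in auto)
  then show ?thesis by (simp add: summable_corrections_def dyadic_corr_def mult.commute)
qed

end

section \<open>Uniqueness of the It\^o integral\<close>

text \<open>
  The integrand of the It\^o integral is a limit of step processes only almost everywhere, hence
  measurable only for the completed product measure.
\<close>

lemma measurable_completion_AE:
  fixes f g :: "'x \<Rightarrow> 'y :: topological_space"
  assumes g: "g \<in> borel_measurable Q" and eq: "AE x in Q. f x = g x"
  shows "f \<in> borel_measurable (completion Q)"
proof (rule measurableI)
  fix A :: "'y set" assume A: "A \<in> sets borel"
  from eq obtain N where N: "N \<in> null_sets Q" "{x \<in> space Q. f x \<noteq> g x} \<subseteq> N"
    by (auto simp: eventually_ae_filter)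
  have gA: "g -` A \<inter> space Q \<in> sets Q" using measurable_sets[OF g A] .
  have Nm: "N \<in> sets Q" using N by auto
  have "f -` A \<inter> space (completion Q) = (g -` A \<inter> space Q - N) \<union> (f -` A \<inter> space Q \<inter> N)"
    using N(2) by auto
  then show "f -` A \<inter> space (completion Q) \<in> sets (completion Q)"
    by (rule sets_completionI[where N' = N]) (use N(1) gA Nm in auto)
qed simp

text \<open>
  Fatou's lemma in the form used for \<open>L\<^sup>2\<close> limits: a bound on the distance to all late members of a
  sequence passes to the distance to an almost sure limit.
\<close>

lemma nn_integral_Fatou_le:
  fixes f :: "nat \<Rightarrow> 'x \<Rightarrow> ennreal"
  assumes f: "\<And>n. f n \<in> borel_measurable Q" and lim: "AE x in Q. (\<lambda>n. f n x) \<longlonglongrightarrow> g x"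
    and K: "\<And>n. start \<le> n \<Longrightarrow> (\<integral>\<^sup>+x. f n x \<partial>Q) \<le> K"
  shows "(\<integral>\<^sup>+x. g x \<partial>Q) \<le> K"
proof -
  have "(\<integral>\<^sup>+x. g x \<partial>Q) = (\<integral>\<^sup>+x. liminf (\<lambda>n. f n x) \<partial>Q)"
    by (rule nn_integral_cong_AE) (use lim in \<open>eventually_elim, simp add: lim_imp_Liminf\<close>)
  also have "\<dots> \<le> liminf (\<lambda>n. \<integral>\<^sup>+x. f n x \<partial>Q)" by (rule nn_integral_liminf[OF f])
  also have "\<dots> \<le> limsup (\<lambda>n. \<integral>\<^sup>+x. f n x \<partial>Q)" by (intro Liminf_le_Limsup sequentially_bot)
  also have "\<dots> \<le> K" by (rule Limsup_bounded) (use K in \<open>auto simp: eventually_sequentially\<close>)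
  finally show ?thesis .
qed

lemma square_diff_le: "(a - b)\<^sup>2 \<le> 2 * (a - c)\<^sup>2 + 2 * (b - c)\<^sup>2" for a b c :: real
proof -
  have "2 * (a - c)\<^sup>2 + 2 * (b - c)\<^sup>2 - (a - b)\<^sup>2 = (a + b - 2 * c)\<^sup>2"
    by (simp add: power2_eq_square algebra_simps)
  then show ?thesis using zero_le_power2[of "a + b - 2 * c"] by linarith
qed

lemma nn_integral_square_diff_le:
  fixes f g h :: "'x \<Rightarrow> real"
  assumes [measurable]: "f \<in> borel_measurable Q" "g \<in> borel_measurable Q" "h \<in> borel_measurable Q"
  shows "(\<integral>\<^sup>+x. ennreal ((f x - g x)\<^sup>2) \<partial>Q)
    \<le> 2 * (\<integral>\<^sup>+x. ennreal ((f x - h x)\<^sup>2) \<partial>Q) + 2 * (\<integral>\<^sup>+x. ennreal ((g x - h x)\<^sup>2) \<partial>Q)"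
proof -
  have e: "ennreal (2 * a + 2 * b) = 2 * ennreal a + 2 * ennreal b" if "0 \<le> a" "0 \<le> b" for a b
    using that by (simp add: ennreal_plus ennreal_mult)
  have "(\<integral>\<^sup>+x. ennreal ((f x - g x)\<^sup>2) \<partial>Q) \<le> (\<integral>\<^sup>+x. 2 * ennreal ((f x - h x)\<^sup>2) + 2 * ennreal ((g x - h x)\<^sup>2) \<partial>Q)"
  proof (rule nn_integral_mono)
    fix x
    have "ennreal ((f x - g x)\<^sup>2) \<le> ennreal (2 * (f x - h x)\<^sup>2 + 2 * (g x - h x)\<^sup>2)"
      by (intro ennreal_leI square_diff_le)
    also have "\<dots> = 2 * ennreal ((f x - h x)\<^sup>2) + 2 * ennreal ((g x - h x)\<^sup>2)" by (rule e) auto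
    finally show "ennreal ((f x - g x)\<^sup>2) \<le> 2 * ennreal ((f x - h x)\<^sup>2) + 2 * ennreal ((g x - h x)\<^sup>2)" .
  qed
  also have "\<dots> = 2 * (\<integral>\<^sup>+x. ennreal ((f x - h x)\<^sup>2) \<partial>Q) + 2 * (\<integral>\<^sup>+x. ennreal ((g x - h x)\<^sup>2) \<partial>Q)"
    by (simp add: nn_integral_add nn_integral_cmult)
  finally show ?thesis .
qed

abbreviation (in filtered_prob) time_prob :: "real \<Rightarrow> real \<Rightarrow> (real \<times> 'a) measure" where
  "time_prob s t \<equiv> restrict_space lborel {s..t} \<Otimes>\<^sub>M M"

lemma sigma_finite_restrict_lborel: "sigma_finite_measure (restrict_space lborel {s..t :: real})"
proof -
  have "finite_measure (restrict_space lborel {s..t})"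
    by (rule finite_measureI) (simp add: emeasure_restrict_space space_restrict_space emeasure_lborel_Icc_eq)
  then show ?thesis by (simp add: finite_measure_def)
qed

context filtered_prob
begin

lemma pair_sigma_finite_time_prob: "pair_sigma_finite (restrict_space lborel {s..t :: real}) M"
  unfolding pair_sigma_finite_def using sigma_finite_restrict_lborel sigma_finite_measure_axioms by auto

lemma elementary_measurable:
  "elementary a b \<zeta> \<Longrightarrow> \<zeta> \<in> borel_measurable M"
  using measurable_F[of a \<zeta>] by (auto simp: elementary_def)

lemma elementary_process_measurable:
  assumes I: "finite I" and z: "\<And>i. i \<in> I \<Longrightarrow> \<zeta> i \<in> borel_measurable M"
  shows "(\<lambda>(u, \<omega>). \<Sum>i\<in>I. \<zeta> i \<omega> * indicator {a i<..b i} u :: real) \<in> borel_measurable (time_prob s t)"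
proof -
  have "(\<lambda>x. \<Sum>i\<in>I. \<zeta> i (snd x) * indicator {a i<..b i} (fst x) :: real) \<in> borel_measurable (time_prob s t)"
  proof (intro borel_measurable_sum borel_measurable_times)
    fix i assume i: "i \<in> I"
    show "(\<lambda>x. \<zeta> i (snd x)) \<in> borel_measurable (time_prob s t)"
      by (rule measurable_compose[OF measurable_snd z[OF i]])
    have "(indicator {a i<..b i} :: real \<Rightarrow> real) \<in> borel_measurable (restrict_space lborel {s..t})"
      by (rule measurable_restrict_space1) simp
    from measurable_compose[OF measurable_fst this]
    show "(\<lambda>x. indicator {a i<..b i} (fst x) :: real) \<in> borel_measurable (time_prob s t)" .
  qed
  then show ?thesis by (simp add: case_prod_beta)
qed

text \<open>
  Both sides are the same double sum of \<open>E[\<zeta>\<^sub>i \<zeta>\<^sub>j]\<close> times the length of the common part of the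
  intervals.
\<close>

lemma ito_isometry_product:
  assumes B: "scalar_bm B" and I: "finite I" and e: "\<And>i. i \<in> I \<Longrightarrow> elementary (a i) (b i) (\<zeta> i)"
    and st: "\<And>i. i \<in> I \<Longrightarrow> s \<le> a i \<and> b i \<le> t"
  shows "(\<integral>\<^sup>+(u, \<omega>). ennreal ((\<Sum>i\<in>I. \<zeta> i \<omega> * indicator {a i<..b i} u)\<^sup>2) \<partial>time_prob s t)
    = (\<integral>\<^sup>+\<omega>. ennreal ((\<Sum>i\<in>I. \<zeta> i \<omega> * (B (b i) \<omega> - B (a i) \<omega>))\<^sup>2) \<partial>M)"
proof -
  interpret pair_sigma_finite "restrict_space lborel {s..t}" M by (rule pair_sigma_finite_time_prob)
  let ?H = "\<lambda>u \<omega>. \<Sum>i\<in>I. \<zeta> i \<omega> * indicator {a i<..b i} u"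
  let ?L = "\<lambda>i j. measure lborel ({a i<..b i} \<inter> {a j<..b j})"
  let ?D = "\<lambda>\<omega>. \<Sum>i\<in>I. \<Sum>j\<in>I. \<zeta> i \<omega> * \<zeta> j \<omega> * ?L i j"
  have zm: "\<zeta> i \<in> borel_measurable M" if "i \<in> I" for i using elementary_measurable[OF e[OF that]] .
  have Hm: "(\<lambda>(u, \<omega>). ?H u \<omega>) \<in> borel_measurable (time_prob s t)"
    by (rule elementary_process_measurable[OF I zm])
  have "(\<lambda>x. ennreal ((case x of (u, \<omega>) \<Rightarrow> ?H u \<omega>)\<^sup>2)) \<in> borel_measurable (time_prob s t)"
    using Hm by measurable
  then have Hm2: "(\<lambda>(u, \<omega>). ennreal ((?H u \<omega>)\<^sup>2)) \<in> borel_measurable (time_prob s t)"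
    by (simp add: case_prod_beta)
  have inner: "(\<integral>\<^sup>+u. ennreal ((?H u \<omega>)\<^sup>2) \<partial>restrict_space lborel {s..t}) = ennreal (?D \<omega>) \<and> 0 \<le> ?D \<omega>" for \<omega>
  proof -
    have H0: "(?H u \<omega>)\<^sup>2 = 0" if "u \<notin> {s..t}" for u
    proof -
      have "?H u \<omega> = 0" by (rule sum.neutral) (use st that in \<open>fastforce simp: indicator_def\<close>)
      then show ?thesis by simp
    qed
    have "(\<integral>\<^sup>+u. ennreal ((?H u \<omega>)\<^sup>2) \<partial>restrict_space lborel {s..t})
        = (\<integral>\<^sup>+u. ennreal ((?H u \<omega>)\<^sup>2) * indicator {s..t} u \<partial>lborel)"
      by (rule nn_integral_restrict_space) simp
    also have "\<dots> = (\<integral>\<^sup>+u. ennreal ((?H u \<omega>)\<^sup>2) \<partial>lborel)"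
      by (rule nn_integral_cong) (use H0 in \<open>auto simp: indicator_def\<close>)
    finally have 1: "(\<integral>\<^sup>+u. ennreal ((?H u \<omega>)\<^sup>2) \<partial>restrict_space lborel {s..t}) = (\<integral>\<^sup>+u. ennreal ((?H u \<omega>)\<^sup>2) \<partial>lborel)" .
    let ?f = "\<lambda>u. \<Sum>i\<in>I. \<Sum>j\<in>I. \<zeta> i \<omega> * \<zeta> j \<omega> * indicator ({a i<..b i} \<inter> {a j<..b j}) u"
    have sq: "(?H u \<omega>)\<^sup>2 = ?f u" for u
      by (simp only: power2_eq_square sum_product indicator_inter_arith mult_ac)
    have "(\<integral>\<^sup>+u. ennreal ((?H u \<omega>)\<^sup>2) \<partial>restrict_space lborel {s..t}) = (\<integral>\<^sup>+u. ennreal (?f u) \<partial>lborel)"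
      using 1 unfolding sq .
    moreover have fb: "has_bochner_integral lborel ?f (?D \<omega>)"
    proof (intro has_bochner_integral_sum has_bochner_integral_mult_right)
      fix i j
      show "has_bochner_integral lborel (indicator ({a i<..b i} \<inter> {a j<..b j})) (?L i j)"
      proof (rule has_bochner_integral_real_indicator)
        show "emeasure lborel ({a i<..b i} \<inter> {a j<..b j}) < \<infinity>"
          by (rule emeasure_bounded_finite, rule bounded_subset[of "{a i..b i}"]) auto
      qed simp
    qed
    moreover have f0: "0 \<le> ?f u" for u
      unfolding sq[symmetric] by simp
    moreover have fi: "integrable lborel ?f" "integral\<^sup>L lborel ?f = ?D \<omega>"
      using fb unfolding has_bochner_integral_iff by blast+
    moreover have "(\<integral>\<^sup>+u. ennreal (?f u) \<partial>lborel) = ennreal (?D \<omega>)"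
      unfolding fi(2)[symmetric] by (rule nn_integral_eq_integral[OF fi(1)]) (rule AE_I2, rule f0)
    moreover have "0 \<le> ?D \<omega>"
      unfolding fi(2)[symmetric] by (rule integral_nonneg_AE) (rule AE_I2, rule f0)
    ultimately show ?thesis by presburger
  qed
  have zint: "integrable M (\<lambda>\<omega>. \<zeta> i \<omega> * \<zeta> j \<omega>)" if "i \<in> I" "j \<in> I" for i j
    using e[OF that(1)] e[OF that(2)] zm that by (intro integrable_mult_of_squares) (auto simp: elementary_def)
  have Dint: "integrable M ?D" using zint by (intro Bochner_Integration.integrable_sum) auto
  have ED: "expectation ?D = (\<Sum>i\<in>I. \<Sum>j\<in>I. expectation (\<lambda>\<omega>. \<zeta> i \<omega> * \<zeta> j \<omega>) * ?L i j)"
  proof -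
    have "expectation ?D = (\<Sum>i\<in>I. expectation (\<lambda>\<omega>. \<Sum>j\<in>I. \<zeta> i \<omega> * \<zeta> j \<omega> * ?L i j))"
      using zint by (intro Bochner_Integration.integral_sum Bochner_Integration.integrable_sum integrable_mult_left) auto
    also have "\<dots> = (\<Sum>i\<in>I. \<Sum>j\<in>I. expectation (\<lambda>\<omega>. \<zeta> i \<omega> * \<zeta> j \<omega> * ?L i j))"
      using zint by (intro sum.cong refl Bochner_Integration.integral_sum integrable_mult_left) auto
    also have "\<dots> = (\<Sum>i\<in>I. \<Sum>j\<in>I. expectation (\<lambda>\<omega>. \<zeta> i \<omega> * \<zeta> j \<omega>) * ?L i j)"
      using zint by (intro sum.cong refl integral_mult_left) auto
    finally show ?thesis .
  qed
  have "(\<integral>\<^sup>+(u, \<omega>). ennreal ((?H u \<omega>)\<^sup>2) \<partial>time_prob s t)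
      = (\<integral>\<^sup>+\<omega>. (\<integral>\<^sup>+u. ennreal ((?H u \<omega>)\<^sup>2) \<partial>restrict_space lborel {s..t}) \<partial>M)"
    using nn_integral_snd[OF Hm2] by simp
  also have "\<dots> = (\<integral>\<^sup>+\<omega>. ennreal (?D \<omega>) \<partial>M)" using inner by (intro nn_integral_cong) blast
  also have "\<dots> = ennreal (expectation ?D)" using inner by (intro nn_integral_eq_integral[OF Dint]) auto
  also have "expectation ?D = expectation (\<lambda>\<omega>. (\<Sum>i\<in>I. \<zeta> i \<omega> * (B (b i) \<omega> - B (a i) \<omega>))\<^sup>2)"
    unfolding ED using ito_isometry_elementary(2)[OF B I e] by (rule sym)
  also have "ennreal \<dots> = (\<integral>\<^sup>+\<omega>. ennreal ((\<Sum>i\<in>I. \<zeta> i \<omega> * (B (b i) \<omega> - B (a i) \<omega>))\<^sup>2) \<partial>M)"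
    using ito_isometry_elementary(1)[OF B I e] by (intro nn_integral_eq_integral[symmetric]) auto
  finally show ?thesis .
qed

lemma simple_integrand_grid:
  assumes "simple_integrand M F s t N \<tau> \<xi>" "k \<le> N"
  shows "s \<le> \<tau> k" "\<tau> k \<le> t"
proof -
  have m: "\<tau> i \<le> \<tau> (Suc i)" if "i < N" for i using assms(1) that by (auto simp: simple_integrand_def)
  have "\<tau> 0 \<le> \<tau> k" using assms(2)
  proof (induction k)
    case (Suc k) then show ?case using m[of k] by simp
  qed simp
  moreover have "\<tau> k \<le> \<tau> N" using assms(2)
  proof (induction "N - k" arbitrary: k)
    case 0 then show ?case by simp
  next
    case (Suc d)
    then have "\<tau> (Suc k) \<le> \<tau> N" by simp
    moreover have "k < N" using Suc.hyps(2) by simp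
    ultimately show ?case using m[of k] by linarith
  qed
  ultimately show "s \<le> \<tau> k" "\<tau> k \<le> t" using assms(1) by (auto simp: simple_integrand_def)
qed

lemma simple_integrand_elementary:
  assumes si: "simple_integrand M F s t N \<tau> \<xi>" and st: "0 \<le> s" "t \<le> T" and k: "k < N"
  shows "elementary (\<tau> k) (\<tau> (Suc k)) (\<xi> k)"
proof -
  have r: "0 \<le> \<tau> k" "\<tau> k \<le> \<tau> (Suc k)" "\<tau> (Suc k) \<le> T"
    using simple_integrand_grid[OF si, of k] simple_integrand_grid[OF si, of "Suc k"] st k si
    by (auto simp: simple_integrand_def)
  have xi: "\<xi> k \<in> borel_measurable (F (\<tau> k))" using si k by (auto simp: simple_integrand_def)
  obtain C where C: "\<And>\<omega>. \<omega> \<in> space M \<Longrightarrow> \<bar>\<xi> k \<omega>\<bar> \<le> C"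
    using si k unfolding simple_integrand_def by blast
  have [measurable]: "\<xi> k \<in> borel_measurable M" using measurable_F[OF _ _ xi] r by simp
  have "integrable M (\<lambda>\<omega>. (\<xi> k \<omega>)\<^sup>2)"
  proof (rule integrable_const_bound)
    show "AE \<omega> in M. norm ((\<xi> k \<omega>)\<^sup>2) \<le> C\<^sup>2"
    proof (rule AE_I2)
      fix \<omega> assume "\<omega> \<in> space M"
      then have "\<bar>\<xi> k \<omega>\<bar>\<^sup>2 \<le> C\<^sup>2" using C by (intro power_mono) auto
      then show "norm ((\<xi> k \<omega>)\<^sup>2) \<le> C\<^sup>2" by simp
    qed
  qed measurable
  then show ?thesis using r xi by (simp add: elementary_def)
qed

text \<open>
  The two simple processes form one elementary family over the disjoint union of their index sets.
\<close>

lemma simple_isometry_diff: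
  assumes B: "scalar_bm B" and st: "0 \<le> s" "t \<le> T"
    and e1: "\<And>k. k < N \<Longrightarrow> elementary (\<tau> k) (\<tau> (Suc k)) (\<xi> k) \<and> s \<le> \<tau> k \<and> \<tau> (Suc k) \<le> t"
    and e2: "\<And>k. k < N' \<Longrightarrow> elementary (\<tau>' k) (\<tau>' (Suc k)) (\<xi>' k) \<and> s \<le> \<tau>' k \<and> \<tau>' (Suc k) \<le> t"
  shows "(\<integral>\<^sup>+(u, \<omega>). ennreal ((simple_process N \<tau> \<xi> u \<omega> - simple_process N' \<tau>' \<xi>' u \<omega>)\<^sup>2) \<partial>time_prob s t)
    = (\<integral>\<^sup>+\<omega>. ennreal ((simple_integral N \<tau> \<xi> B \<omega> - simple_integral N' \<tau>' \<xi>' B \<omega>)\<^sup>2) \<partial>M)"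
proof -
  let ?I = "{..<N} <+> {..<N'}"
  \<comment> \<open>The second family enters with a minus sign.\<close>
  define a where "a = case_sum \<tau> \<tau>'"
  define b where "b = case_sum (\<lambda>k. \<tau> (Suc k)) (\<lambda>k. \<tau>' (Suc k))"
  define \<zeta> where "\<zeta> = case_sum \<xi> (\<lambda>k \<omega>. - \<xi>' k \<omega>)"
  have sm: "(\<Sum>i\<in>?I. g i) = (\<Sum>k<N. g (Inl k)) + (\<Sum>k<N'. g (Inr k))" for g :: "nat + nat \<Rightarrow> real"
    by (simp add: sum.Plus comp_def)
  have "(\<integral>\<^sup>+(u, \<omega>). ennreal ((\<Sum>i\<in>?I. \<zeta> i \<omega> * indicator {a i<..b i} u)\<^sup>2) \<partial>time_prob s t)
    = (\<integral>\<^sup>+\<omega>. ennreal ((\<Sum>i\<in>?I. \<zeta> i \<omega> * (B (b i) \<omega> - B (a i) \<omega>))\<^sup>2) \<partial>M)"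
  proof (rule ito_isometry_product[OF B])
    fix i assume i: "i \<in> ?I"
    show "elementary (a i) (b i) (\<zeta> i)"
    proof (cases i)
      case (Inl k) then show ?thesis using i e1[of k] by (auto simp: a_def b_def \<zeta>_def)
    next
      case (Inr k) then show ?thesis using i e2[of k] by (auto simp: a_def b_def \<zeta>_def elementary_def)
    qed
    show "s \<le> a i \<and> b i \<le> t"
      using i e1 e2 by (cases i) (auto simp: a_def b_def)
  qed simp
  then show ?thesis
    unfolding sm by (simp add: a_def b_def \<zeta>_def simple_process_def simple_integral_def sum_negf)
qed

text \<open>
  Two approximating sequences of the same integrand are asymptotically equal in \<open>L\<^sup>2(du \<otimes> P)\<close>, and the
  isometry carries this over to their integrals.
\<close>

lemma ito_integral_unique:
  assumes B: "scalar_bm B" and st: "0 \<le> s" "s \<le> t" "t \<le> T"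
    and Z1: "has_ito_integral M F s t H B Z1" and Z2: "has_ito_integral M F s t H B Z2"
  shows "AE \<omega> in M. Z1 \<omega> = Z2 \<omega>"
proof -
  let ?P = "completion (time_prob s t)"
  obtain N1 \<tau>1 \<xi>1 where s1: "\<And>n. simple_integrand M F s t (N1 n) (\<tau>1 n) (\<xi>1 n)"
    and p1: "(\<lambda>n. \<integral>\<^sup>+(u, \<omega>). ennreal ((simple_process (N1 n) (\<tau>1 n) (\<xi>1 n) u \<omega> - H u \<omega>)\<^sup>2) \<partial>?P) \<longlonglongrightarrow> 0"
    and i1: "(\<lambda>n. \<integral>\<^sup>+\<omega>. ennreal ((simple_integral (N1 n) (\<tau>1 n) (\<xi>1 n) B \<omega> - Z1 \<omega>)\<^sup>2) \<partial>M) \<longlonglongrightarrow> 0"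
    using Z1 unfolding has_ito_integral_def by blast
  obtain N2 \<tau>2 \<xi>2 where s2: "\<And>n. simple_integrand M F s t (N2 n) (\<tau>2 n) (\<xi>2 n)"
    and p2: "(\<lambda>n. \<integral>\<^sup>+(u, \<omega>). ennreal ((simple_process (N2 n) (\<tau>2 n) (\<xi>2 n) u \<omega> - H u \<omega>)\<^sup>2) \<partial>?P) \<longlonglongrightarrow> 0"
    and i2: "(\<lambda>n. \<integral>\<^sup>+\<omega>. ennreal ((simple_integral (N2 n) (\<tau>2 n) (\<xi>2 n) B \<omega> - Z2 \<omega>)\<^sup>2) \<partial>M) \<longlonglongrightarrow> 0"
    using Z2 unfolding has_ito_integral_def by blast
  have Zm[measurable]: "Z1 \<in> borel_measurable M" "Z2 \<in> borel_measurable M"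
    and Hm: "(\<lambda>(u, \<omega>). H u \<omega>) \<in> borel_measurable ?P"
    using Z1 Z2 by (auto simp: has_ito_integral_def)
  have e: "elementary (\<tau> k) (\<tau> (Suc k)) (\<xi> k) \<and> s \<le> \<tau> k \<and> \<tau> (Suc k) \<le> t"
    if "simple_integrand M F s t N \<tau> \<xi>" "k < N" for N \<tau> \<xi> k
    using simple_integrand_elementary[OF that(1) st(1,3) that(2)]
      simple_integrand_grid[OF that(1), of k] simple_integrand_grid[OF that(1), of "Suc k"] that(2) by auto
  have pm: "(\<lambda>(u, \<omega>). simple_process N \<tau> \<xi> u \<omega>) \<in> borel_measurable ?P"
    if "simple_integrand M F s t N \<tau> \<xi>" for N \<tau> \<xi>
    unfolding simple_process_def
    by (intro measurable_completion elementary_process_measurable)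
      (use e[OF that] elementary_measurable in auto)
  have im: "simple_integral N \<tau> \<xi> B \<in> borel_measurable M" if "simple_integrand M F s t N \<tau> \<xi>" for N \<tau> \<xi>
  proof -
    have "(\<lambda>\<omega>. \<Sum>k<N. \<xi> k \<omega> * (B (\<tau> (Suc k)) \<omega> - B (\<tau> k) \<omega>)) \<in> borel_measurable M"
      using e[OF that] elementary_square(3)[OF B] by (intro borel_measurable_sum) auto
    then show ?thesis by (simp add: simple_integral_def[abs_def])
  qed
  let ?S1 = "\<lambda>n. simple_integral (N1 n) (\<tau>1 n) (\<xi>1 n) B" and ?S2 = "\<lambda>n. simple_integral (N2 n) (\<tau>2 n) (\<xi>2 n) B"
  let ?p1 = "\<lambda>n. \<integral>\<^sup>+(u, \<omega>). ennreal ((simple_process (N1 n) (\<tau>1 n) (\<xi>1 n) u \<omega> - H u \<omega>)\<^sup>2) \<partial>?P"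
  let ?p2 = "\<lambda>n. \<integral>\<^sup>+(u, \<omega>). ennreal ((simple_process (N2 n) (\<tau>2 n) (\<xi>2 n) u \<omega> - H u \<omega>)\<^sup>2) \<partial>?P"
  define D where "D n = (\<integral>\<^sup>+\<omega>. ennreal ((?S1 n \<omega> - ?S2 n \<omega>)\<^sup>2) \<partial>M)" for n
  have Dle: "D n \<le> 2 * ?p1 n + 2 * ?p2 n" for n
  proof -
    have "D n = (\<integral>\<^sup>+(u, \<omega>). ennreal ((simple_process (N1 n) (\<tau>1 n) (\<xi>1 n) u \<omega> - simple_process (N2 n) (\<tau>2 n) (\<xi>2 n) u \<omega>)\<^sup>2) \<partial>?P)"
      unfolding D_def nn_integral_completion
      by (rule simple_isometry_diff[where N = "N1 n" and \<tau> = "\<tau>1 n" and \<xi> = "\<xi>1 n" and N' = "N2 n"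
          and \<tau>' = "\<tau>2 n" and \<xi>' = "\<xi>2 n", OF B st(1,3) e[OF s1] e[OF s2], symmetric])
    also have "\<dots> \<le> 2 * ?p1 n + 2 * ?p2 n"
      using nn_integral_square_diff_le[OF pm[OF s1] pm[OF s2] Hm, of n n] unfolding case_prod_unfold .
    finally show ?thesis .
  qed
  have D0: "D \<longlonglongrightarrow> 0"
  proof (rule tendsto_sandwich[OF always_eventually always_eventually tendsto_const])
    show "\<forall>n. 0 \<le> D n" by simp
    show "\<forall>n. D n \<le> 2 * ?p1 n + 2 * ?p2 n" using Dle by blast
    show "(\<lambda>n. 2 * ?p1 n + 2 * ?p2 n) \<longlonglongrightarrow> 0"
      using tendsto_add[OF ennreal_tendsto_cmult[OF _ p1, of 2] ennreal_tendsto_cmult[OF _ p2, of 2]]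
      by (simp add: less_top[symmetric])
  qed
  define d1 where "d1 n = (\<integral>\<^sup>+\<omega>. ennreal ((?S1 n \<omega> - Z1 \<omega>)\<^sup>2) \<partial>M)" for n
  define d2 where "d2 n = (\<integral>\<^sup>+\<omega>. ennreal ((?S2 n \<omega> - Z2 \<omega>)\<^sup>2) \<partial>M)" for n
  have d: "d1 \<longlonglongrightarrow> 0" "d2 \<longlonglongrightarrow> 0" using i1 i2 by (simp_all add: d1_def[abs_def] d2_def[abs_def])
  have le: "(\<integral>\<^sup>+\<omega>. ennreal ((Z1 \<omega> - Z2 \<omega>)\<^sup>2) \<partial>M) \<le> 2 * d1 n + 2 * (2 * d2 n + 2 * D n)" for n
  proof -
    have c1: "(\<integral>\<^sup>+\<omega>. ennreal ((Z1 \<omega> - ?S1 n \<omega>)\<^sup>2) \<partial>M) = d1 n"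
      unfolding d1_def by (rule nn_integral_cong) (simp only: power2_commute)
    have c2: "(\<integral>\<^sup>+\<omega>. ennreal ((Z2 \<omega> - ?S2 n \<omega>)\<^sup>2) \<partial>M) = d2 n"
      unfolding d2_def by (rule nn_integral_cong) (simp only: power2_commute)
    have a1: "(\<integral>\<^sup>+\<omega>. ennreal ((Z1 \<omega> - Z2 \<omega>)\<^sup>2) \<partial>M)
      \<le> 2 * d1 n + 2 * (\<integral>\<^sup>+\<omega>. ennreal ((Z2 \<omega> - ?S1 n \<omega>)\<^sup>2) \<partial>M)"
      using nn_integral_square_diff_le[OF Zm im[OF s1], of n] unfolding c1 .
    have a2: "(\<integral>\<^sup>+\<omega>. ennreal ((Z2 \<omega> - ?S1 n \<omega>)\<^sup>2) \<partial>M) \<le> 2 * d2 n + 2 * D n"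
      using nn_integral_square_diff_le[OF Zm(2) im[OF s1] im[OF s2], of n n] unfolding c2 D_def .
    show ?thesis
      by (rule order_trans[OF a1 add_left_mono[OF mult_left_mono[OF a2]]]) simp
  qed
  have "(\<lambda>n. 2 * d1 n + 2 * (2 * d2 n + 2 * D n)) \<longlonglongrightarrow> 0"
    using tendsto_add[OF ennreal_tendsto_cmult[OF _ d(1), of 2] ennreal_tendsto_cmult[OF _
        tendsto_add[OF ennreal_tendsto_cmult[OF _ d(2), of 2] ennreal_tendsto_cmult[OF _ D0, of 2]], of 2]]
    by (simp add: less_top[symmetric])
  then have "(\<integral>\<^sup>+\<omega>. ennreal ((Z1 \<omega> - Z2 \<omega>)\<^sup>2) \<partial>M) \<le> 0"
    by (rule tendsto_lowerbound) (use le in auto)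
  then have "(\<integral>\<^sup>+\<omega>. ennreal ((Z1 \<omega> - Z2 \<omega>)\<^sup>2) \<partial>M) = 0" by simp
  then have "AE \<omega> in M. ennreal ((Z1 \<omega> - Z2 \<omega>)\<^sup>2) = 0" by (subst (asm) nn_integral_0_iff_AE) auto
  then show ?thesis by eventually_elim simp
qed

end

section \<open>The It\^o integral as a limit of dyadic Riemann sums\<close>

text \<open>
  Clipping the dyadic grid to \<open>[s, t]\<close> gives grid points of \<open>[s, t]\<close>, with degenerate cells outside.
\<close>

definition clip :: "real \<Rightarrow> real \<Rightarrow> real \<Rightarrow> real" where
  "clip s t u = max s (min t u)"

text \<open>
  The candidate for \<open>\<integral>\<^sub>s\<^sup>t (x\<^sub>u - x\<^sub>s) dy\<^sub>u\<close> is a simple integral on the clipped grid. In a cell that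
  straddles \<open>s\<close> the coefficient is \<open>x\<close> at the dyadic point before \<open>s\<close>, not at \<open>s\<close> itself; it is still
  known at the left end point of the clipped cell.
\<close>

lemma riemann_increment_eq_clipped_sum:
  assumes T: "0 < T" and st: "0 \<le> s" "s \<le> t" "t \<le> T"
  shows "(\<Sum>k<2 ^ n. (x (min (dyadic T n k) t) - x s)
      * (y (clip s t (dyadic T n (Suc k))) - y (clip s t (dyadic T n k))))
    = dyadic_riemann T x y n t - dyadic_riemann T x y n s - x s * (y t - y s)"
proof -
  let ?c = "\<lambda>k. clip s t (dyadic T n k)"
  have f: "y (min u t) - y (min u s) = y (clip s t u) - y s" for u
    using st by (auto simp: clip_def min_def max_def)
  have xk: "x (min (dyadic T n k) t) * (y (?c (Suc k)) - y (?c k)) = x (dyadic T n k) * (y (?c (Suc k)) - y (?c k))" for k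
  proof (cases "dyadic T n k \<le> t")
    case False
    moreover have "dyadic T n k \<le> dyadic T n (Suc k)" using T by (simp add: dyadic_mono)
    ultimately have "?c (Suc k) = t" "?c k = t" using st by (auto simp: clip_def)
    then show ?thesis by simp
  qed (simp add: min_absorb1)
  have "dyadic_riemann T x y n t - dyadic_riemann T x y n s
      = (\<Sum>k<2 ^ n. x (dyadic T n k) * (y (?c (Suc k)) - y (?c k)))"
    unfolding dyadic_riemann_def sum_subtractf[symmetric]
  proof (rule sum.cong[OF refl])
    fix k
    show "x (dyadic T n k) * (y (min (dyadic T n (Suc k)) t) - y (min (dyadic T n k) t))
        - x (dyadic T n k) * (y (min (dyadic T n (Suc k)) s) - y (min (dyadic T n k) s))
        = x (dyadic T n k) * (y (?c (Suc k)) - y (?c k))"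
      using f[of "dyadic T n (Suc k)"] f[of "dyadic T n k"]
      by (simp add: right_diff_distrib[symmetric])
  qed
  moreover have "(\<Sum>k<2 ^ n. y (?c (Suc k)) - y (?c k)) = y t - y s"
    using sum_lessThan_telescope[of "\<lambda>k. y (?c k)" "2 ^ n"] st by (simp add: clip_def)
  ultimately show ?thesis
    by (simp add: left_diff_distrib xk sum_subtractf sum_distrib_left[symmetric])
qed

text \<open>
  At each time the step process shows the path at one grid point \<open>v\<close> nearby. The point does not depend
  on the path, which allows taking expectations for fixed \<open>u\<close>.
\<close>

lemma step_process_value:
  assumes T: "0 < T" and st: "0 \<le> s" "s \<le> t" "t \<le> T" and u: "u \<in> {s..t}"
  shows "\<exists>v\<in>{0..T}. \<bar>u - v\<bar> \<le> T / 2 ^ n \<and>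
    (\<forall>x. (\<Sum>k<2 ^ n. (x (min (dyadic T n k) t) - x s)
      * indicator {clip s t (dyadic T n k)<..clip s t (dyadic T n (Suc k))} u) = (x v - x s :: real))"
proof (cases "u = s")
  case True
  have "(\<Sum>k<2 ^ n. (x (min (dyadic T n k) t) - x s)
      * indicator {clip s t (dyadic T n k)<..clip s t (dyadic T n (Suc k))} u) = x s - x s" for x :: "real \<Rightarrow> real"
    by (subst sum.neutral) (auto simp: True clip_def indicator_def)
  then show ?thesis using True st T by (intro bexI[of _ s]) auto
next
  case False
  then have u': "s < u" "u \<le> t" using u by auto
  \<comment> \<open>The cells of a simple process are closed on the right, so the cell of \<open>u\<close> is the one with \<open>t\<^sub>k < u \<le> t\<^sub>k\<^sub>+\<^sub>1\<close>.\<close>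
  define k where "k = nat (\<lceil>u * 2 ^ n / T\<rceil> - 1)"
  have "0 < u * 2 ^ n / T" using u' st T by simp
  then have "real k = of_int \<lceil>u * 2 ^ n / T\<rceil> - 1" unfolding k_def by simp
  then have *: "real k < u * 2 ^ n / T" "u * 2 ^ n / T \<le> real k + 1" by linarith+
  then have k: "dyadic T n k < u" "u \<le> dyadic T n (Suc k)"
    using T by (simp_all add: dyadic_def field_simps)
  then have "dyadic T n k < dyadic T n (2 ^ n)" using u' st by simp
  then have kn: "k < 2 ^ n" using T by (simp add: dyadic_strict_mono del: dyadic_end)
  have ind: "indicator {clip s t (dyadic T n i)<..clip s t (dyadic T n (Suc i))} u = (if i = k then 1 else 0 :: real)" for i
  proof (cases "i = k")
    case True
    then show ?thesis using k u' by (auto simp: clip_def)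
  next
    case False
    then consider "Suc i \<le> k" | "Suc k \<le> i" by linarith
    then show ?thesis
    proof cases
      case 1
      then have "dyadic T n (Suc i) \<le> dyadic T n k" using T by (simp add: dyadic_mono)
      then show ?thesis using k u' False by (auto simp: clip_def indicator_def)
    next
      case 2
      then have "dyadic T n (Suc k) \<le> dyadic T n i" using T by (simp add: dyadic_mono)
      then show ?thesis using k u' False by (auto simp: clip_def indicator_def)
    qed
  qed
  have "dyadic T n (Suc k) = dyadic T n k + T / 2 ^ n" by (simp add: dyadic_def field_simps)
  then have "\<bar>u - dyadic T n k\<bar> \<le> T / 2 ^ n" using k by simp
  moreover have "min (dyadic T n k) t = dyadic T n k" using k u' by simp
  moreover have "(\<Sum>i<2 ^ n. (x (min (dyadic T n i) t) - x s) * (if i = k then 1 else 0))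
      = x (min (dyadic T n k) t) - x s" for x :: "real \<Rightarrow> real"
  proof -
    have "(\<Sum>i<2 ^ n. (x (min (dyadic T n i) t) - x s) * (if i = k then 1 else 0))
      = (\<Sum>i<2 ^ n. if i = k then x (min (dyadic T n i) t) - x s else 0)"
      by (intro sum.cong) auto
    then show ?thesis using kn by simp
  qed
  ultimately show ?thesis
    unfolding ind using kn dyadic_in_range[OF T, of k n]
    by (intro bexI[of _ "dyadic T n k"]) auto
qed

text \<open>
  Simple integrands must have bounded coefficients; increments of Brownian motion are cut off at a
  level that grows with the grid.
\<close>

definition truncation :: "real \<Rightarrow> real \<Rightarrow> real" where
  "truncation c z = max (- c) (min c z)"

lemma abs_truncation_le: "0 \<le> c \<Longrightarrow> \<bar>truncation c z\<bar> \<le> c"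
  by (auto simp: truncation_def)

lemma truncation_error:
  assumes c: "0 < c"
  shows "(z - truncation c z)\<^sup>2 \<le> z ^ 4 / c\<^sup>2"
proof (cases "\<bar>z\<bar> \<le> c")
  case True
  then have "truncation c z = z" by (auto simp: truncation_def)
  then show ?thesis by simp
next
  case False
  have "\<bar>z - truncation c z\<bar> \<le> \<bar>z\<bar>" using c by (auto simp: truncation_def)
  then have 1: "(z - truncation c z)\<^sup>2 \<le> z\<^sup>2" using power_mono[OF _ abs_ge_zero, of "z - truncation c z" "\<bar>z\<bar>" 2] by simp
  have "c\<^sup>2 \<le> z\<^sup>2" using False c power_mono[of c "\<bar>z\<bar>" 2] by simp
  then have "z\<^sup>2 * c\<^sup>2 \<le> z\<^sup>2 * z\<^sup>2" by (intro mult_left_mono) auto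
  then have "z\<^sup>2 \<le> z ^ 4 / c\<^sup>2" using c by (simp add: pos_le_divide_eq power2_eq_square power4_eq_xxxx mult_ac)
  with 1 show ?thesis by simp
qed

context filtered_prob
begin

lemma regular_moments:
  assumes Y: "regular_process p C Y" and st: "s \<in> {0..T}" "t \<in> {0..T}"
  shows "integrable M (\<lambda>\<omega>. (Y t \<omega> - Y s \<omega>)\<^sup>2)"
    and "expectation (\<lambda>\<omega>. (Y t \<omega> - Y s \<omega>)\<^sup>2) \<le> (1 + C) * \<bar>t - s\<bar> powr (2 / p)"
    and "integrable M (\<lambda>\<omega>. (Y t \<omega> - Y s \<omega>) ^ 4)"
    and "expectation (\<lambda>\<omega>. (Y t \<omega> - Y s \<omega>) ^ 4) \<le> C * \<bar>t - s\<bar> powr (4 / p)"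
proof -
  have 4: "integrable M (\<lambda>\<omega>. (Y b \<omega> - Y a \<omega>) ^ 4) \<and> expectation (\<lambda>\<omega>. (Y b \<omega> - Y a \<omega>) ^ 4) \<le> C * (b - a) powr (4 / p)"
    if "0 \<le> a" "a \<le> b" "b \<le> T" for a b
    using Y that by (auto simp: regular_process_def)
  have sw2: "(Y t \<omega> - Y s \<omega>)\<^sup>2 = (Y s \<omega> - Y t \<omega>)\<^sup>2" for \<omega> by (rule power2_commute)
  have sw4: "(Y t \<omega> - Y s \<omega>) ^ 4 = (Y s \<omega> - Y t \<omega>) ^ 4" for \<omega>
    using power_even_abs[of 4 "Y t \<omega> - Y s \<omega>"] power_even_abs[of 4 "Y s \<omega> - Y t \<omega>"]
    by (simp add: abs_minus_commute)
  consider "s \<le> t" | "t \<le> s" by linarith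
  then have "integrable M (\<lambda>\<omega>. (Y t \<omega> - Y s \<omega>)\<^sup>2) \<and> expectation (\<lambda>\<omega>. (Y t \<omega> - Y s \<omega>)\<^sup>2) \<le> (1 + C) * \<bar>t - s\<bar> powr (2 / p)
    \<and> integrable M (\<lambda>\<omega>. (Y t \<omega> - Y s \<omega>) ^ 4) \<and> expectation (\<lambda>\<omega>. (Y t \<omega> - Y s \<omega>) ^ 4) \<le> C * \<bar>t - s\<bar> powr (4 / p)"
  proof cases
    case 1
    then show ?thesis using regular_square[OF Y, of s t] 4[of s t] st by auto
  next
    case 2
    then show ?thesis unfolding sw2 sw4 using regular_square[OF Y, of t s] 4[of t s] st by auto
  qed
  then show "integrable M (\<lambda>\<omega>. (Y t \<omega> - Y s \<omega>)\<^sup>2)"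
    "expectation (\<lambda>\<omega>. (Y t \<omega> - Y s \<omega>)\<^sup>2) \<le> (1 + C) * \<bar>t - s\<bar> powr (2 / p)"
    "integrable M (\<lambda>\<omega>. (Y t \<omega> - Y s \<omega>) ^ 4)"
    "expectation (\<lambda>\<omega>. (Y t \<omega> - Y s \<omega>) ^ 4) \<le> C * \<bar>t - s\<bar> powr (4 / p)" by auto
qed

text \<open>
  The exceptional pairs lie in the product of \<open>[s, t]\<close> with a null set of \<open>M\<close>.
\<close>

lemma AE_time_prob:
  assumes "AE \<omega> in M. \<forall>u\<in>{s..t}. P u \<omega>"
  shows "AE (u, \<omega>) in time_prob s t. P u \<omega>"
proof -
  interpret sigma_finite_measure M by (rule sigma_finite_measure_axioms)
  from assms obtain N where N: "N \<in> null_sets M" "{\<omega> \<in> space M. \<not> (\<forall>u\<in>{s..t}. P u \<omega>)} \<subseteq> N"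
    by (auto simp: eventually_ae_filter)
  have "space (restrict_space lborel {s..t}) \<times> N \<in> null_sets (time_prob s t)"
  proof (rule null_setsI)
    have "emeasure (time_prob s t) (space (restrict_space lborel {s..t}) \<times> N)
        = emeasure (restrict_space lborel {s..t}) (space (restrict_space lborel {s..t})) * emeasure M N"
      by (rule emeasure_pair_measure_Times[OF sets.top]) (use N(1) in auto)
    also have "\<dots> = 0" using null_setsD1[OF N(1)] by (simp only: mult_zero_right)
    finally show "emeasure (time_prob s t) (space (restrict_space lborel {s..t}) \<times> N) = 0" .
    show "space (restrict_space lborel {s..t}) \<times> N \<in> sets (time_prob s t)"
      by (rule pair_measureI[OF sets.top]) (use N(1) in auto)
  qed
  then show ?thesis
    by (rule AE_I') (use N(2) in \<open>auto simp: space_pair_measure space_restrict_space\<close>)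
qed

context
  fixes B Y :: "real \<Rightarrow> 'a \<Rightarrow> real" and Z :: "'a \<Rightarrow> real" and p C s t :: real
  assumes B: "scalar_bm B" and Y: "regular_process p C Y" and p: "0 < p"
    and Ycont: "AE \<omega> in M. continuous_on {0..T} (\<lambda>u. Y u \<omega>)"
    and st: "0 \<le> s" "s \<le> t" "t \<le> T"
    and Zm: "Z \<in> borel_measurable M"
    and conv: "AE \<omega> in M. (\<lambda>n. dyadic_riemann T (\<lambda>u. Y u \<omega>) (\<lambda>u. B u \<omega>) n t
        - dyadic_riemann T (\<lambda>u. Y u \<omega>) (\<lambda>u. B u \<omega>) n s - Y s \<omega> * (B t \<omega> - B s \<omega>)) \<longlonglongrightarrow> Z \<omega>"
begin

text \<open>
  \<open>Hn\<close> and \<open>Zn\<close> are the step process and the Riemann sum of level \<open>n\<close> on \<open>[s, t]\<close>; the primed variants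
  have truncated coefficients and are the simple integrands that the It\^o integral asks for.
\<close>

private definition grid :: "nat \<Rightarrow> nat \<Rightarrow> real" where
  "grid n k = clip s t (dyadic T n k)"

private definition coef :: "nat \<Rightarrow> nat \<Rightarrow> 'a \<Rightarrow> real" where
  "coef n k \<omega> = Y (min (dyadic T n k) t) \<omega> - Y s \<omega>"

private definition tcoef :: "nat \<Rightarrow> nat \<Rightarrow> 'a \<Rightarrow> real" where
  "tcoef n k \<omega> = truncation (real (Suc n)) (coef n k \<omega>)"

private abbreviation "Hn n \<equiv> simple_process (2 ^ n) (grid n) (coef n)"
private abbreviation "Zn n \<equiv> simple_integral (2 ^ n) (grid n) (coef n) B"
private abbreviation "Hn' n \<equiv> simple_process (2 ^ n) (grid n) (tcoef n)"
private abbreviation "Zn' n \<equiv> simple_integral (2 ^ n) (grid n) (tcoef n) B"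
private abbreviation "H u \<omega> \<equiv> Y u \<omega> - Y s \<omega>"

private definition mesh_error :: "nat \<Rightarrow> real" where
  "mesh_error n = (1 + C) * (2 * (T / 2 ^ n)) powr (2 / p) * T"

private definition trunc_error :: "nat \<Rightarrow> real" where
  "trunc_error n = C * T powr (4 / p) * T / (real (Suc n))\<^sup>2"

private lemma C0: "0 \<le> C" using Y by (simp add: regular_process_def)

private lemma grid_range: "s \<le> grid n k" "grid n k \<le> t" "grid n k \<le> grid n (Suc k)" "0 \<le> grid n k" "grid n k \<le> T"
proof -
  have "dyadic T n k \<le> dyadic T n (Suc k)" using T_pos by (simp add: dyadic_mono)
  then show "s \<le> grid n k" "grid n k \<le> t" "grid n k \<le> grid n (Suc k)" "0 \<le> grid n k" "grid n k \<le> T"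
    using st by (auto simp: grid_def clip_def)
qed

private lemma left_range: "k < 2 ^ n \<Longrightarrow> min (dyadic T n k) t \<in> {0..T}"
  using dyadic_in_range[OF T_pos, of k n] st by auto

private lemma coef_adapted: "k < 2 ^ n \<Longrightarrow> coef n k \<in> borel_measurable (F (grid n k))"
  unfolding coef_def[abs_def] using left_range[of k n] grid_range[of n k] st
  by (intro regular_increment_adapted[OF Y]) (auto simp: grid_def clip_def)

private lemma coef_elementary:
  assumes k: "k < 2 ^ n"
  shows "elementary (grid n k) (grid n (Suc k)) (coef n k) \<and> s \<le> grid n k \<and> grid n (Suc k) \<le> t"
  using coef_adapted[OF k] grid_range[of n k] grid_range[of n "Suc k"]
    regular_moments(1)[OF Y _ left_range[OF k], of s] st
  by (auto simp: elementary_def coef_def[abs_def])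

private lemma tcoef_adapted: "k < 2 ^ n \<Longrightarrow> tcoef n k \<in> borel_measurable (F (grid n k))"
  using coef_adapted[of k n] unfolding tcoef_def[abs_def] truncation_def by measurable

private lemma tcoef_simple: "simple_integrand M F s t (2 ^ n) (grid n) (tcoef n)"
  unfolding simple_integrand_def
proof (intro conjI allI impI)
  show "grid n 0 = s" "grid n (2 ^ n) = t" using st by (auto simp: grid_def clip_def)
  fix k :: nat assume k: "k < 2 ^ n"
  show "grid n k \<le> grid n (Suc k)" by (rule grid_range)
  show "tcoef n k \<in> borel_measurable (F (grid n k))" by (rule tcoef_adapted[OF k])
  show "\<exists>c. \<forall>\<omega>\<in>space M. \<bar>tcoef n k \<omega>\<bar> \<le> c"
    unfolding tcoef_def by (intro exI[of _ "real (Suc n)"] ballI abs_truncation_le) simp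
qed

private lemma tcoef_elementary:
  assumes k: "k < 2 ^ n"
  shows "elementary (grid n k) (grid n (Suc k)) (tcoef n k) \<and> s \<le> grid n k \<and> grid n (Suc k) \<le> t"
  using simple_integrand_elementary[OF tcoef_simple st(1,3) k] coef_elementary[OF k] by simp

private lemma process_measurable:
  assumes "\<And>k. k < N \<Longrightarrow> elementary (\<tau> k) (\<tau> (Suc k)) (\<xi> k) \<and> s \<le> \<tau> k \<and> \<tau> (Suc k) \<le> t"
  shows "(\<lambda>(u, \<omega>). simple_process N \<tau> \<xi> u \<omega>) \<in> borel_measurable (time_prob s t)"
    and "simple_integral N \<tau> \<xi> B \<in> borel_measurable M"
proof -
  show "(\<lambda>(u, \<omega>). simple_process N \<tau> \<xi> u \<omega>) \<in> borel_measurable (time_prob s t)"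
    unfolding simple_process_def
    by (intro elementary_process_measurable) (use assms elementary_measurable in auto)
  have "(\<lambda>\<omega>. \<Sum>k<N. \<xi> k \<omega> * (B (\<tau> (Suc k)) \<omega> - B (\<tau> k) \<omega>)) \<in> borel_measurable M"
    using assms elementary_square(3)[OF B] by (intro borel_measurable_sum) auto
  then show "simple_integral N \<tau> \<xi> B \<in> borel_measurable M" by (simp add: simple_integral_def[abs_def])
qed

private lemma Hn_Zn_measurable:
  "(\<lambda>(u, \<omega>). Hn n u \<omega>) \<in> borel_measurable (time_prob s t)" "Zn n \<in> borel_measurable M"
  by (rule process_measurable, rule coef_elementary, assumption)+

private lemma Hn'_Zn'_measurable:
  "(\<lambda>(u, \<omega>). Hn' n u \<omega>) \<in> borel_measurable (time_prob s t)" "Zn' n \<in> borel_measurable M"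
  by (rule process_measurable, rule tcoef_elementary, assumption)+

private lemma Hn_value:
  assumes "u \<in> {s..t}"
  obtains v where "v \<in> {0..T}" "\<bar>u - v\<bar> \<le> T / 2 ^ n" "\<And>\<omega>. Hn n u \<omega> = Y v \<omega> - Y s \<omega>"
proof -
  obtain v where v: "v \<in> {0..T}" "\<bar>u - v\<bar> \<le> T / 2 ^ n"
    and eq: "\<And>x :: real \<Rightarrow> real. (\<Sum>k<2 ^ n. (x (min (dyadic T n k) t) - x s)
      * indicator {clip s t (dyadic T n k)<..clip s t (dyadic T n (Suc k))} u) = x v - x s"
    using step_process_value[OF T_pos st assms, of n] by blast
  show ?thesis
    by (rule that[OF v]) (use eq[of "\<lambda>u. Y u \<omega>" for \<omega>] in \<open>simp add: simple_process_def coef_def grid_def\<close>)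
qed

text \<open>
  By Fubini's theorem the distance is an integral over \<open>u\<close> of second moments of \<open>Y\<^sub>v - Y\<^sub>v\<^sub>'\<close> for two grid
  points near \<open>u\<close>.
\<close>

private lemma Hn_diff:
  assumes "n \<le> m"
  shows "(\<integral>\<^sup>+(u, \<omega>). ennreal ((Hn n u \<omega> - Hn m u \<omega>)\<^sup>2) \<partial>time_prob s t) \<le> ennreal (mesh_error n)"
proof -
  interpret sigma_finite_measure M by (rule sigma_finite_measure_axioms)
  let ?K = "(1 + C) * (2 * (T / 2 ^ n)) powr (2 / p)"
  have K: "0 \<le> ?K" using C0 by simp
  have m1: "(\<lambda>(u, \<omega>). Hn n u \<omega>) \<in> borel_measurable (time_prob s t)"
    "(\<lambda>(u, \<omega>). Hn m u \<omega>) \<in> borel_measurable (time_prob s t)"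
    by (rule Hn_Zn_measurable)+
  have meas: "(\<lambda>x. ennreal (((case x of (u, \<omega>) \<Rightarrow> Hn n u \<omega>) - (case x of (u, \<omega>) \<Rightarrow> Hn m u \<omega>))\<^sup>2)) \<in> borel_measurable (time_prob s t)"
    using m1 by measurable
  have "(\<integral>\<^sup>+(u, \<omega>). ennreal ((Hn n u \<omega> - Hn m u \<omega>)\<^sup>2) \<partial>time_prob s t)
      = (\<integral>\<^sup>+u. \<integral>\<^sup>+\<omega>. ennreal ((Hn n u \<omega> - Hn m u \<omega>)\<^sup>2) \<partial>M \<partial>restrict_space lborel {s..t})"
    using nn_integral_fst[OF meas] unfolding case_prod_unfold by simp
  also have "\<dots> \<le> (\<integral>\<^sup>+u. ennreal ?K \<partial>restrict_space lborel {s..t})"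
  proof (rule nn_integral_mono)
    fix u assume "u \<in> space (restrict_space lborel {s..t})"
    then have u: "u \<in> {s..t}" by (simp add: space_restrict_space)
    obtain v where v: "v \<in> {0..T}" "\<bar>u - v\<bar> \<le> T / 2 ^ n" "\<And>\<omega>. Hn n u \<omega> = Y v \<omega> - Y s \<omega>"
      using Hn_value[OF u] by blast
    obtain v' where v': "v' \<in> {0..T}" "\<bar>u - v'\<bar> \<le> T / 2 ^ m" "\<And>\<omega>. Hn m u \<omega> = Y v' \<omega> - Y s \<omega>"
      using Hn_value[OF u] by blast
    have "T / 2 ^ m \<le> T / 2 ^ n" using T_pos assms by (intro divide_left_mono power_increasing) auto
    then have d: "\<bar>v - v'\<bar> \<le> 2 * (T / 2 ^ n)" using v(2) v'(2) by linarith
    have "(\<integral>\<^sup>+\<omega>. ennreal ((Hn n u \<omega> - Hn m u \<omega>)\<^sup>2) \<partial>M) = (\<integral>\<^sup>+\<omega>. ennreal ((Y v \<omega> - Y v' \<omega>)\<^sup>2) \<partial>M)"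
      unfolding v(3) v'(3) by simp
    also have "\<dots> = ennreal (expectation (\<lambda>\<omega>. (Y v \<omega> - Y v' \<omega>)\<^sup>2))"
      by (rule nn_integral_eq_integral[OF regular_moments(1)[OF Y v'(1) v(1)]]) simp
    also have "\<dots> \<le> ennreal ((1 + C) * \<bar>v - v'\<bar> powr (2 / p))"
      by (rule ennreal_leI[OF regular_moments(2)[OF Y v'(1) v(1)]])
    also have "\<dots> \<le> ennreal ?K"
      using C0 p d by (intro ennreal_leI mult_left_mono powr_mono2) auto
    finally show "(\<integral>\<^sup>+\<omega>. ennreal ((Hn n u \<omega> - Hn m u \<omega>)\<^sup>2) \<partial>M) \<le> ennreal ?K" .
  qed
  also have "\<dots> = ennreal ?K * ennreal (t - s)"
    using st by (simp add: emeasure_restrict_space space_restrict_space)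
  also have "\<dots> \<le> ennreal ?K * ennreal T"
    using st by (intro mult_left_mono ennreal_leI) auto
  also have "\<dots> = ennreal (mesh_error n)"
    unfolding mesh_error_def using K T_pos by (simp add: ennreal_mult[symmetric])
  finally show ?thesis .
qed

private lemma Zn_diff:
  assumes "n \<le> m"
  shows "(\<integral>\<^sup>+\<omega>. ennreal ((Zn n \<omega> - Zn m \<omega>)\<^sup>2) \<partial>M) \<le> ennreal (mesh_error n)"
proof -
  have "(\<integral>\<^sup>+(u, \<omega>). ennreal ((Hn n u \<omega> - Hn m u \<omega>)\<^sup>2) \<partial>time_prob s t)
      = (\<integral>\<^sup>+\<omega>. ennreal ((Zn n \<omega> - Zn m \<omega>)\<^sup>2) \<partial>M)"
    by (rule simple_isometry_diff[OF B st(1,3)]) (rule coef_elementary, assumption)+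
  then show ?thesis using Hn_diff[OF assms] by simp
qed

private lemma Zn_conv: "AE \<omega> in M. (\<lambda>n. Zn n \<omega>) \<longlonglongrightarrow> Z \<omega>"
proof -
  have "Zn n \<omega> = dyadic_riemann T (\<lambda>u. Y u \<omega>) (\<lambda>u. B u \<omega>) n t
        - dyadic_riemann T (\<lambda>u. Y u \<omega>) (\<lambda>u. B u \<omega>) n s - Y s \<omega> * (B t \<omega> - B s \<omega>)" for n \<omega>
    using riemann_increment_eq_clipped_sum[OF T_pos st, where x = "\<lambda>u. Y u \<omega>" and y = "\<lambda>u. B u \<omega>" and n = n]
    by (simp add: simple_integral_def coef_def grid_def)
  then show ?thesis using conv by simp
qed

text \<open>
  The isometry turns the distance of two step processes into the distance of their integrals; then the
  finer one is sent to its almost sure limit.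
\<close>

private lemma Zn_error: "(\<integral>\<^sup>+\<omega>. ennreal ((Zn n \<omega> - Z \<omega>)\<^sup>2) \<partial>M) \<le> ennreal (mesh_error n)"
proof (rule nn_integral_Fatou_le[where start = n])
  have [measurable]: "Zn m \<in> borel_measurable M" for m
    by (rule Hn_Zn_measurable)
  show "(\<lambda>\<omega>. ennreal ((Zn n \<omega> - Zn m \<omega>)\<^sup>2)) \<in> borel_measurable M" for m by measurable
  show "AE \<omega> in M. (\<lambda>m. ennreal ((Zn n \<omega> - Zn m \<omega>)\<^sup>2)) \<longlonglongrightarrow> ennreal ((Zn n \<omega> - Z \<omega>)\<^sup>2)"
    using Zn_conv by eventually_elim (intro tendsto_ennrealI tendsto_intros)
qed (rule Zn_diff)

private lemma Hn_conv: "AE (u, \<omega>) in time_prob s t. (\<lambda>m. Hn m u \<omega>) \<longlonglongrightarrow> H u \<omega>"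
proof (rule AE_time_prob)
  show "AE \<omega> in M. \<forall>u\<in>{s..t}. (\<lambda>m. Hn m u \<omega>) \<longlonglongrightarrow> H u \<omega>"
    using Ycont
  proof eventually_elim
    case (elim \<omega>)
    show ?case
    proof
      fix u assume u: "u \<in> {s..t}"
      have "\<exists>v. v \<in> {0..T} \<and> \<bar>u - v\<bar> \<le> T / 2 ^ m \<and> Hn m u \<omega> = Y v \<omega> - Y s \<omega>" for m
        by (rule Hn_value[OF u, of m]) blast
      then have "\<exists>v. \<forall>m. v m \<in> {0..T} \<and> \<bar>u - v m\<bar> \<le> T / 2 ^ m \<and> Hn m u \<omega> = Y (v m) \<omega> - Y s \<omega>"
        by (intro choice allI)
      then obtain v where v: "\<And>m. v m \<in> {0..T}" "\<And>m. \<bar>u - v m\<bar> \<le> T / 2 ^ m"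
        "\<And>m. Hn m u \<omega> = Y (v m) \<omega> - Y s \<omega>" by blast
      have "(\<lambda>m. v m - u) \<longlonglongrightarrow> 0"
        by (rule Lim_null_comparison[OF _ T_over_power_tendsto_0[of T]])
          (use v(2) in \<open>simp add: abs_minus_commute\<close>)
      then have "v \<longlonglongrightarrow> u" by (simp add: LIM_zero_iff)
      then have "(\<lambda>m. Y (v m) \<omega>) \<longlonglongrightarrow> Y u \<omega>"
        by (rule continuous_on_tendsto_compose[OF elim]) (use u st v(1) in auto)
      then show "(\<lambda>m. Hn m u \<omega>) \<longlonglongrightarrow> H u \<omega>" unfolding v(3) by (intro tendsto_intros)
    qed
  qed
qed

private lemma Hn_measurable: "(\<lambda>x. Hn m (fst x) (snd x)) \<in> borel_measurable (time_prob s t)"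
  using Hn_Zn_measurable(1)[of m] unfolding case_prod_unfold by blast

private lemma H_measurable: "(\<lambda>(u, \<omega>). H u \<omega>) \<in> borel_measurable (completion (time_prob s t))"
proof (rule measurable_completion_AE)
  show "(\<lambda>x. lim (\<lambda>m. Hn m (fst x) (snd x))) \<in> borel_measurable (time_prob s t)"
    by (intro borel_measurable_lim_metric Hn_measurable)
  show "AE x in time_prob s t. (case x of (u, \<omega>) \<Rightarrow> H u \<omega>) = lim (\<lambda>m. Hn m (fst x) (snd x))"
    using Hn_conv by eventually_elim (auto intro: limI[symmetric])
qed

text \<open>
  The integrand is only an almost everywhere limit of step processes; Fatou's lemma accepts that.
\<close>

private lemma Hn_error: "(\<integral>\<^sup>+(u, \<omega>). ennreal ((Hn n u \<omega> - H u \<omega>)\<^sup>2) \<partial>time_prob s t) \<le> ennreal (mesh_error n)"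
proof (rule nn_integral_Fatou_le[where start = n])
  note [measurable] = Hn_measurable
  show "(\<lambda>(u, \<omega>). ennreal ((Hn n u \<omega> - Hn m u \<omega>)\<^sup>2)) \<in> borel_measurable (time_prob s t)" for m
    unfolding case_prod_unfold by measurable
  show "AE x in time_prob s t. (\<lambda>m. case x of (u, \<omega>) \<Rightarrow> ennreal ((Hn n u \<omega> - Hn m u \<omega>)\<^sup>2))
      \<longlonglongrightarrow> (case x of (u, \<omega>) \<Rightarrow> ennreal ((Hn n u \<omega> - H u \<omega>)\<^sup>2))"
    using Hn_conv
  proof eventually_elim
    case (elim x)
    then show ?case by (cases x) (auto intro!: tendsto_ennrealI tendsto_intros)
  qed
qed (rule Hn_diff)

text \<open>
  The truncation error of a coefficient at level \<open>c\<close> is at most its fourth power divided by \<open>c\<^sup>2\<close>.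
\<close>

private lemma Zn'_error: "(\<integral>\<^sup>+\<omega>. ennreal ((Zn' n \<omega> - Zn n \<omega>)\<^sup>2) \<partial>M) \<le> ennreal (trunc_error n)"
proof -
  let ?c = "real (Suc n)"
  let ?\<zeta> = "\<lambda>k \<omega>. tcoef n k \<omega> - coef n k \<omega>"
  let ?K = "C * T powr (4 / p) / ?c\<^sup>2"
  have K: "0 \<le> ?K" using C0 by (intro divide_nonneg_nonneg mult_nonneg_nonneg) auto
  have m: "integrable M (\<lambda>\<omega>. coef n k \<omega> ^ 4)" "expectation (\<lambda>\<omega>. coef n k \<omega> ^ 4) \<le> C * T powr (4 / p)"
    if k: "k < 2 ^ n" for k
  proof -
    note R = regular_moments(3,4)[OF Y _ left_range[OF k], of s]
    show "integrable M (\<lambda>\<omega>. coef n k \<omega> ^ 4)" unfolding coef_def using R(1) st by simp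
    have "C * \<bar>min (dyadic T n k) t - s\<bar> powr (4 / p) \<le> C * T powr (4 / p)"
      using C0 p left_range[OF k] st by (intro mult_left_mono powr_mono2) auto
    then show "expectation (\<lambda>\<omega>. coef n k \<omega> ^ 4) \<le> C * T powr (4 / p)"
      unfolding coef_def using R(2) st by simp
  qed
  have sqle: "(?\<zeta> k \<omega>)\<^sup>2 \<le> coef n k \<omega> ^ 4 / ?c\<^sup>2" for k \<omega>
    unfolding tcoef_def using truncation_error[of ?c "coef n k \<omega>"] by (simp add: power2_commute)
  have int: "integrable M (\<lambda>\<omega>. (?\<zeta> k \<omega>)\<^sup>2)" if k: "k < 2 ^ n" for k
  proof (rule Bochner_Integration.integrable_bound)
    show "integrable M (\<lambda>\<omega>. coef n k \<omega> ^ 4 / ?c\<^sup>2)" using m(1)[OF k] by simp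
    have [measurable]: "coef n k \<in> borel_measurable M" "tcoef n k \<in> borel_measurable M"
      using elementary_measurable coef_elementary[OF k] tcoef_elementary[OF k] by blast+
    show "(\<lambda>\<omega>. (?\<zeta> k \<omega>)\<^sup>2) \<in> borel_measurable M" by measurable
    show "AE \<omega> in M. norm ((?\<zeta> k \<omega>)\<^sup>2) \<le> norm (coef n k \<omega> ^ 4 / ?c\<^sup>2)"
      using sqle by (intro AE_I2) (auto intro: order_trans[OF _ abs_ge_self])
  qed
  have e: "elementary (grid n k) (grid n (Suc k)) (?\<zeta> k)" if k: "k \<in> {..<2 ^ n}" for k
    using coef_elementary[of k n] k coef_adapted[of k n] tcoef_adapted[of k n] int[of k]
    by (auto simp: elementary_def)
  have Ele: "expectation (\<lambda>\<omega>. (?\<zeta> k \<omega>)\<^sup>2) \<le> ?K" if k: "k < 2 ^ n" for k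
  proof -
    have "expectation (\<lambda>\<omega>. (?\<zeta> k \<omega>)\<^sup>2) \<le> expectation (\<lambda>\<omega>. coef n k \<omega> ^ 4 / ?c\<^sup>2)"
      using m(1)[OF k] by (intro integral_mono int[OF k] sqle) auto
    also have "\<dots> = expectation (\<lambda>\<omega>. coef n k \<omega> ^ 4) / ?c\<^sup>2" by simp
    also have "\<dots> \<le> ?K" by (intro divide_right_mono m(2)[OF k]) auto
    finally show ?thesis .
  qed
  have gm: "grid n i \<le> grid n j" if "i \<le> j" for i j
    using that grid_range(3) by (rule lift_Suc_mono_le[rotated])
  let ?S = "\<lambda>\<omega>. \<Sum>k<2 ^ n. ?\<zeta> k \<omega> * (B (grid n (Suc k)) \<omega> - B (grid n k) \<omega>)"
  have "expectation (\<lambda>\<omega>. (?S \<omega>)\<^sup>2) = (\<Sum>k<2 ^ n. expectation (\<lambda>\<omega>. (?\<zeta> k \<omega>)\<^sup>2) * (grid n (Suc k) - grid n k))"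
  proof (rule ito_isometry_disjoint[OF B])
    fix i j :: nat assume "i \<noteq> j"
    then consider "Suc i \<le> j" | "Suc j \<le> i" by linarith
    then show "{grid n i<..grid n (Suc i)} \<inter> {grid n j<..grid n (Suc j)} = {}"
      by cases (use gm[of "Suc i" j] gm[of "Suc j" i] in auto)
  qed (use e in auto)
  also have "\<dots> \<le> (\<Sum>k<2 ^ n. ?K * (grid n (Suc k) - grid n k))"
    using grid_range(3) by (intro sum_mono mult_right_mono Ele) auto
  also have "\<dots> = ?K * (t - s)"
  proof -
    have "(\<Sum>k<2 ^ n. grid n (Suc k) - grid n k) = t - s"
      using sum_lessThan_telescope[of "grid n" "2 ^ n"] st by (simp add: grid_def clip_def)
    then show ?thesis by (simp only: sum_distrib_left[symmetric])
  qed
  also have "\<dots> \<le> ?K * T" using K st by (intro mult_left_mono) auto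
  also have "\<dots> = trunc_error n" by (simp add: trunc_error_def)
  finally have le: "expectation (\<lambda>\<omega>. (?S \<omega>)\<^sup>2) \<le> trunc_error n" .
  have "Zn' n \<omega> - Zn n \<omega> = ?S \<omega>" for \<omega>
    by (simp add: simple_integral_def sum_subtractf left_diff_distrib)
  then have "(\<integral>\<^sup>+\<omega>. ennreal ((Zn' n \<omega> - Zn n \<omega>)\<^sup>2) \<partial>M) = (\<integral>\<^sup>+\<omega>. ennreal ((?S \<omega>)\<^sup>2) \<partial>M)" by simp
  also have "\<dots> = ennreal (expectation (\<lambda>\<omega>. (?S \<omega>)\<^sup>2))"
    by (rule nn_integral_eq_integral[OF ito_isometry_elementary(1)[OF B finite_lessThan e]]) auto
  also have "\<dots> \<le> ennreal (trunc_error n)" by (rule ennreal_leI[OF le])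
  finally show ?thesis .
qed

private lemma Hn'_error: "(\<integral>\<^sup>+(u, \<omega>). ennreal ((Hn' n u \<omega> - Hn n u \<omega>)\<^sup>2) \<partial>time_prob s t) \<le> ennreal (trunc_error n)"
proof -
  have "(\<integral>\<^sup>+(u, \<omega>). ennreal ((Hn' n u \<omega> - Hn n u \<omega>)\<^sup>2) \<partial>time_prob s t)
      = (\<integral>\<^sup>+\<omega>. ennreal ((Zn' n \<omega> - Zn n \<omega>)\<^sup>2) \<partial>M)"
    by (rule simple_isometry_diff[OF B st(1,3)]) (rule coef_elementary tcoef_elementary, assumption)+
  then show ?thesis using Zn'_error by simp
qed

private lemma errors_tendsto_0: "(\<lambda>n. 2 * ennreal (trunc_error n) + 2 * ennreal (mesh_error n)) \<longlonglongrightarrow> 0"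
proof -
  have a: "(\<lambda>n. inverse (real (Suc n))) \<longlonglongrightarrow> 0" by (rule LIMSEQ_inverse_real_of_nat)
  have "(\<lambda>n. C * T powr (4 / p) * T * (inverse (real (Suc n)) * inverse (real (Suc n)))) \<longlonglongrightarrow> C * T powr (4 / p) * T * (0 * 0)"
    by (intro tendsto_mult tendsto_const a)
  moreover have "trunc_error = (\<lambda>n. C * T powr (4 / p) * T * (inverse (real (Suc n)) * inverse (real (Suc n))))"
    by (intro ext) (simp only: trunc_error_def power2_eq_square divide_inverse inverse_mult_distrib)
  ultimately have 1: "trunc_error \<longlonglongrightarrow> 0" by simp
  have "(\<lambda>n. 2 * (T / 2 ^ n)) \<longlonglongrightarrow> 2 * 0" by (intro tendsto_mult tendsto_const T_over_power_tendsto_0)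
  then have "(\<lambda>n. (2 * (T / 2 ^ n)) powr (2 / p)) \<longlonglongrightarrow> 0"
    using p T_pos by (intro tendsto_zero_powrI[where b = "2 / p"]) auto
  then have "(\<lambda>n. (1 + C) * (2 * (T / 2 ^ n)) powr (2 / p) * T) \<longlonglongrightarrow> (1 + C) * 0 * T"
    by (intro tendsto_mult tendsto_const)
  then have 2: "mesh_error \<longlonglongrightarrow> 0" by (simp add: mesh_error_def[abs_def])
  have "(\<lambda>n. 2 * ennreal (trunc_error n) + 2 * ennreal (mesh_error n)) \<longlonglongrightarrow> 2 * ennreal 0 + 2 * ennreal 0"
    by (intro tendsto_add ennreal_tendsto_cmult tendsto_ennrealI 1 2) (simp_all add: less_top[symmetric])
  then show ?thesis by simp
qed

text \<open>
  The truncated step processes and their integrals have squared \<open>L\<^sup>2\<close> distance at most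
  \<open>trunc_error + mesh_error\<close> from the integrand and from \<open>Z\<close>, up to the factor \<open>2\<close> in \<open>(a - b)\<^sup>2 \<le> 2 (a - c)\<^sup>2 + 2 (b - c)\<^sup>2\<close>.
\<close>

lemma riemann_limit_has_ito_integral: "has_ito_integral M F s t (\<lambda>u \<omega>. Y u \<omega> - Y s \<omega>) B Z"
  unfolding has_ito_integral_def
proof (intro conjI ballI exI allI)
  fix u assume "u \<in> {s..t}"
  then show "(\<lambda>\<omega>. Y u \<omega> - Y s \<omega>) \<in> borel_measurable (F u)"
    using st by (intro regular_increment_adapted[OF Y]) auto
next
  show "(\<lambda>(u, \<omega>). Y u \<omega> - Y s \<omega>) \<in> borel_measurable (completion (time_prob s t))" by (rule H_measurable)
  show "Z \<in> borel_measurable M" by (rule Zm)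
  show "simple_integrand M F s t (2 ^ n) (grid n) (tcoef n)" for n by (rule tcoef_simple)
  have le1: "(\<integral>\<^sup>+(u, \<omega>). ennreal ((Hn' n u \<omega> - H u \<omega>)\<^sup>2) \<partial>completion (time_prob s t))
      \<le> 2 * ennreal (trunc_error n) + 2 * ennreal (mesh_error n)" for n
  proof -
    let ?P = "completion (time_prob s t)"
    have m: "(\<lambda>(u, \<omega>). Hn' n u \<omega>) \<in> borel_measurable ?P" "(\<lambda>(u, \<omega>). Hn n u \<omega>) \<in> borel_measurable ?P"
      by (rule measurable_completion, rule Hn_Zn_measurable Hn'_Zn'_measurable)+
    have "(\<integral>\<^sup>+(u, \<omega>). ennreal ((Hn' n u \<omega> - H u \<omega>)\<^sup>2) \<partial>?P)
        \<le> 2 * (\<integral>\<^sup>+(u, \<omega>). ennreal ((Hn' n u \<omega> - Hn n u \<omega>)\<^sup>2) \<partial>?P)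
          + 2 * (\<integral>\<^sup>+(u, \<omega>). ennreal ((H u \<omega> - Hn n u \<omega>)\<^sup>2) \<partial>?P)"
      using nn_integral_square_diff_le[OF m(1) H_measurable m(2)] unfolding case_prod_unfold .
    also have "\<dots> \<le> 2 * ennreal (trunc_error n) + 2 * ennreal (mesh_error n)"
      using Hn'_error[of n] Hn_error[of n]
      unfolding nn_integral_completion power2_commute[of "H _ _" "Hn n _ _"]
      by (intro add_mono mult_left_mono) auto
    finally show ?thesis .
  qed
  show "(\<lambda>n. \<integral>\<^sup>+(u, \<omega>). ennreal ((Hn' n u \<omega> - (Y u \<omega> - Y s \<omega>))\<^sup>2) \<partial>completion (time_prob s t)) \<longlonglongrightarrow> 0"
    by (rule tendsto_sandwich[OF always_eventually always_eventually tendsto_const errors_tendsto_0])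
      (use le1 in auto)
  have le2: "(\<integral>\<^sup>+\<omega>. ennreal ((Zn' n \<omega> - Z \<omega>)\<^sup>2) \<partial>M)
      \<le> 2 * ennreal (trunc_error n) + 2 * ennreal (mesh_error n)" for n
  proof -
    have m: "Zn' n \<in> borel_measurable M" "Zn n \<in> borel_measurable M"
      by (rule Hn_Zn_measurable Hn'_Zn'_measurable)+
    have "(\<integral>\<^sup>+\<omega>. ennreal ((Zn' n \<omega> - Z \<omega>)\<^sup>2) \<partial>M)
        \<le> 2 * (\<integral>\<^sup>+\<omega>. ennreal ((Zn' n \<omega> - Zn n \<omega>)\<^sup>2) \<partial>M) + 2 * (\<integral>\<^sup>+\<omega>. ennreal ((Z \<omega> - Zn n \<omega>)\<^sup>2) \<partial>M)"
      by (rule nn_integral_square_diff_le[OF m(1) Zm m(2)])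
    also have "\<dots> \<le> 2 * ennreal (trunc_error n) + 2 * ennreal (mesh_error n)"
      using Zn'_error[of n] Zn_error[of n]
      unfolding power2_commute[of "Z _" "Zn n _"]
      by (intro add_mono mult_left_mono) auto
    finally show ?thesis .
  qed
  show "(\<lambda>n. \<integral>\<^sup>+\<omega>. ennreal ((Zn' n \<omega> - Z \<omega>)\<^sup>2) \<partial>M) \<longlonglongrightarrow> 0"
    by (rule tendsto_sandwich[OF always_eventually always_eventually tendsto_const errors_tendsto_0])
      (use le2 in auto)
qed

end

end

section \<open>Continuous versions and integration by parts\<close>

lemma dyadic_riemann_continuous:
  assumes "continuous_on {0..T} y" and T: "0 < T"
  shows "continuous_on {0..T} (dyadic_riemann T x y n)"
proof -
  have "continuous_on {0..T} (\<lambda>t. y (min (dyadic T n k) t))" for k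
    by (rule continuous_on_compose2[OF assms(1)]) (use T in \<open>auto simp: dyadic_def intro!: continuous_intros\<close>)
  then show ?thesis unfolding dyadic_riemann_def[abs_def] by (intro continuous_intros)
qed

definition riemann_limit :: "real \<Rightarrow> (real \<Rightarrow> real) \<Rightarrow> (real \<Rightarrow> real) \<Rightarrow> real \<Rightarrow> real" where
  "riemann_limit T x y t = lim (\<lambda>n. dyadic_riemann T x y n t)"

lemma riemann_limit:
  assumes u: "uniformly_convergent_on {0..T} (dyadic_riemann T x y)"
  shows "t \<in> {0..T} \<Longrightarrow> (\<lambda>n. dyadic_riemann T x y n t) \<longlonglongrightarrow> riemann_limit T x y t"
    and "0 < T \<Longrightarrow> continuous_on {0..T} y \<Longrightarrow> continuous_on {0..T} (riemann_limit T x y)"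
proof -
  have ul: "uniform_limit {0..T} (dyadic_riemann T x y) (riemann_limit T x y) sequentially"
    using u unfolding uniformly_convergent_uniform_limit_iff by (simp add: riemann_limit_def[abs_def])
  show "t \<in> {0..T} \<Longrightarrow> (\<lambda>n. dyadic_riemann T x y n t) \<longlonglongrightarrow> riemann_limit T x y t"
    by (rule tendsto_uniform_limitI[OF ul])
  show "continuous_on {0..T} (riemann_limit T x y)" if "0 < T" "continuous_on {0..T} y"
    by (rule uniform_limit_theorem[OF _ ul])
      (use dyadic_riemann_continuous[OF that(2,1)] in \<open>auto intro: always_eventually\<close>)
qed

text \<open>
  Telescopes the product rule \<open>\<Delta>(x y) = x \<Delta>y + y \<Delta>x + \<Delta>x \<Delta>y\<close>. Beyond \<open>t\<close> all clipped increments vanish,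
  so there the integrand may as well be evaluated at \<open>t\<close>.
\<close>

lemma riemann_by_parts:
  assumes T: "0 < T" and t: "t \<in> {0..T}"
  shows "dyadic_riemann T x y n t + dyadic_riemann T y x n t
    + (\<Sum>k<2 ^ n. (x (min (dyadic T n (Suc k)) t) - x (min (dyadic T n k) t))
        * (y (min (dyadic T n (Suc k)) t) - y (min (dyadic T n k) t))) = x t * y t - x 0 * y 0"
proof -
  let ?m = "\<lambda>k. min (dyadic T n k) t"
  have m: "f (dyadic T n k) * (g (?m (Suc k)) - g (?m k)) = f (?m k) * (g (?m (Suc k)) - g (?m k))"
    for f g :: "real \<Rightarrow> real" and k
  proof (cases "dyadic T n k \<le> t")
    case False
    moreover have "dyadic T n k \<le> dyadic T n (Suc k)" using T by (simp add: dyadic_mono)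
    ultimately have "?m (Suc k) = t" "?m k = t" by auto
    then show ?thesis by simp
  qed (simp add: min_absorb1)
  have "dyadic_riemann T x y n t + dyadic_riemann T y x n t
      + (\<Sum>k<2 ^ n. (x (?m (Suc k)) - x (?m k)) * (y (?m (Suc k)) - y (?m k)))
      = (\<Sum>k<2 ^ n. x (?m (Suc k)) * y (?m (Suc k)) - x (?m k) * y (?m k))"
    unfolding dyadic_riemann_def m sum.distrib[symmetric]
    by (intro sum.cong refl) (simp add: algebra_simps)
  also have "\<dots> = x t * y t - x 0 * y 0"
    using sum_lessThan_telescope[of "\<lambda>k. x (?m k) * y (?m k)" "2 ^ n"] t
    by (simp add: min_absorb1 min_absorb2)
  finally show ?thesis .
qed

text \<open>
  What Property (RIE) asks of an ordered pair of coordinates beyond the regularity of each one.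
\<close>

definition enhanced_pair :: "real \<Rightarrow> real \<Rightarrow> (real \<Rightarrow> real) \<Rightarrow> (real \<Rightarrow> real) \<Rightarrow> bool" where
  "enhanced_pair T q x y \<longleftrightarrow>
     uniformly_convergent_on {0..T} (dyadic_riemann T x y) \<and> area_controlled T q x y"

lemma enhanced_pairI:
  assumes "0 < T" "0 < q" "1 < c" "continuous_on {0..T} x" "continuous_on {0..T} y"
    "summable_increments T q c x" "summable_increments T q c y" "summable_corrections T q c x y"
  shows "enhanced_pair T q x y"
  using riemann_uniformly_convergent[OF assms] area_control[OF assms] by (simp add: enhanced_pair_def)

lemma rate_exists:
  fixes p q :: real
  assumes "0 < p" "p < q"
  obtains c where "1 < c" "0 < c" "c < 2 powr (q / p - 1)"
proof -
  have "0 < q / p - 1" using assms by simp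
  then have "1 < 2 powr (q / p - 1)" by simp
  then obtain c where "1 < c" "c < 2 powr (q / p - 1)" using dense by blast
  then show ?thesis by (intro that[of c]) auto
qed

context filtered_prob
begin

lemma AE_path_control:
  assumes Y: "regular_process p C Y" and p: "0 < p" "p < q" "q \<le> 4"
    and cont: "AE \<omega> in M. continuous_on {0..T} (\<lambda>u. Y u \<omega>)"
  shows "AE \<omega> in M. path_controlled T q (\<lambda>u. Y u \<omega>)"
proof -
  obtain c where c: "1 < c" "0 < c" "c < 2 powr (q / p - 1)" using rate_exists[OF p(1,2)] .
  have q: "0 < q" using p by simp
  show ?thesis using regular_summable_increments[OF Y p c(2,3)] cont
    by eventually_elim (rule path_control[OF T_pos q c(1)])
qed

lemma AE_enhanced_regular_bm:
  assumes B: "scalar_bm B" and Y: "regular_process p C Y" and p: "2 < p" "p < q" "q \<le> 4"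
    and cont: "AE \<omega> in M. continuous_on {0..T} (\<lambda>u. Y u \<omega>)" "AE \<omega> in M. continuous_on {0..T} (\<lambda>u. B u \<omega>)"
  shows "AE \<omega> in M. enhanced_pair T q (\<lambda>u. Y u \<omega>) (\<lambda>u. B u \<omega>)"
proof -
  have p': "0 < p" "2 \<le> p" "0 < q" using p by auto
  obtain c where c: "1 < c" "0 < c" "c < 2 powr (q / p - 1)" using rate_exists[OF p'(1) p(2)] .
  show ?thesis
    using regular_summable_increments[OF Y p'(1) p(2,3) c(2,3)]
      regular_summable_increments[OF scalar_bm_regular[OF B p(1)] p'(1) p(2,3) c(2,3)]
      regular_bm_summable_corrections[OF B Y p'(2) p(2,3) c(2,3)] cont
    by eventually_elim (rule enhanced_pairI[OF T_pos p'(3) c(1)])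
qed

lemma AE_enhanced_bm_holder:
  assumes B: "scalar_bm B" and x: "regular_process p C (\<lambda>t _. x t)" and p: "2 < p" "p < q" "q \<le> 4"
    and cont: "continuous_on {0..T} x" "AE \<omega> in M. continuous_on {0..T} (\<lambda>u. B u \<omega>)"
  shows "AE \<omega> in M. enhanced_pair T q (\<lambda>u. B u \<omega>) x"
proof -
  have p': "0 < p" "2 \<le> p" "0 < q" using p by auto
  obtain c where c: "1 < c" "0 < c" "c < 2 powr (q / p - 1)" using rate_exists[OF p'(1) p(2)] .
  show ?thesis
    using regular_summable_increments[OF x p'(1) p(2,3) c(2,3)]
      regular_summable_increments[OF scalar_bm_regular[OF B p(1)] p'(1) p(2,3) c(2,3)]
      bm_holder_summable_corrections[OF B x p'(2) p(2,3) c(2,3)] cont(2)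
    by eventually_elim (rule enhanced_pairI[OF T_pos p'(3) c(1) _ cont(1)])
qed

lemma dyadic_riemann_measurable:
  assumes B: "scalar_bm B" and Y: "regular_process p C Y" and t: "t \<in> {0..T}"
  shows "(\<lambda>\<omega>. dyadic_riemann T (\<lambda>u. Y u \<omega>) (\<lambda>u. B u \<omega>) n t) \<in> borel_measurable M"
  unfolding dyadic_riemann_def
proof (intro borel_measurable_sum borel_measurable_times borel_measurable_diff)
  fix k :: nat assume k: "k \<in> {..<2 ^ n}"
  have r: "dyadic T n k \<in> {0..T}" "dyadic T n (Suc k) \<in> {0..T}"
    using dyadic_in_range[OF T_pos] k by auto
  show "Y (dyadic T n k) \<in> borel_measurable M" using regular_process_measurable[OF Y] r by auto
  show "B (min (dyadic T n (Suc k)) t) \<in> borel_measurable M" "B (min (dyadic T n k) t) \<in> borel_measurable M"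
    using bm_measurable[OF B] r t by auto
qed

text \<open>
  For fixed \<open>t\<close> the sum is an elementary integral with second moment at most a multiple of \<open>2\<^sup>-\<^sup>2\<^sup>n\<^sup>/\<^sup>p\<close>.
  The second moments are summable, so the squares are almost surely summable. For
  \<open>p > 2\<close> the Hoelder exponents alone do not give this, because \<open>1/p + 1/2 < 1\<close>.
\<close>

lemma AE_cross_variation_tendsto_0:
  assumes B: "scalar_bm B" and x: "regular_process p C (\<lambda>t _. x t)" and p: "0 < p" and t: "t \<in> {0..T}"
  shows "AE \<omega> in M. (\<lambda>n. \<Sum>k<2 ^ n. (x (min (dyadic T n (Suc k)) t) - x (min (dyadic T n k) t))
        * (B (min (dyadic T n (Suc k)) t) \<omega> - B (min (dyadic T n k) t) \<omega>)) \<longlonglongrightarrow> 0"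
proof -
  let ?m = "\<lambda>n k. min (dyadic T n k) t"
  let ?Q = "\<lambda>n \<omega>. \<Sum>k<2 ^ n. (x (?m n (Suc k)) - x (?m n k)) * (B (?m n (Suc k)) \<omega> - B (?m n k) \<omega>)"
  have C: "0 \<le> C" using x by (simp add: regular_process_def)
  have r: "0 \<le> ?m n k" "?m n k \<le> ?m n (Suc k)" "?m n (Suc k) \<le> T" "?m n (Suc k) - ?m n k \<le> T / 2 ^ n" for n k
  proof -
    have "dyadic T n (Suc k) = dyadic T n k + T / 2 ^ n" by (simp add: dyadic_def field_simps)
    moreover have "0 < T / 2 ^ n" using T_pos by simp
    moreover have "0 \<le> dyadic T n k" using T_pos by (simp add: dyadic_def)
    ultimately show "0 \<le> ?m n k" "?m n k \<le> ?m n (Suc k)" "?m n (Suc k) \<le> T" "?m n (Suc k) - ?m n k \<le> T / 2 ^ n"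
      using t by (auto simp: min_def)
  qed
  have e: "elementary (?m n k) (?m n (Suc k)) (\<lambda>_. x (?m n (Suc k)) - x (?m n k))" for n k
    using r[of n k] by (simp add: elementary_def)
  have gm: "?m n i \<le> ?m n j" if "i \<le> j" for n i j
    using that by (intro min.mono) (simp_all add: dyadic_mono[OF T_pos])
  let ?g = "\<lambda>n. (1 + C) * T powr (2 / p) * T * (2 powr (- 2 / p)) ^ n"
  have "AE \<omega> in M. summable (\<lambda>n. (?Q n \<omega>)\<^sup>2)"
  proof (rule AE_summableI[where g = ?g])
    fix n
    show "(\<lambda>\<omega>. (?Q n \<omega>)\<^sup>2) \<in> borel_measurable M"
      by (intro borel_measurable_power borel_measurable_sum elementary_square(3)[OF B e])
    show "0 \<le> ?g n" using C T_pos by (intro mult_nonneg_nonneg) auto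
    have "expectation (\<lambda>\<omega>. (?Q n \<omega>)\<^sup>2)
        = (\<Sum>k<2 ^ n. expectation (\<lambda>_. (x (?m n (Suc k)) - x (?m n k))\<^sup>2) * (?m n (Suc k) - ?m n k))"
    proof (rule ito_isometry_disjoint[OF B _ e])
      fix i j :: nat assume "i \<noteq> j"
      then consider "Suc i \<le> j" | "Suc j \<le> i" by linarith
      then show "{?m n i<..?m n (Suc i)} \<inter> {?m n j<..?m n (Suc j)} = {}"
      proof cases
        case 1 from gm[OF 1, of n] show ?thesis by auto
      next
        case 2 from gm[OF 2, of n] show ?thesis by auto
      qed
    qed simp
    also have "\<dots> \<le> (\<Sum>k<2 ^ n. ((1 + C) * (T / 2 ^ n) powr (2 / p)) * (?m n (Suc k) - ?m n k))"
    proof (intro sum_mono mult_right_mono)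
      fix k
      have "expectation (\<lambda>_. (x (?m n (Suc k)) - x (?m n k))\<^sup>2) \<le> (1 + C) * (?m n (Suc k) - ?m n k) powr (2 / p)"
        by (rule regular_square(2)[OF x r(1,2,3)])
      also have "\<dots> \<le> (1 + C) * (T / 2 ^ n) powr (2 / p)"
        using r(2,4)[of n k] C p by (intro mult_left_mono powr_mono2) auto
      finally show "expectation (\<lambda>_. (x (?m n (Suc k)) - x (?m n k))\<^sup>2) \<le> (1 + C) * (T / 2 ^ n) powr (2 / p)" .
      show "0 \<le> ?m n (Suc k) - ?m n k" using r(2)[of n k] by simp
    qed
    also have "\<dots> = ((1 + C) * (T / 2 ^ n) powr (2 / p)) * (\<Sum>k<2 ^ n. ?m n (Suc k) - ?m n k)"
      by (simp only: sum_distrib_left)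
    also have "(\<Sum>k<2 ^ n. ?m n (Suc k) - ?m n k) = t"
      using sum_lessThan_telescope[of "?m n" "2 ^ n"] t by (simp add: min_absorb1 min_absorb2)
    also have "((1 + C) * (T / 2 ^ n) powr (2 / p)) * t \<le> ((1 + C) * (T / 2 ^ n) powr (2 / p)) * T"
      using C t by (intro mult_left_mono) auto
    also have "(T / 2 ^ n) powr (2 / p) = T powr (2 / p) * (2 powr (- 2 / p)) ^ n"
    proof -
      have "(2 ^ n :: real) powr (2 / p) = (2 powr (2 / p)) ^ n"
        by (simp add: powr_realpow[symmetric] powr_powr mult.commute)
      then show ?thesis unfolding powr_divide by (simp add: powr_minus power_inverse divide_inverse)
    qed
    finally have "expectation (\<lambda>\<omega>. (?Q n \<omega>)\<^sup>2) \<le> ?g n" by (simp add: mult_ac)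
    then show "(\<integral>\<^sup>+\<omega>. ennreal ((?Q n \<omega>)\<^sup>2) \<partial>M) \<le> ennreal (?g n)"
      by (intro nn_integral_le_dominated[where g = "\<lambda>\<omega>. (?Q n \<omega>)\<^sup>2"] ito_isometry_elementary(1)[OF B _ e]) auto
  next
    have "(2 :: real) powr (- 2 / p) < 1" using p by (intro powr_less_one) auto
    then show "summable ?g" by (intro summable_mult summable_geometric) auto
  qed auto
  then show ?thesis
  proof eventually_elim
    case (elim \<omega>)
    then have "(\<lambda>n. (?Q n \<omega>)\<^sup>2) \<longlonglongrightarrow> 0" by (rule summable_LIMSEQ_zero)
    then have "(\<lambda>n. sqrt ((?Q n \<omega>)\<^sup>2)) \<longlonglongrightarrow> sqrt 0" by (rule tendsto_real_sqrt)
    then show ?case by (simp add: tendsto_rabs_zero_iff)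
  qed
qed

text \<open>
  The exceptional null set can be chosen for all dyadic \<open>t\<close> at once; both sides are continuous in \<open>t\<close>.
\<close>

lemma AE_integration_by_parts:
  assumes B: "scalar_bm B" and x: "regular_process p C (\<lambda>t _. x t)" and p: "0 < p"
    and cont: "continuous_on {0..T} x" "AE \<omega> in M. continuous_on {0..T} (\<lambda>u. B u \<omega>)"
    and conv: "AE \<omega> in M. uniformly_convergent_on {0..T} (dyadic_riemann T x (\<lambda>u. B u \<omega>))"
      "AE \<omega> in M. uniformly_convergent_on {0..T} (dyadic_riemann T (\<lambda>u. B u \<omega>) x)"
  shows "AE \<omega> in M. \<forall>t\<in>{0..T}. riemann_limit T x (\<lambda>u. B u \<omega>) t + riemann_limit T (\<lambda>u. B u \<omega>) x t
    = x t * B t \<omega> - x 0 * B 0 \<omega>"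
proof -
  have "AE \<omega> in M. \<forall>n. \<forall>k\<in>{..2 ^ n}. (\<lambda>m. \<Sum>j<2 ^ m. (x (min (dyadic T m (Suc j)) (dyadic T n k)) - x (min (dyadic T m j) (dyadic T n k)))
        * (B (min (dyadic T m (Suc j)) (dyadic T n k)) \<omega> - B (min (dyadic T m j) (dyadic T n k)) \<omega>)) \<longlonglongrightarrow> 0"
    unfolding AE_all_countable
    by (intro allI AE_finite_allI AE_cross_variation_tendsto_0[OF B x p] dyadic_in_range[OF T_pos]) auto
  then show ?thesis using cont(2) conv
  proof eventually_elim
    case (elim \<omega>)
    let ?B = "\<lambda>u. B u \<omega>"
    let ?f = "\<lambda>t. riemann_limit T x ?B t + riemann_limit T ?B x t - (x t * ?B t - x 0 * ?B 0)"
    have z: "?f (dyadic T n k) = 0" if k: "k \<le> 2 ^ n" for n k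
    proof -
      let ?t = "dyadic T n k"
      have t: "?t \<in> {0..T}" by (rule dyadic_in_range[OF T_pos k])
      let ?Q = "\<lambda>m. \<Sum>j<2 ^ m. (x (min (dyadic T m (Suc j)) ?t) - x (min (dyadic T m j) ?t))
        * (?B (min (dyadic T m (Suc j)) ?t) - ?B (min (dyadic T m j) ?t))"
      have "(\<lambda>m. dyadic_riemann T x ?B m ?t + dyadic_riemann T ?B x m ?t + ?Q m) \<longlonglongrightarrow>
          riemann_limit T x ?B ?t + riemann_limit T ?B x ?t + 0"
        by (intro tendsto_add riemann_limit(1) elim t) (use elim(1) k in auto)
      then have "(\<lambda>m :: nat. x ?t * ?B ?t - x 0 * ?B 0) \<longlonglongrightarrow> riemann_limit T x ?B ?t + riemann_limit T ?B x ?t + 0"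
        using riemann_by_parts[OF T_pos t, of x ?B] by (simp only:)
      from LIMSEQ_unique[OF this tendsto_const] show ?thesis by simp
    qed
    have fc: "continuous_on {0..T} ?f"
      by (intro continuous_intros riemann_limit(2) T_pos cont(1) elim)
    show ?case
    proof
      fix t assume t: "t \<in> {0..T}"
      have "(\<lambda>n. ?f (dyadic T n (dyadic_floor T n t))) \<longlonglongrightarrow> ?f t"
        by (rule continuous_on_tendsto_compose[OF fc dyadic_floor_tendsto[OF T_pos t] t])
          (intro always_eventually allI dyadic_in_range[OF T_pos] dyadic_floor(4)[OF T_pos t])
      then have "(\<lambda>n :: nat. 0) \<longlonglongrightarrow> ?f t" unfolding z[OF dyadic_floor(4)[OF T_pos t]] .
      from LIMSEQ_unique[OF this tendsto_const] show "riemann_limit T x ?B t + riemann_limit T ?B x t = x t * ?B t - x 0 * ?B 0"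
        by simp
    qed
  qed
qed

text \<open>
  The pathwise limit that serves as the continuous version of \<open>\<integral>\<^sub>s\<^sup>t (Y\<^sub>u - Y\<^sub>s) \<otimes> dW\<^sub>u\<close>.
\<close>

definition riemann_tensor ::
  "(real \<Rightarrow> 'a \<Rightarrow> real ^ 'm) \<Rightarrow> (real \<Rightarrow> 'a \<Rightarrow> real ^ 'n) \<Rightarrow> real \<Rightarrow> real \<Rightarrow> 'a \<Rightarrow> real ^ 'n ^ 'm" where
  "riemann_tensor Y W s t \<omega> = (\<chi> i j. riemann_limit T (\<lambda>u. Y u \<omega> $ i) (\<lambda>u. W u \<omega> $ j) t
     - riemann_limit T (\<lambda>u. Y u \<omega> $ i) (\<lambda>u. W u \<omega> $ j) s - Y s \<omega> $ i * (W t \<omega> $ j - W s \<omega> $ j))"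

lemma riemann_tensor_is_ito_tensor_version:
  fixes Y :: "real \<Rightarrow> 'a \<Rightarrow> real ^ 'm" and W :: "real \<Rightarrow> 'a \<Rightarrow> real ^ 'n"
  assumes W: "\<And>j. scalar_bm (\<lambda>u \<omega>. W u \<omega> $ j)" and Y: "\<And>i. regular_process p C (\<lambda>u \<omega>. Y u \<omega> $ i)"
    and p: "2 < p" "p < 4"
    and cont: "AE \<omega> in M. continuous_on {0..T} (\<lambda>u. Y u \<omega>)" "AE \<omega> in M. continuous_on {0..T} (\<lambda>u. W u \<omega>)"
  shows "is_ito_tensor_version M F T Y W (riemann_tensor Y W)"
proof -
  have Yc: "AE \<omega> in M. continuous_on {0..T} (\<lambda>u. Y u \<omega> $ i)" for i
    using cont(1) by eventually_elim (intro continuous_intros)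
  have Wc: "AE \<omega> in M. continuous_on {0..T} (\<lambda>u. W u \<omega> $ j)" for j
    using cont(2) by eventually_elim (intro continuous_intros)
  have conv: "AE \<omega> in M. uniformly_convergent_on {0..T} (dyadic_riemann T (\<lambda>u. Y u \<omega> $ i) (\<lambda>u. W u \<omega> $ j))" for i j
    using AE_enhanced_regular_bm[OF W[of j] Y[of i] p(1) p(2) order_refl Yc[of i] Wc[of j]]
    by eventually_elim (simp add: enhanced_pair_def)
  have p0: "0 < p" using p by simp
  have "has_ito_integral M F s t (\<lambda>u \<omega>. Y u \<omega> $ i - Y s \<omega> $ i) (\<lambda>u \<omega>. W u \<omega> $ j) (\<lambda>\<omega>. riemann_tensor Y W s t \<omega> $ i $ j)"
    if st: "(s, t) \<in> Simplex T" for s t i j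
  proof (rule riemann_limit_has_ito_integral[OF W Y p0 Yc])
    show "0 \<le> s" "s \<le> t" "t \<le> T" using st by (auto simp: Simplex_def)
    then have st': "s \<in> {0..T}" "t \<in> {0..T}" by auto
    show "(\<lambda>\<omega>. riemann_tensor Y W s t \<omega> $ i $ j) \<in> borel_measurable M"
      unfolding riemann_tensor_def riemann_limit_def vec_lambda_beta
      using bm_measurable[OF W] regular_process_measurable[OF Y] st'
      by (intro borel_measurable_diff borel_measurable_times borel_measurable_lim_metric
          dyadic_riemann_measurable[OF W Y]) auto
    show "AE \<omega> in M. (\<lambda>n. dyadic_riemann T (\<lambda>u. Y u \<omega> $ i) (\<lambda>u. W u \<omega> $ j) n t
         - dyadic_riemann T (\<lambda>u. Y u \<omega> $ i) (\<lambda>u. W u \<omega> $ j) n s - Y s \<omega> $ i * (W t \<omega> $ j - W s \<omega> $ j))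
         \<longlonglongrightarrow> riemann_tensor Y W s t \<omega> $ i $ j"
      using conv[of i j] unfolding riemann_tensor_def vec_lambda_beta
      by eventually_elim (intro tendsto_diff tendsto_const riemann_limit(1) st')
  qed
  moreover have "AE \<omega> in M. continuous_on (Simplex T) (\<lambda>(s, t). riemann_tensor Y W s t \<omega>)"
  proof -
    have "AE \<omega> in M. \<forall>i j. uniformly_convergent_on {0..T} (dyadic_riemann T (\<lambda>u. Y u \<omega> $ i) (\<lambda>u. W u \<omega> $ j))"
      by (intro eventually_all_finite conv)
    then show ?thesis using cont
    proof eventually_elim
      case (elim \<omega>)
      have "continuous_on {0..T} (riemann_limit T (\<lambda>u. Y u \<omega> $ i) (\<lambda>u. W u \<omega> $ j))" for i j
        using elim by (intro riemann_limit(2) T_pos) (auto intro!: continuous_intros)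
      then have c: "continuous_on (Simplex T) (\<lambda>z. riemann_limit T (\<lambda>u. Y u \<omega> $ i) (\<lambda>u. W u \<omega> $ j) (g z))"
        if "continuous_on (Simplex T) g" "g ` Simplex T \<subseteq> {0..T}" for i j g
        using that by (rule continuous_on_compose2)
      have S: "fst ` Simplex T \<subseteq> {0..T}" "snd ` Simplex T \<subseteq> {0..T}" by (auto simp: Simplex_def)
      have f: "continuous_on (Simplex T) fst" "continuous_on (Simplex T) snd" by (auto intro!: continuous_intros)
      have y: "continuous_on (Simplex T) (\<lambda>z. Y (fst z) \<omega>)" by (rule continuous_on_compose2[OF elim(2) f(1) S(1)])
      have w: "continuous_on (Simplex T) (\<lambda>z. W (fst z) \<omega>)" "continuous_on (Simplex T) (\<lambda>z. W (snd z) \<omega>)"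
        by (rule continuous_on_compose2[OF elim(3) f(1) S(1)], rule continuous_on_compose2[OF elim(3) f(2) S(2)])
      show ?case unfolding riemann_tensor_def case_prod_unfold
        by (intro continuous_on_vec_lambda continuous_on_diff continuous_on_mult c f S
            continuous_on_component y w)
    qed
  qed
  ultimately show ?thesis by (auto simp: is_ito_tensor_version_def)
qed

text \<open>
  At each pair of dyadic points the versions agree almost surely; the pairs are countable and, rounding
  both times down on the same grid, dense in the simplex.
\<close>

lemma ito_tensor_version_unique:
  fixes W :: "real \<Rightarrow> 'a \<Rightarrow> real ^ 'n"
  assumes W: "\<And>j. scalar_bm (\<lambda>u \<omega>. W u \<omega> $ j)"
    and J: "is_ito_tensor_version M F T Y W J" and J': "is_ito_tensor_version M F T Y W J'"
  shows "AE \<omega> in M. \<forall>(s, t)\<in>Simplex T. J s t \<omega> = J' s t \<omega>"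
proof -
  have fixed: "AE \<omega> in M. J s t \<omega> = J' s t \<omega>" if st: "(s, t) \<in> Simplex T" for s t
  proof -
    have r: "0 \<le> s" "s \<le> t" "t \<le> T" using st by (auto simp: Simplex_def)
    have "AE \<omega> in M. J s t \<omega> $ i $ j = J' s t \<omega> $ i $ j" for i j
      using J J' st unfolding is_ito_tensor_version_def
      by (intro ito_integral_unique[OF W[of j] r, where H = "\<lambda>u \<omega>. (Y u \<omega> - Y s \<omega>) $ i"]) auto
    then have "AE \<omega> in M. \<forall>i j. J s t \<omega> $ i $ j = J' s t \<omega> $ i $ j" by (intro eventually_all_finite)
    then show ?thesis by eventually_elim (simp add: vec_eq_iff)
  qed
  have "AE \<omega> in M. \<forall>n. \<forall>k\<in>{..2 ^ n}. \<forall>l\<in>{k..2 ^ n}. J (dyadic T n k) (dyadic T n l) \<omega> = J' (dyadic T n k) (dyadic T n l) \<omega>"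
    unfolding AE_all_countable
  proof (intro allI AE_finite_allI fixed)
    fix n k l :: nat assume "k \<in> {..2 ^ n}" "l \<in> {k..2 ^ n}"
    then show "(dyadic T n k, dyadic T n l) \<in> Simplex T"
      using dyadic_in_range[OF T_pos, of k n] dyadic_in_range[OF T_pos, of l n] dyadic_mono[OF T_pos, of n k l]
      by (auto simp: Simplex_def)
  qed auto
  moreover have "AE \<omega> in M. continuous_on (Simplex T) (\<lambda>(s, t). J s t \<omega>)"
    "AE \<omega> in M. continuous_on (Simplex T) (\<lambda>(s, t). J' s t \<omega>)"
    using J J' by (auto simp: is_ito_tensor_version_def)
  ultimately show ?thesis
  proof eventually_elim
    case (elim \<omega>)
    show ?case
    proof (clarify)
      fix s t assume st: "(s, t) \<in> Simplex T"
      then have r: "s \<in> {0..T}" "t \<in> {0..T}" "s \<le> t" by (auto simp: Simplex_def)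
      let ?k = "\<lambda>n. dyadic_floor T n s" and ?l = "\<lambda>n. dyadic_floor T n t"
      let ?z = "\<lambda>n. (dyadic T n (?k n), dyadic T n (?l n))"
      have kl: "?k n \<le> ?l n" "?k n \<le> 2 ^ n" "?l n \<le> 2 ^ n" for n
        using dyadic_floor_mono[OF T_pos r(3)] dyadic_floor(4)[OF T_pos] r by auto
      have zS: "?z n \<in> Simplex T" for n
        using dyadic_in_range[OF T_pos kl(2)] dyadic_in_range[OF T_pos kl(3)] dyadic_mono[OF T_pos] kl(1)
        by (auto simp: Simplex_def)
      have z: "?z \<longlonglongrightarrow> (s, t)" by (intro tendsto_Pair dyadic_floor_tendsto[OF T_pos] r)
      have "(\<lambda>n. case ?z n of (s, t) \<Rightarrow> J s t \<omega>) \<longlonglongrightarrow> (case (s, t) of (s, t) \<Rightarrow> J s t \<omega>)"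
        by (rule continuous_on_tendsto_compose[OF elim(2) z st]) (intro always_eventually allI zS)
      moreover have "(\<lambda>n. case ?z n of (s, t) \<Rightarrow> J' s t \<omega>) \<longlonglongrightarrow> (case (s, t) of (s, t) \<Rightarrow> J' s t \<omega>)"
        by (rule continuous_on_tendsto_compose[OF elim(3) z st]) (intro always_eventually allI zS)
      moreover have "(case ?z n of (s, t) \<Rightarrow> J s t \<omega>) = (case ?z n of (s, t) \<Rightarrow> J' s t \<omega>)" for n
        using elim(1) kl by simp
      ultimately show "J s t \<omega> = J' s t \<omega>" using LIMSEQ_unique by simp
    qed
  qed
qed

text \<open>
  A version exists, so the chosen one is a version, and versions are indistinguishable.
\<close>

lemma ito_tensor_eq_riemann_tensor:
  fixes Y :: "real \<Rightarrow> 'a \<Rightarrow> real ^ 'm" and W :: "real \<Rightarrow> 'a \<Rightarrow> real ^ 'n"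
  assumes W: "\<And>j. scalar_bm (\<lambda>u \<omega>. W u \<omega> $ j)" and Y: "\<And>i. regular_process p C (\<lambda>u \<omega>. Y u \<omega> $ i)"
    and p: "2 < p" "p < 4"
    and cont: "AE \<omega> in M. continuous_on {0..T} (\<lambda>u. Y u \<omega>)" "AE \<omega> in M. continuous_on {0..T} (\<lambda>u. W u \<omega>)"
  shows "AE \<omega> in M. \<forall>(s, t)\<in>Simplex T. ito_tensor M F T Y W s t \<omega> = riemann_tensor Y W s t \<omega>"
proof -
  note R = riemann_tensor_is_ito_tensor_version[OF assms]
  have "is_ito_tensor_version M F T Y W (ito_tensor M F T Y W)"
    unfolding ito_tensor_def by (rule someI[of "is_ito_tensor_version M F T Y W", OF R])
  from ito_tensor_version_unique[OF W this R] show ?thesis .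
qed

end

lemma canonical_lift_component:
  assumes conv: "\<And>k l. uniformly_convergent_on {0..T} (dyadic_riemann T (\<lambda>u. X u $ k) (\<lambda>u. X u $ l))"
    and st: "(s, t) \<in> Simplex T"
  shows "snd (canonical_lift dyadic_size (dyadic T) X) s t $ k $ l
    = riemann_limit T (\<lambda>u. X u $ k) (\<lambda>u. X u $ l) t - riemann_limit T (\<lambda>u. X u $ k) (\<lambda>u. X u $ l) s
      - X s $ k * (X t $ l - X s $ l)"
proof -
  have "RIE_integral dyadic_size (dyadic T) X u $ k $ l = riemann_limit T (\<lambda>u. X u $ k) (\<lambda>u. X u $ l) u"
    if u: "u \<in> {0..T}" for u
  proof -
    have "(\<lambda>n. riemann_sum (dyadic_size n) (dyadic T n) X u)
        \<longlonglongrightarrow> (\<chi> k l. riemann_limit T (\<lambda>u. X u $ k) (\<lambda>u. X u $ l) u)"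
      by (intro vec_tendstoI) (simp add: riemann_sum_component riemann_limit(1)[OF conv u])
    from limI[OF this] show ?thesis by (simp add: RIE_integral_def)
  qed
  then show ?thesis using st by (auto simp: canonical_lift_def tensor_def Simplex_def)
qed

section \<open>The joint lift\<close>

theorem theorem4p3:
  fixes T p :: real
    and M :: "'a measure" and F :: "real \<Rightarrow> 'a measure"
    and \<eta> :: "real \<Rightarrow> real ^ 'd" and W :: "real \<Rightarrow> 'a \<Rightarrow> real ^ 'e"
  assumes "T > 0"
    and "2 < p" and "p < 3"
    and "usual_conditions M F T"
    and "holder_on T (1 / p) \<eta>"
    and "RIE T p dyadic_size (dyadic T) \<eta>"
    and "brownian_motion M F T W"
  shows "(\<forall>p'. p < p' \<and> p' < 3 \<longrightarrow>
            (AE \<omega> in M. RIE T p' dyadic_size (dyadic T) (\<lambda>t. join_vec (\<eta> t) (W t \<omega>)))) \<and>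
         (AE \<omega> in M.
            let \<eta>2 = snd (canonical_lift dyadic_size (dyadic T) \<eta>);
                WW = (\<lambda>s t. ito_tensor M F T W W s t \<omega>);
                I = (\<lambda>s t. ito_tensor M F T (\<lambda>u _. \<eta> u) W s t \<omega>);
                \<Lambda> = canonical_lift dyadic_size (dyadic T) (\<lambda>t. join_vec (\<eta> t) (W t \<omega>))
            in (\<forall>t\<in>{0..T}. fst \<Lambda> t = join_vec (\<eta> t) (W t \<omega>)) \<and>
               (\<forall>(s, t)\<in>Simplex T.
                  snd \<Lambda> s t =
                    block_mat (\<eta>2 s t) (I s t)
                      (tensor (W t \<omega> - W s \<omega>) (\<eta> t - \<eta> s) - transpose (I s t)) (WW s t)))"
proof -
  note p = \<open>2 < p\<close> \<open>p < 3\<close> and T = \<open>T > 0\<close>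
  have p0: "0 < p" using p by simp
  interpret prob_space M using assms(4) by (simp add: usual_conditions_def)
  interpret filtered_prob M F T
    by unfold_locales (use assms(1,4) in \<open>auto simp: usual_conditions_def Simplex_def\<close>)
  have bm: "scalar_bm (\<lambda>u \<omega>. W u \<omega> $ j)" for j by (rule scalar_bm_component[OF assms(7)])
  note Wreg = scalar_bm_regular[OF bm p(1)]
  have Wcont: "AE \<omega> in M. continuous_on {0..T} (\<lambda>u. W u \<omega>)"
    using assms(7) by (simp add: brownian_motion_def)
  have Wcont': "AE \<omega> in M. continuous_on {0..T} (\<lambda>u. W u \<omega> $ j)" for j
    using Wcont by eventually_elim (intro continuous_intros)
  obtain K where K: "\<And>s t. s \<in> {0..T} \<Longrightarrow> t \<in> {0..T} \<Longrightarrow> dist (\<eta> s) (\<eta> t) \<le> K * \<bar>t - s\<bar> powr (1 / p)"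
    using assms(5) unfolding holder_on_def by blast
  have hold: "dist (\<eta> s) (\<eta> t) \<le> \<bar>K\<bar> * \<bar>t - s\<bar> powr (1 / p)" if "s \<in> {0..T}" "t \<in> {0..T}" for s t
    by (rule order_trans[OF K[OF that] mult_right_mono[OF abs_ge_self]]) simp
  have ereg: "regular_process p (\<bar>K\<bar> ^ 4) (\<lambda>t _. \<eta> t $ i)" for i
  proof (rule holder_regular)
    fix s t assume "0 \<le> s" "s \<le> t" "t \<le> T"
    then show "\<bar>\<eta> t $ i - \<eta> s $ i\<bar> \<le> \<bar>K\<bar> * (t - s) powr (1 / p)"
      using hold[of s t] component_le_norm_cart[of "\<eta> t - \<eta> s" i] by (simp add: dist_norm norm_minus_commute)
  qed simp
  have econt: "continuous_on {0..T} \<eta>"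
    unfolding continuous_on_def
  proof
    fix s assume s: "s \<in> {0..T}"
    have "((\<lambda>t. \<bar>K\<bar> * \<bar>t - s\<bar> powr (1 / p)) \<longlongrightarrow> \<bar>K\<bar> * 0) (at s within {0..T})"
    proof (intro tendsto_mult tendsto_const tendsto_zero_powrI[where b = "1 / p"])
      show "((\<lambda>t. \<bar>t - s\<bar>) \<longlongrightarrow> 0) (at s within {0..T})"
        by (rule tendsto_eq_intros refl | simp)+
    qed (use p0 in auto)
    then have lim: "((\<lambda>t. \<bar>K\<bar> * \<bar>t - s\<bar> powr (1 / p)) \<longlongrightarrow> 0) (at s within {0..T})" by simp
    have "\<forall>\<^sub>F t in at s within {0..T}. norm (dist (\<eta> t) (\<eta> s)) \<le> \<bar>K\<bar> * \<bar>t - s\<bar> powr (1 / p)"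
      using hold[OF s] by (auto simp: eventually_at_filter dist_commute)
    then have "((\<lambda>t. dist (\<eta> t) (\<eta> s)) \<longlongrightarrow> 0) (at s within {0..T})"
      by (rule Lim_null_comparison[OF _ lim])
    then show "(\<eta> \<longlongrightarrow> \<eta> s) (at s within {0..T})"
      by (subst tendsto_dist_iff)
  qed
  have econt': "continuous_on {0..T} (\<lambda>u. \<eta> u $ i)" for i using econt by (intro continuous_intros)
  have pairs: "AE \<omega> in M. \<forall>k l. enhanced_pair T q (\<lambda>u. join_vec (\<eta> u) (W u \<omega>) $ k) (\<lambda>u. join_vec (\<eta> u) (W u \<omega>) $ l)"
    if q: "p < q" "q < 3" for q
  proof (intro eventually_all_finite)
    fix k l :: "'d + 'e"
    have q4: "q \<le> 4" using q by simp
    show "AE \<omega> in M. enhanced_pair T q (\<lambda>u. join_vec (\<eta> u) (W u \<omega>) $ k) (\<lambda>u. join_vec (\<eta> u) (W u \<omega>) $ l)"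
    proof (cases k)
      case (Inl i)
      note k = this
      show ?thesis
      proof (cases l)
        case (Inl i')
        have "enhanced_pair T q (\<lambda>u. \<eta> u $ i) (\<lambda>u. \<eta> u $ i')"
          unfolding enhanced_pair_def
          using RIE_dyadicD(3)[OF T p0 assms(6)] area_controlled_mono_exponent[OF T p0 _ RIE_dyadicD(4)[OF T p0 assms(6)]] q
          by auto
        then show ?thesis by (simp add: k Inl join_vec_def)
      next
        case (Inr j)
        show ?thesis
          using AE_enhanced_regular_bm[OF bm ereg p(1) q(1) q4 _ Wcont', of i j] econt'
          by (simp add: k Inr join_vec_def)
      qed
    next
      case (Inr j)
      note k = this
      show ?thesis
      proof (cases l)
        case (Inl i)
        show ?thesis
          using AE_enhanced_bm_holder[OF bm ereg p(1) q(1) q4 econt' Wcont', of j i]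
          by (simp add: k Inl join_vec_def)
      next
        case (Inr j')
        show ?thesis
          using AE_enhanced_regular_bm[OF bm[of j'] Wreg[of j] p(1) q(1) q4 Wcont'[of j] Wcont'[of j']]
          by (simp add: k Inr join_vec_def)
      qed
    qed
  qed
  have paths: "AE \<omega> in M. \<forall>k. path_controlled T q (\<lambda>u. join_vec (\<eta> u) (W u \<omega>) $ k)"
    if q: "p < q" "q < 3" for q
  proof (intro eventually_all_finite)
    fix k :: "'d + 'e"
    have q4: "q \<le> 4" using q by simp
    show "AE \<omega> in M. path_controlled T q (\<lambda>u. join_vec (\<eta> u) (W u \<omega>) $ k)"
    proof (cases k)
      case (Inl i)
      show ?thesis using AE_path_control[OF ereg p0 q(1) q4, of i] econt' by (simp add: Inl join_vec_def)
    next
      case (Inr j)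
      show ?thesis using AE_path_control[OF Wreg p0 q(1) q4 Wcont', of j] by (simp add: Inr join_vec_def)
    qed
  qed
  have joint_cont: "continuous_on {0..T} (\<lambda>t. join_vec (\<eta> t) (W t \<omega>))"
    if "continuous_on {0..T} (\<lambda>u. W u \<omega>)" for \<omega>
    unfolding join_vec_def
  proof (rule continuous_on_vec_lambda)
    fix k :: "'d + 'e"
    show "continuous_on {0..T} (\<lambda>t. case k of Inl i \<Rightarrow> \<eta> t $ i | Inr j \<Rightarrow> W t \<omega> $ j)"
      using econt that by (cases k) (auto intro!: continuous_intros)
  qed
  have first: "AE \<omega> in M. RIE T p' dyadic_size (dyadic T) (\<lambda>t. join_vec (\<eta> t) (W t \<omega>))"
    if p': "p < p'" "p' < 3" for p'
    using pairs[OF p'] paths[OF p'] Wcont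
  proof eventually_elim
    case (elim \<omega>)
    have q: "0 < p'" using p' p by simp
    show ?case
    proof (rule RIE_dyadicI[OF T q RIE_dyadicD(1,2)[OF T p0 assms(6)] joint_cont[OF elim(3)]])
    qed (use elim in \<open>auto simp: enhanced_pair_def\<close>)
  qed
  \<comment> \<open>Any exponent in \<open>(p, 3)\<close> gives the convergence of the Riemann sums.\<close>
  define q where "q = (p + 3) / 2"
  have q: "p < q" "q < 3" using p by (auto simp: q_def)
  have p4: "p < 4" using p by simp
  have conv: "AE \<omega> in M. \<forall>k l. uniformly_convergent_on {0..T}
      (dyadic_riemann T (\<lambda>u. join_vec (\<eta> u) (W u \<omega>) $ k) (\<lambda>u. join_vec (\<eta> u) (W u \<omega>) $ l))"
    using pairs[OF q] by eventually_elim (simp add: enhanced_pair_def)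
  have convx: "AE \<omega> in M. uniformly_convergent_on {0..T} (dyadic_riemann T (\<lambda>u. \<eta> u $ i) (\<lambda>u. W u \<omega> $ j))"
    "AE \<omega> in M. uniformly_convergent_on {0..T} (dyadic_riemann T (\<lambda>u. W u \<omega> $ j) (\<lambda>u. \<eta> u $ i))" for i j
  proof -
    show "AE \<omega> in M. uniformly_convergent_on {0..T} (dyadic_riemann T (\<lambda>u. \<eta> u $ i) (\<lambda>u. W u \<omega> $ j))"
      using conv by eventually_elim (drule spec[of _ "Inl i"], drule spec[of _ "Inr j"], simp add: join_vec_def)
    show "AE \<omega> in M. uniformly_convergent_on {0..T} (dyadic_riemann T (\<lambda>u. W u \<omega> $ j) (\<lambda>u. \<eta> u $ i))"
      using conv by eventually_elim (drule spec[of _ "Inr j"], drule spec[of _ "Inl i"], simp add: join_vec_def)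
  qed
  have parts: "AE \<omega> in M. \<forall>i j. \<forall>t\<in>{0..T}. riemann_limit T (\<lambda>u. \<eta> u $ i) (\<lambda>u. W u \<omega> $ j) t
      + riemann_limit T (\<lambda>u. W u \<omega> $ j) (\<lambda>u. \<eta> u $ i) t = \<eta> t $ i * W t \<omega> $ j - \<eta> 0 $ i * W 0 \<omega> $ j"
    by (intro eventually_all_finite AE_integration_by_parts[OF bm ereg p0 econt' Wcont' convx])
  have II: "AE \<omega> in M. \<forall>(s, t)\<in>Simplex T. ito_tensor M F T (\<lambda>u _. \<eta> u) W s t \<omega> = riemann_tensor (\<lambda>u _. \<eta> u) W s t \<omega>"
    by (rule ito_tensor_eq_riemann_tensor[OF bm ereg p(1) p4]) (use econt Wcont in auto)
  have WW: "AE \<omega> in M. \<forall>(s, t)\<in>Simplex T. ito_tensor M F T W W s t \<omega> = riemann_tensor W W s t \<omega>"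
    by (rule ito_tensor_eq_riemann_tensor[OF bm Wreg p(1) p4 Wcont Wcont])
  have second: "AE \<omega> in M. \<forall>(s, t)\<in>Simplex T.
      snd (canonical_lift dyadic_size (dyadic T) (\<lambda>t. join_vec (\<eta> t) (W t \<omega>))) s t
      = block_mat (snd (canonical_lift dyadic_size (dyadic T) \<eta>) s t) (ito_tensor M F T (\<lambda>u _. \<eta> u) W s t \<omega>)
          (tensor (W t \<omega> - W s \<omega>) (\<eta> t - \<eta> s) - transpose (ito_tensor M F T (\<lambda>u _. \<eta> u) W s t \<omega>))
          (ito_tensor M F T W W s t \<omega>)"
    using conv parts II WW
  proof eventually_elim
    case (elim \<omega>)
    let ?X = "\<lambda>t. join_vec (\<eta> t) (W t \<omega>)"
    show ?case
    proof clarify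
      fix s t assume st: "(s, t) \<in> Simplex T"
      then have r: "s \<in> {0..T}" "t \<in> {0..T}" by (auto simp: Simplex_def)
      have I: "ito_tensor M F T (\<lambda>u _. \<eta> u) W s t \<omega> = riemann_tensor (\<lambda>u _. \<eta> u) W s t \<omega>"
        and V: "ito_tensor M F T W W s t \<omega> = riemann_tensor W W s t \<omega>"
        using elim(3,4) st by auto
      have \<Lambda>: "snd (canonical_lift dyadic_size (dyadic T) ?X) s t $ k $ l
        = riemann_limit T (\<lambda>u. ?X u $ k) (\<lambda>u. ?X u $ l) t - riemann_limit T (\<lambda>u. ?X u $ k) (\<lambda>u. ?X u $ l) s
          - ?X s $ k * (?X t $ l - ?X s $ l)" for k l
        by (rule canonical_lift_component[OF _ st]) (use elim(1) in blast)
      have E: "snd (canonical_lift dyadic_size (dyadic T) \<eta>) s t $ i $ i'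
        = riemann_limit T (\<lambda>u. \<eta> u $ i) (\<lambda>u. \<eta> u $ i') t - riemann_limit T (\<lambda>u. \<eta> u $ i) (\<lambda>u. \<eta> u $ i') s
          - \<eta> s $ i * (\<eta> t $ i' - \<eta> s $ i')" for i i'
        by (rule canonical_lift_component[OF RIE_dyadicD(3)[OF T p0 assms(6)] st])
      \<comment> \<open>Integration by parts expresses the \<open>(W, \<eta>)\<close> limits through the \<open>(\<eta>, W)\<close> limits.\<close>
      have P: "riemann_limit T (\<lambda>u. W u \<omega> $ j) (\<lambda>u. \<eta> u $ i) v
          = \<eta> v $ i * W v \<omega> $ j - \<eta> 0 $ i * W 0 \<omega> $ j - riemann_limit T (\<lambda>u. \<eta> u $ i) (\<lambda>u. W u \<omega> $ j) v"
        if "v \<in> {0..T}" for i j v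
      proof -
        from elim(2) that have "riemann_limit T (\<lambda>u. \<eta> u $ i) (\<lambda>u. W u \<omega> $ j) v
          + riemann_limit T (\<lambda>u. W u \<omega> $ j) (\<lambda>u. \<eta> u $ i) v = \<eta> v $ i * W v \<omega> $ j - \<eta> 0 $ i * W 0 \<omega> $ j" by blast
        then show ?thesis by linarith
      qed
      have "snd (canonical_lift dyadic_size (dyadic T) ?X) s t $ k $ l
        = block_mat (snd (canonical_lift dyadic_size (dyadic T) \<eta>) s t) (riemann_tensor (\<lambda>u _. \<eta> u) W s t \<omega>)
          (tensor (W t \<omega> - W s \<omega>) (\<eta> t - \<eta> s) - transpose (riemann_tensor (\<lambda>u _. \<eta> u) W s t \<omega>))
          (riemann_tensor W W s t \<omega>) $ k $ l" for k l
      proof (cases k)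
        case (Inl i)
        then show ?thesis unfolding \<Lambda> by (cases l) (simp_all add: join_vec_def block_mat_def E riemann_tensor_def)
      next
        case (Inr j)
        show ?thesis
        proof (cases l)
          case (Inl i)
          show ?thesis unfolding \<Lambda> \<open>k = Inr j\<close> Inl
            using P[OF r(1), of j i] P[OF r(2), of j i]
            by (simp add: join_vec_def block_mat_def riemann_tensor_def tensor_def transpose_def algebra_simps)
        next
          case (Inr j')
          then show ?thesis unfolding \<Lambda> \<open>k = Inr j\<close> by (simp add: join_vec_def block_mat_def riemann_tensor_def)
        qed
      qed
      then show "snd (canonical_lift dyadic_size (dyadic T) ?X) s t
        = block_mat (snd (canonical_lift dyadic_size (dyadic T) \<eta>) s t) (ito_tensor M F T (\<lambda>u _. \<eta> u) W s t \<omega>)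
          (tensor (W t \<omega> - W s \<omega>) (\<eta> t - \<eta> s) - transpose (ito_tensor M F T (\<lambda>u _. \<eta> u) W s t \<omega>))
          (ito_tensor M F T W W s t \<omega>)"
        unfolding I V by (simp add: vec_eq_iff)
    qed
  qed
  show ?thesis
    unfolding Let_def using first second by (auto simp: canonical_lift_def)
qed

end
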